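(* Let $m,n\in\mathbb{N}$ (positive integers). There exist $t_0>0$ and a function $C:X\to\mathbb{R}_+$ such that the following holds. For any $t>t_0$ there exists a compact subset $Q=Q(t)$ of $X$ such that for any $N\in\mathbb{N}$, $\delta\in(0,1)$ and $x\in X$, the set $$Z_x(Q,N,t,\delta):=\left\{u\in B_1^U:\frac1N\big|\{\ell\in\{1,\dots,N\}: g_{t\ell}ux\notin Q\}\big|\ge\delta\right\}$$ can be covered with (at most) $C(x)\,t^{3N}e^{(m+n-\delta)mntN}$ balls in $U$ of radius $e^{-(m+n)tN}$.
   Context: $X:=G/\Gamma$, where $G=\mathrm{SL}(m+n,\mathbb{R})$ and $\Gamma=\mathrm{SL}(m+n,\mathbb{Z})$, with $G$ acting by left translations. $g_t:=\mathrm{diag}(e^{nt},\dots,e^{nt},e^{-mt},\dots,e^{-mt})$, with $m$ entries $e^{nt}$ and $n$ entries $e^{-mt}$. $M_{m,n}$ is the space of real $m\times n$ matrices and $U=\{u_s:s\in M_{m,n}\}$ with $u_s:=\begin{pmatrix}I_m&s\\0&I_n\end{pmatrix}$. $U$ carries the distance $d_U$ induced by the Euclidean norm $\|\cdot\|$ on $M_{m,n}$ via $s\mapsto u_s$, balls in $U$ are with respect to $d_U$, and $B_r^U:=\{u_s:\|s\|<r\}$. *)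

theory Defs
  imports "HOL-Analysis.Analysis" "HOL-Algebra.Left_Coset"
begin

text \<open>
  The integers \<open>m, n \<ge> 1\<close> are the cardinalities of finite index types \<open>'m\<close>, \<open>'n\<close>, and
  \<open>(m+n) \<times> (m+n)\<close> matrices are indexed by the sum type \<open>'m + 'n\<close> (first \<open>m\<close> indices:
  \<open>Inl\<close>, last \<open>n\<close> indices: \<open>Inr\<close>).
\<close>

definition SLR :: "(real^'k^'k) monoid" where
  "SLR = \<lparr>carrier = {A. det A = 1}, monoid.mult = (**), one = mat 1\<rparr>"

definition SLZ :: "(real^'k^'k) set" where
  "SLZ = {A. det A = 1 \<and> (\<forall>i j. A $ i $ j \<in> \<int>)}"

definition XSpace :: "(real^'k^'k) set set" where
  "XSpace = lcosets\<^bsub>SLR\<^esub> SLZ"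

text \<open>The left translation action of \<open>G\<close> on \<open>X = G/\<Gamma>\<close>: \<open>g (h\<Gamma>) = {g y | y \<in> h\<Gamma>}\<close>.\<close>

definition act :: "real^'k^'k \<Rightarrow> (real^'k^'k) set \<Rightarrow> (real^'k^'k) set" where
  "act g x = g <#\<^bsub>SLR\<^esub> x"

text \<open>
  The quotient topology on \<open>X\<close>; \<open>G\<close> carries the subspace topology from the space of all matrices.
\<close>

definition XTop :: "(real^'k^'k) set topology" where
  "XTop = topology (\<lambda>V. V \<subseteq> XSpace \<and>
     openin (top_of_set (carrier SLR)) {g \<in> carrier SLR. g <#\<^bsub>SLR\<^esub> SLZ \<in> V})"

lemma openin_XTop:
  fixes V :: "(real^'k^'k) set set"
  shows "openin XTop V \<longleftrightarrow> V \<subseteq> XSpace \<and>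
     openin (top_of_set (carrier SLR)) {g \<in> carrier SLR. g <#\<^bsub>SLR\<^esub> SLZ \<in> V}"
proof -
  have "istopology (\<lambda>V::(real^'k^'k) set set. V \<subseteq> XSpace \<and>
     openin (top_of_set (carrier SLR)) {g \<in> carrier SLR. g <#\<^bsub>SLR\<^esub> SLZ \<in> V})"
    (is "istopology ?L")
    unfolding istopology_def
  proof (intro conjI allI impI)
    fix S T :: "(real^'k^'k) set set"
    assume "?L S" "?L T"
    moreover have "{g \<in> carrier SLR. g <#\<^bsub>SLR\<^esub> SLZ \<in> S \<inter> T} =
      {g \<in> carrier SLR. g <#\<^bsub>SLR\<^esub> SLZ \<in> S} \<inter> {g \<in> carrier SLR. g <#\<^bsub>SLR\<^esub> SLZ \<in> T}"
      by auto
    ultimately show "S \<inter> T \<subseteq> XSpace"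
      and "openin (top_of_set (carrier SLR)) {g \<in> carrier SLR. g <#\<^bsub>SLR\<^esub> SLZ \<in> S \<inter> T}"
      by (auto simp del: Int_iff)
  next
    fix K :: "(real^'k^'k) set set set"
    assume K: "\<forall>S\<in>K. ?L S"
    have "{g \<in> carrier SLR. g <#\<^bsub>SLR\<^esub> SLZ \<in> \<Union>K} =
      (\<Union>S\<in>K. {g \<in> carrier SLR. g <#\<^bsub>SLR\<^esub> SLZ \<in> S})"
      by auto
    moreover have "openin (top_of_set (carrier SLR))
        (\<Union>S\<in>K. {g \<in> carrier SLR. g <#\<^bsub>SLR\<^esub> SLZ \<in> S})"
      using K by (intro openin_Union) auto
    ultimately show "openin (top_of_set (carrier SLR)) {g \<in> carrier SLR. g <#\<^bsub>SLR\<^esub> SLZ \<in> \<Union>K}"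
      by (simp only:)
    show "\<Union>K \<subseteq> XSpace" using K by blast
  qed
  then show ?thesis
    unfolding XTop_def by (simp add: topology_inverse')
qed

lemma topspace_XTop: "topspace (XTop :: (real^'k^'k) set topology) = XSpace"
proof
  show "topspace XTop \<subseteq> XSpace"
    using openin_XTop openin_topspace by blast
  have "{g \<in> carrier SLR. g <#\<^bsub>SLR\<^esub> SLZ \<in> (XSpace :: (real^'k^'k) set set)} = carrier SLR"
    by (auto simp: XSpace_def LCOSETS_def)
  then have "openin XTop (XSpace :: (real^'k^'k) set set)"
    unfolding openin_XTop by (simp only: subset_refl simp_thms openin_subtopology_self)
  then show "(XSpace :: (real^'k^'k) set set) \<subseteq> topspace XTop"
    by (rule openin_subset)
qed

lemma quotient_map_XTop:
  "quotient_map (top_of_set (carrier SLR)) XTop (\<lambda>g. g <#\<^bsub>SLR\<^esub> SLZ)"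
  unfolding quotient_map_def topspace_XTop openin_XTop
  by (auto simp: XSpace_def LCOSETS_def)

definition gmat :: "real \<Rightarrow> real^('m::finite + 'n::finite)^('m + 'n)" where
  "gmat t = (\<chi> i j. if i = j
     then (case i of Inl _ \<Rightarrow> exp (real CARD('n) * t) | Inr _ \<Rightarrow> exp (- real CARD('m) * t))
     else 0)"

definition umat :: "real^'n^'m \<Rightarrow> real^('m::finite + 'n::finite)^('m + 'n)" where
  "umat s = (\<chi> i j. case (i, j) of
       (Inl a, Inr b) \<Rightarrow> s $ a $ b
     | _ \<Rightarrow> if i = j then 1 else 0)"

text \<open>The upper right block, i.e. the inverse of \<open>umat\<close> on its range.\<close>

definition ublock :: "real^('m::finite + 'n::finite)^('m + 'n) \<Rightarrow> real^'n^'m" where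
  "ublock u = (\<chi> a b. u $ Inl a $ Inr b)"

lemma ublock_umat [simp]: "ublock (umat s) = s"
  by (simp add: ublock_def umat_def vec_eq_iff)

definition USub :: "(real^('m::finite + 'n::finite)^('m + 'n)) set" where
  "USub = range umat"

text \<open>
  The norm on \<open>real^'n^'m\<close> is the square root of the sum of the squares of all entries, that is,
  the Euclidean norm on \<open>m \<times> n\<close> matrices.
\<close>

definition dU ::
  "real^('m::finite + 'n::finite)^('m + 'n) \<Rightarrow> real^('m + 'n)^('m + 'n) \<Rightarrow> real" where
  "dU u v = norm (ublock u - ublock v)"

definition ballU ::
  "real^('m::finite + 'n::finite)^('m + 'n) \<Rightarrow> real \<Rightarrow> (real^('m + 'n)^('m + 'n)) set" where
  "ballU c r = {u \<in> USub. dU c u < r}"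

definition BU :: "real \<Rightarrow> (real^('m::finite + 'n::finite)^('m + 'n)) set" where
  "BU r = {umat s | s. norm s < r}"

definition Zset :: "(real^('m::finite + 'n::finite)^('m + 'n)) set \<Rightarrow>
    (real^('m + 'n)^('m + 'n)) set set \<Rightarrow> nat \<Rightarrow> real \<Rightarrow> real \<Rightarrow>
    (real^('m + 'n)^('m + 'n)) set" where
  "Zset x Q N t \<delta> = {u \<in> BU 1.
     1 / real N * real (card {l \<in> {1..N}. act (gmat (t * real l)) (act u x) \<notin> Q}) \<ge> \<delta>}"

end

theory Submission
  imports Defs
begin

text \<open>
  Let \<open>d = m + n\<close>. The height of a lattice \<open>x\<close> is \<open>1\<close> plus the sum over \<open>0 < i < d\<close> of suitable
  powers of \<open>e ^ (i (d - i)) \<alpha>\<^sub>i(x)\<close>, where \<open>1 / \<alpha>\<^sub>i(x)\<close> is, up to a constant, the least covolume of a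
  sublattice of rank \<open>i\<close>. As in the work of Eskin, Margulis and Mozes, the average of the height over
  the points \<open>g\<^sub>t u x\<close>, with \<open>u\<close> in a unit box, is at most \<open>\<kappa>\<close> times the height of \<open>x\<close> plus a constant,
  with \<open>\<kappa>\<close> of the order \<open>t exp (- m n t)\<close>; the factor \<open>t\<close> comes from a logarithmic singularity at the
  critical exponents. The average is taken over a grid of mesh \<open>exp (- d t)\<close>, which replaces integration
  by counting. The boxes of size \<open>exp (- d t (N + 1))\<close> inside a box of size \<open>exp (- d t N)\<close> correspond to
  the points of such a grid, and the height is constant on each of them up to a bounded factor. Hence
  each visit to the part where the height is large cuts the number of boxes by the factor \<open>\<kappa>\<close>, up to a
  constant, and induction on \<open>N\<close> gives the covering.
\<close>

subsection \<open>Determinants as functions of their rows\<close>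

text \<open>For \<open>i \<le> m\<close> the flow multiplies the covolume of a typical rank
  \<open>i\<close> sublattice by \<open>exp (i n t)\<close>, so the power \<open>- m / i\<close>
  yields the factor \<open>exp (- m n t)\<close>; for \<open>i > m\<close> the annihilator, of rank
  \<open>m + n - i\<close>, takes over with exponent \<open>n / (m + n - i)\<close>. Every rank thus
  contracts at the same rate. At these exponents the integrals can diverge, but only
  logarithmically, and the mesh \<open>exp (- d t)\<close> cuts them off; this is the origin of the
  factor \<open>t\<close>. A reduced basis replaces the infinitely many sublattices of a given rank
  by the coordinate sublattices of one basis. It also replaces submodularity of covolumes: passing
  to a neighbouring rank means adding or removing one basis vector. Two demands on constants shape
  the end of the proof. Whatever enters to the power \<open>N\<close> is independent of
  \<open>t\<close>, so that for large \<open>t\<close> it is absorbed by the powers of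
  \<open>t\<close> in the bound. The function of \<open>x\<close> must not depend on
  \<open>t\<close> although the weight \<open>e\<close> and the compact set do; heights are
  therefore finally compared with those for \<open>e = 1\<close>.\<close>

definition rdet :: "('k::finite \<Rightarrow> real^'k) \<Rightarrow> real" where
  "rdet w = det (\<chi> c. w c)"

lemma rdet_add:
  fixes w :: "'k::finite \<Rightarrow> real^'k"
  shows "rdet (w(c := x + y)) = rdet (w(c := x)) + rdet (w(c := y))"
proof -
  have e: "(\<chi> i. (w(c := z)) i) = (\<chi> i. if i = c then z else w i)" for z :: "real^'k"
    by (simp add: vec_eq_iff)
  show ?thesis
    unfolding rdet_def e using det_row_add[of c "\<lambda>_. x" "\<lambda>_. y" w] .
qed

lemma rdet_scale:
  fixes w :: "'k::finite \<Rightarrow> real^'k"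
  shows "rdet (w(c := a *\<^sub>R x)) = a * rdet (w(c := x))"
proof -
  have e: "(\<chi> i. (w(c := z)) i) = (\<chi> i. if i = c then z else w i)" for z :: "real^'k"
    by (simp add: vec_eq_iff)
  have s: "a *\<^sub>R x = a *s x" by (simp add: vec_eq_iff)
  show ?thesis
    unfolding rdet_def e s by (rule det_row_mul)
qed

lemma linear_rdet: "linear (\<lambda>x. rdet (w(c := x)))"
  by (rule linearI) (auto simp: rdet_add rdet_scale)

lemma rdet_sum: "rdet (w(c := (\<Sum>i\<in>I. a i *\<^sub>R x i))) = (\<Sum>i\<in>I. a i * rdet (w(c := x i)))"
  using linear_sum[OF linear_rdet, of w c "\<lambda>i. a i *\<^sub>R x i" I] by (simp add: rdet_scale)

lemma rdet_expand: "rdet (w(c := x)) = (\<Sum>k\<in>UNIV. x $ k * rdet (w(c := axis k 1)))"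
proof -
  have "x = (\<Sum>k\<in>UNIV. x $ k *\<^sub>R axis k 1)"
    by (simp add: vec_eq_iff axis_def if_distrib[where f="\<lambda>z. _ * z"] cong: if_cong)
  then show ?thesis by (metis rdet_sum)
qed

lemma rdet_identical: "c \<noteq> c' \<Longrightarrow> w c = w c' \<Longrightarrow> rdet w = 0"
  unfolding rdet_def by (rule det_identical_rows) (auto simp: row_def vec_eq_iff)

lemma abs_rdet_permute:
  assumes "bij p"
  shows "\<bar>rdet (\<lambda>c. w (p c))\<bar> = \<bar>rdet w\<bar>"
proof -
  have "p permutes UNIV" using assms by (simp add: bij_iff permutes_def)
  then show ?thesis
    unfolding rdet_def using det_permute_rows[of p "\<chi> c. w c"] by (simp add: abs_mult sign_def)
qed

lemma abs_rdet_permute_columns: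
  assumes "bij p"
  shows "\<bar>rdet (\<lambda>c. \<chi> k. w c $ p k)\<bar> = \<bar>rdet w\<bar>"
proof -
  have "p permutes UNIV" using assms by (simp add: bij_iff permutes_def)
  then show ?thesis
    unfolding rdet_def using det_permute_columns[of p "\<chi> c. w c"] by (simp add: abs_mult sign_def)
qed

lemma rdet_vector_matrix_mult: "rdet (\<lambda>c. w c v* H) = rdet w * det H"
proof -
  have "(\<chi> c. w c v* H) = (\<chi> c. w c) ** H"
    by (simp add: vec_eq_iff matrix_matrix_mult_def vector_matrix_mult_def mult.commute)
  then show ?thesis by (simp add: rdet_def det_mul)
qed

lemma rdet_axis_bij: "bij p \<Longrightarrow> \<bar>rdet (\<lambda>c. axis (p c) 1)\<bar> = 1"
proof -
  assume p: "bij p"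
  have "(\<chi> c. axis c 1) = (mat 1 :: real^'a^'a)"
    by (auto simp: vec_eq_iff mat_def axis_def)
  then have "rdet (\<lambda>c::'a. axis c 1) = 1"
    by (simp add: rdet_def)
  then show ?thesis using abs_rdet_permute[OF p, of "\<lambda>c. axis c 1"] by simp
qed

lemma sum_coeff_rdet:
  assumes "x = (\<Sum>i\<in>UNIV. a i *\<^sub>R w i)"
  shows "rdet (w(c := x)) = a c * rdet w"
proof -
  have "rdet (w(c := x)) = (\<Sum>i\<in>UNIV. a i * rdet (w(c := w i)))"
    unfolding assms by (rule rdet_sum)
  also have "\<dots> = (\<Sum>i\<in>UNIV. if i = c then a c * rdet w else 0)"
    by (rule sum.cong) (auto intro!: rdet_identical[of c])
  finally show ?thesis by simp
qed

text \<open>Cramer's rule: invertibility gives some coefficients, and \<open>sum_coeff_rdet\<close>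
  identifies them as quotients of determinants.\<close>

lemma rdet_nonzero_expand:
  assumes "rdet w \<noteq> 0"
  shows "x = (\<Sum>c\<in>UNIV. (rdet (w(c := x)) / rdet w) *\<^sub>R w c)"
proof -
  let ?W = "\<chi> c. w c"
  have "invertible ?W" using assms by (simp add: rdet_def invertible_det_nz)
  then obtain B where B: "B ** ?W = mat 1" by (auto simp: invertible_def)
  have "x = x v* (B ** ?W)" by (simp add: B)
  also have "\<dots> = (x v* B) v* ?W" by (simp add: vector_matrix_mul_assoc)
  also have "\<dots> = (\<Sum>c\<in>UNIV. (x v* B) $ c *\<^sub>R w c)"
    by (simp add: vec_eq_iff vector_matrix_mult_def mult.commute)
  finally have x: "x = (\<Sum>c\<in>UNIV. (x v* B) $ c *\<^sub>R w c)" .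
  have "(x v* B) $ c = rdet (w(c := x)) / rdet w" for c
    using sum_coeff_rdet[OF x, of c] assms by simp
  then show ?thesis using x by simp
qed

text \<open>Only permutations fixing the complement of \<open>T\<close> contribute to the Leibniz formula.\<close>

lemma det_block_cong:
  fixes A B :: "real^'k^'k"
  assumes "\<And>c. c \<notin> T \<Longrightarrow> A $ c = axis c 1" "\<And>c. c \<notin> T \<Longrightarrow> B $ c = axis c 1"
    and "\<And>c k. c \<in> T \<Longrightarrow> k \<in> T \<Longrightarrow> A $ c $ k = B $ c $ k"
  shows "det A = det B"
  unfolding det_def
proof (rule sum.cong)
  fix p assume "p \<in> {p. p permutes (UNIV::'k set)}"
  then have p: "inj p" by (simp add: permutes_inj)
  show "of_int (sign p) * (\<Prod>i\<in>UNIV. A $ i $ p i) = of_int (sign p) * (\<Prod>i\<in>UNIV. B $ i $ p i)"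
  proof (cases "\<exists>c. c \<notin> T \<and> p c \<noteq> c")
    case True
    then obtain c where c: "c \<notin> T" "p c \<noteq> c" by auto
    then have "A $ c $ p c = 0" "B $ c $ p c = 0" by (simp_all add: assms axis_def)
    then have "(\<Prod>i\<in>UNIV. A $ i $ p i) = 0" "(\<Prod>i\<in>UNIV. B $ i $ p i) = 0"
      by (meson UNIV_I finite prod_zero)+
    then show ?thesis by (simp only:)
  next
    case False
    have "A $ i $ p i = B $ i $ p i" for i
    proof (cases "i \<in> T")
      case True
      then have "p i \<in> T" using False p by (metis injD)
      then show ?thesis using True assms(3) by simp
    next
      case F: False
      then show ?thesis using assms by simp
    qed
    then show ?thesis by simp
  qed
qed auto

subsection \<open>Covolumes\<close>

text \<open>Filling up with unit rows turns the minors of the rows in \<open>S\<close> into full determinants, so that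
  \<open>covol S v\<close> is the sup norm of the Pluecker coordinates of these rows.\<close>

definition fam :: "'k set \<Rightarrow> ('k \<Rightarrow> 'k) \<Rightarrow> ('k \<Rightarrow> real^'k) \<Rightarrow> 'k \<Rightarrow> real^'k::finite" where
  "fam S r v c = (if c \<in> S then v c else axis (r c) 1)"

definition covol :: "'k::finite set \<Rightarrow> ('k \<Rightarrow> real^'k) \<Rightarrow> real" where
  "covol S v = Max (range (\<lambda>r. \<bar>rdet (fam S r v)\<bar>))"

lemma covol_ge: "\<bar>rdet (fam S r v)\<bar> \<le> covol S v"
  unfolding covol_def by (rule Max_ge) auto

lemma covol_attained: obtains r where "\<bar>rdet (fam S r v)\<bar> = covol S v"
proof -
  have "covol S v \<in> range (\<lambda>r. \<bar>rdet (fam S r v)\<bar>)"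
    unfolding covol_def by (rule Max_in) auto
  then show ?thesis using that by auto
qed

lemma covol_nonneg: "0 \<le> covol S v"
  using covol_ge[of S id v] by linarith

lemma covol_le_iff: "covol S v \<le> B \<longleftrightarrow> (\<forall>r. \<bar>rdet (fam S r v)\<bar> \<le> B)"
  by (metis covol_attained covol_ge order_trans)

lemma covol_cong: "(\<And>c. c \<in> S \<Longrightarrow> v c = v' c) \<Longrightarrow> covol S v = covol S v'"
proof -
  assume "\<And>c. c \<in> S \<Longrightarrow> v c = v' c"
  then have "fam S r v = fam S r v'" for r by (auto simp: fam_def)
  then show ?thesis by (simp add: covol_def)
qed

lemma covol_UNIV: "covol UNIV v = \<bar>rdet v\<bar>"
  by (simp add: covol_def fam_def[abs_def])

text \<open>A repeated value of \<open>r\<close> would give two equal unit rows. A nonzero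
  \<open>rdet (fam S r v)\<close> is therefore, up to sign, the minor of the rows \<open>S\<close>
  in the columns outside the image of \<open>-S\<close> under \<open>r\<close>.\<close>

lemma fam_inj:
  assumes "rdet (fam S r v) \<noteq> 0" shows "inj_on r (-S)"
proof (rule inj_onI, rule ccontr)
  fix a b assume "a \<in> - S" "b \<in> - S" "r a = r b" "a \<noteq> b"
  then show False using rdet_identical[of a b "fam S r v"] assms by (auto simp: fam_def)
qed

lemma covol_empty: "covol {} v = 1"
proof (rule antisym)
  show "covol {} v \<le> 1"
    unfolding covol_le_iff
  proof
    fix r
    show "\<bar>rdet (fam {} r v)\<bar> \<le> 1"
    proof (cases "rdet (fam {} r v) = 0")
      case False
      then have "inj r" using fam_inj by fastforce
      then have "bij r" by (simp add: finite_UNIV_inj_surj bij_def)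
      then show ?thesis using rdet_axis_bij[of r] by (simp add: fam_def[abs_def])
    qed auto
  qed
  show "1 \<le> covol {} v"
    using covol_ge[of "{}" id v] rdet_axis_bij[of "id::'a \<Rightarrow> 'a"] by (simp add: fam_def[abs_def])
qed

lemma covol_le_permute:
  assumes "bij \<sigma>"
  shows "covol S (\<lambda>c. v (\<sigma> c)) \<le> covol (\<sigma> ` S) v"
  unfolding covol_le_iff
proof
  fix r
  have "fam S r (\<lambda>c. v (\<sigma> c)) = (\<lambda>c. fam (\<sigma> ` S) (r \<circ> inv_into UNIV \<sigma>) v (\<sigma> c))"
    using assms by (auto simp: fam_def bij_def inj_image_mem_iff)
  then show "\<bar>rdet (fam S r (\<lambda>c. v (\<sigma> c)))\<bar> \<le> covol (\<sigma> ` S) v"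
    using abs_rdet_permute[OF assms] covol_ge by metis
qed

lemma covol_permute:
  assumes "bij \<sigma>"
  shows "covol (\<sigma> ` S) v = covol S (\<lambda>c. v (\<sigma> c))"
proof (rule antisym)
  have "covol (\<sigma> ` S) (\<lambda>c. (\<lambda>c. v (\<sigma> c)) (inv_into UNIV \<sigma> c)) \<le> covol (inv_into UNIV \<sigma> ` \<sigma> ` S) (\<lambda>c. v (\<sigma> c))"
    by (rule covol_le_permute) (simp add: assms bij_imp_bij_inv)
  moreover have "v (\<sigma> (inv_into UNIV \<sigma> c)) = v c" for c
    using assms by (simp add: bij_is_surj surj_f_inv_f)
  moreover have "inv_into UNIV \<sigma> ` \<sigma> ` S = S"
    using assms by (simp add: bij_is_inj image_inv_f_f)
  ultimately show "covol (\<sigma> ` S) v \<le> covol S (\<lambda>c. v (\<sigma> c))" by simp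
qed (rule covol_le_permute[OF assms])

lemma fam_upd_in: "c \<in> S \<Longrightarrow> fam S r (v(c := x)) = (fam S r v)(c := x)"
  by (auto simp: fam_def)

lemma fam_upd_notin: "c \<notin> S \<Longrightarrow> fam S (r(c := k)) v = (fam S r v)(c := axis k 1)"
  by (auto simp: fam_def)

lemma fam_insert: "fam (insert c S) r v = (fam S r v)(c := v c)"
  by (auto simp: fam_def)

lemma covol_upd_sum_le:
  assumes "c \<in> S"
  shows "covol S (v(c := (\<Sum>i\<in>I. a i *\<^sub>R x i))) \<le> (\<Sum>i\<in>I. \<bar>a i\<bar> * covol S (v(c := x i)))"
  unfolding covol_le_iff
proof
  fix r
  have "\<bar>rdet (fam S r (v(c := (\<Sum>i\<in>I. a i *\<^sub>R x i))))\<bar>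
      \<le> (\<Sum>i\<in>I. \<bar>a i * rdet (fam S r (v(c := x i)))\<bar>)"
    using assms by (simp add: fam_upd_in rdet_sum)
  also have "\<dots> \<le> (\<Sum>i\<in>I. \<bar>a i\<bar> * covol S (v(c := x i)))"
    by (rule sum_mono) (simp add: abs_mult mult_left_mono covol_ge)
  finally show "\<bar>rdet (fam S r (v(c := (\<Sum>i\<in>I. a i *\<^sub>R x i))))\<bar> \<le> \<dots>" .
qed

lemma covol_upd_add_le:
  assumes "c \<in> S"
  shows "covol S (v(c := x + y)) \<le> covol S (v(c := x)) + covol S (v(c := y))"
  unfolding covol_le_iff
proof
  fix r
  show "\<bar>rdet (fam S r (v(c := x + y)))\<bar> \<le> covol S (v(c := x)) + covol S (v(c := y))"
    using assms covol_ge[of S r "v(c := x)"] covol_ge[of S r "v(c := y)"]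
    by (simp add: fam_upd_in rdet_add)
qed

lemma covol_dup:
  assumes "c \<in> S" "j \<in> S" "c \<noteq> j" "v c = v j"
  shows "covol S v = 0"
proof -
  have "rdet (fam S r v) = 0" for r
    using assms by (intro rdet_identical[of c j]) (auto simp: fam_def)
  then show ?thesis by (metis covol_attained abs_zero)
qed

section \<open>The l1 norm of rows and bounds of Hadamard type\<close>

definition n1 :: "real^'k::finite \<Rightarrow> real" where
  "n1 x = (\<Sum>k\<in>UNIV. \<bar>x $ k\<bar>)"

lemma n1_nonneg: "0 \<le> n1 x"
  by (simp add: n1_def sum_nonneg)

lemma n1_add: "n1 (x + y) \<le> n1 x + n1 y"
  by (simp add: n1_def sum.distrib[symmetric] sum_mono)

lemma n1_scale: "n1 (a *\<^sub>R x) = \<bar>a\<bar> * n1 x"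
  by (simp add: n1_def abs_mult sum_distrib_left)

lemma n1_sum: "n1 (\<Sum>i\<in>I. x i) \<le> (\<Sum>i\<in>I. n1 (x i))"
proof (induction I rule: infinite_finite_induct)
  case (insert i I)
  then show ?case using n1_add[of "x i" "sum x I"] by simp
qed (auto simp: n1_def)

lemma n1_axis [simp]: "n1 (axis k 1) = 1"
  by (simp add: n1_def axis_def if_distrib[where f=abs] cong: if_cong)

lemma component_le_n1: "\<bar>x $ k\<bar> \<le> n1 x"
  unfolding n1_def by (rule member_le_sum) auto

lemma n1_le_CARD: "(\<And>k. \<bar>x $ k\<bar> \<le> B) \<Longrightarrow> n1 x \<le> real CARD('k) * B" for x :: "real^'k::finite"
  unfolding n1_def using sum_bounded_above[of UNIV "\<lambda>k. \<bar>x $ k\<bar>" B] by simp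

lemma n1_vector_matrix_mult_le:
  assumes "\<And>k. n1 (row k H) \<le> b"
  shows "n1 (x v* H) \<le> b * n1 x"
proof -
  have "x v* H = (\<Sum>k\<in>UNIV. x $ k *\<^sub>R row k H)"
    by (simp add: vec_eq_iff vector_matrix_mult_def row_def mult.commute)
  then have "n1 (x v* H) \<le> (\<Sum>k\<in>UNIV. \<bar>x $ k\<bar> * n1 (row k H))"
    using n1_sum[of "\<lambda>k. x $ k *\<^sub>R row k H" UNIV] by (simp add: n1_scale)
  also have "\<dots> \<le> (\<Sum>k\<in>UNIV. \<bar>x $ k\<bar> * b)"
    by (intro sum_mono mult_left_mono assms) auto
  finally show ?thesis by (simp add: n1_def sum_distrib_left sum_distrib_right mult.commute)
qed

text \<open>Expand along row \<open>c\<close>: the cofactors are again among the determinants that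
  define \<open>covol S v\<close>. The l1 norm is dual to the maximum, so no dimensional constant
  appears.\<close>

lemma covol_insert_le:
  assumes "c \<notin> S"
  shows "covol (insert c S) v \<le> n1 (v c) * covol S v"
  unfolding covol_le_iff
proof
  fix r
  have "rdet (fam (insert c S) r v) = (\<Sum>k\<in>UNIV. v c $ k * rdet (fam S (r(c := k)) v))"
    using assms by (simp add: fam_insert fam_upd_notin rdet_expand[of _ _ "v c"])
  also have "\<bar>\<dots>\<bar> \<le> (\<Sum>k\<in>UNIV. \<bar>v c $ k * rdet (fam S (r(c := k)) v)\<bar>)"
    by (rule sum_abs)
  also have "\<dots> \<le> (\<Sum>k\<in>UNIV. \<bar>v c $ k\<bar> * covol S v)"
    by (rule sum_mono) (simp add: abs_mult mult_left_mono covol_ge)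
  finally show "\<bar>rdet (fam (insert c S) r v)\<bar> \<le> n1 (v c) * covol S v"
    by (simp add: n1_def sum_distrib_right)
qed

lemma covol_Un_le:
  "S \<inter> T = {} \<Longrightarrow> covol (S \<union> T) v \<le> (\<Prod>c\<in>T. n1 (v c)) * covol S v"
proof (induction T rule: infinite_finite_induct)
  case (insert c T)
  have "covol (S \<union> insert c T) v \<le> n1 (v c) * covol (S \<union> T) v"
    using covol_insert_le[of c "S \<union> T" v] insert by auto
  also have "\<dots> \<le> n1 (v c) * ((\<Prod>c\<in>T. n1 (v c)) * covol S v)"
    using insert by (intro mult_left_mono n1_nonneg) auto
  finally show ?case using insert by (simp add: mult.assoc)
qed auto

lemma covol_le_prod: "covol S v \<le> (\<Prod>c\<in>S. n1 (v c))"
  using covol_Un_le[of "{}" S v] by (simp add: covol_empty)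

lemma rdet_le_prod_covol: "\<bar>rdet v\<bar> \<le> (\<Prod>c\<in>-S. n1 (v c)) * covol S v"
  using covol_Un_le[of S "-S" v] by (simp add: covol_UNIV)

lemma covol_scaleR: "covol S (\<lambda>c. a *\<^sub>R v c) = \<bar>a\<bar> ^ card S * covol S v"
proof -
  have "rdet (fam S r (\<lambda>c. a *\<^sub>R v c)) = a ^ card S * rdet (fam S r v)" for r
  proof -
    have "rdet (\<lambda>c. if c \<in> T then a *\<^sub>R w c else w c) = a ^ card T * rdet w"
      for T :: "'a set" and w
    proof (induction T rule: infinite_finite_induct)
      case (insert c T)
      have "(\<lambda>i. if i \<in> insert c T then a *\<^sub>R w i else w i)
          = (\<lambda>i. if i \<in> T then a *\<^sub>R w i else w i)(c := a *\<^sub>R w c)" by auto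
      moreover have "(\<lambda>i. if i \<in> T then a *\<^sub>R w i else w i)(c := w c) =
         (\<lambda>i. if i \<in> T then a *\<^sub>R w i else w i)" using insert by auto
      ultimately show ?case using insert by (simp add: rdet_scale)
    qed auto
    from this[of S "fam S r v"] show ?thesis
      by (simp add: fam_def[abs_def] if_distrib cong: if_cong)
  qed
  then have e: "\<bar>rdet (fam S r (\<lambda>c. a *\<^sub>R v c))\<bar> = \<bar>a\<bar> ^ card S * \<bar>rdet (fam S r v)\<bar>" for r
    by (simp add: abs_mult power_abs)
  show ?thesis
  proof (rule antisym)
    show "covol S (\<lambda>c. a *\<^sub>R v c) \<le> \<bar>a\<bar> ^ card S * covol S v"
      unfolding covol_le_iff e by (auto intro!: mult_left_mono covol_ge)
    obtain r where "\<bar>rdet (fam S r v)\<bar> = covol S v" by (rule covol_attained)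
    then show "\<bar>a\<bar> ^ card S * covol S v \<le> covol S (\<lambda>c. a *\<^sub>R v c)"
      using covol_ge[of S r "\<lambda>c. a *\<^sub>R v c"] e[of r] by simp
  qed
qed

text \<open>Exchanging the rows \<open>c\<close> and \<open>j\<close> puts \<open>v j\<close> in its
  own position and moves the unit row of \<open>j\<close> to \<open>c\<close>.\<close>

lemma rdet_exchange_le:
  assumes "c \<notin> T" "j \<notin> T"
  shows "\<bar>rdet ((fam T r v)(c := v j))\<bar> \<le> covol (insert j T) v"
proof -
  let ?p = "Transposition.transpose c j"
  have "(\<lambda>i. ((fam T r v)(c := v j)) (?p i)) = fam (insert j T) (r(c := r j)) v"
    using assms by (auto simp: fam_def Transposition.transpose_def)
  then show ?thesis
    using abs_rdet_permute[of ?p "(fam T r v)(c := v j)"] covol_ge by (metis bij_swap_iff bij_id transpose_comp_involutory bij_transpose)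
qed

text \<open>A substitute for the Gram-Schmidt step: \<open>y\<close> is the part of
  \<open>v j\<close> along the unit rows of a maximal minor. By Cramer's rule its coefficients are
  quotients with denominator of size \<open>covol T v\<close> and numerators bounded by
  \<open>rdet_exchange_le\<close>.\<close>

lemma covol_residual:
  fixes T :: "'k::finite set"
  assumes "covol T v > 0" "j \<notin> T"
  obtains a y where "v j = (\<Sum>k\<in>T. a k *\<^sub>R v k) + y"
    and "covol T v * n1 y \<le> real CARD('k) * covol (insert j T) v"
proof -
  obtain r where r: "\<bar>rdet (fam T r v)\<bar> = covol T v" by (rule covol_attained)
  let ?w = "fam T r v"
  let ?a = "\<lambda>c. rdet (?w(c := v j)) / rdet ?w"
  define y where "y = (\<Sum>c\<in>-T. ?a c *\<^sub>R (axis (r c) 1 :: real^'k))"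
  have nz: "rdet ?w \<noteq> 0" using r assms by auto
  have "v j = (\<Sum>c\<in>UNIV. ?a c *\<^sub>R ?w c)" by (rule rdet_nonzero_expand[OF nz])
  also have "\<dots> = (\<Sum>c\<in>T. ?a c *\<^sub>R ?w c) + (\<Sum>c\<in>-T. ?a c *\<^sub>R ?w c)"
    by (subst sum.union_disjoint[symmetric]) auto
  also have "\<dots> = (\<Sum>c\<in>T. ?a c *\<^sub>R v c) + y"
    unfolding y_def by (intro arg_cong2[where f="(+)"] sum.cong) (auto simp: fam_def)
  finally have 1: "v j = (\<Sum>c\<in>T. ?a c *\<^sub>R v c) + y" .
  have "n1 y \<le> (\<Sum>c\<in>-T. \<bar>?a c\<bar>)"
    unfolding y_def using n1_sum[of "\<lambda>c. ?a c *\<^sub>R (axis (r c) 1 :: real^'k)" "-T"]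
    by (simp add: n1_scale)
  also have "\<dots> \<le> (\<Sum>c\<in>-T. covol (insert j T) v / covol T v)"
    using rdet_exchange_le[of _ T j r v] assms r by (intro sum_mono) (auto intro!: divide_right_mono)
  also have "\<dots> = real (card (-T)) * (covol (insert j T) v / covol T v)" by simp
  also have "\<dots> \<le> real CARD('k) * (covol (insert j T) v / covol T v)"
    by (intro mult_right_mono) (auto simp: covol_nonneg card_mono)
  finally have "covol T v * n1 y \<le> real CARD('k) * covol (insert j T) v"
    using assms by (simp add: field_simps)
  with 1 show ?thesis by (rule that)
qed

lemma covol_combination:
  assumes "\<And>c. c \<in> S \<Longrightarrow> w c = (\<Sum>c'\<in>S. M $ c $ c' *\<^sub>R v c')"
    and "\<And>c. c \<notin> S \<Longrightarrow> M $ c = axis c 1"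
  shows "covol S w = \<bar>det M\<bar> * covol S v"
proof -
  \<comment> \<open>Entries of \<open>M\<close> in rows of \<open>S\<close> and columns outside
    \<open>S\<close> are unconstrained; as the remaining rows are unit rows, replacing these entries
    by zero keeps the determinant.\<close>
  have M0: "det M = det M'" if "M' = (\<chi> c k. if c \<in> S then (if k \<in> S then M $ c $ k else 0) else axis c 1 $ k)" for M'
    unfolding that by (rule det_block_cong[of S]) (auto simp: assms vec_eq_iff)
  define M' where "M' = (\<chi> c k. if c \<in> S then (if k \<in> S then M $ c $ k else 0) else axis c 1 $ k)"
  have e: "rdet (fam S r w) = det M * rdet (fam S r v)" for r
  proof -
    have "(\<chi> c. fam S r w c) = M' ** (\<chi> c. fam S r v c)"
    proof -
      have "fam S r w c $ l = (\<Sum>k\<in>UNIV. M' $ c $ k * fam S r v k $ l)" for c l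
      proof (cases "c \<in> S")
        case True
        have "(\<Sum>k\<in>UNIV. M' $ c $ k * fam S r v k $ l) = (\<Sum>k\<in>S. M' $ c $ k * fam S r v k $ l)"
          by (rule sum.mono_neutral_right) (auto simp: M'_def True)
        also have "\<dots> = (\<Sum>k\<in>S. M $ c $ k * v k $ l)"
          by (rule sum.cong) (auto simp: M'_def True fam_def)
        finally show ?thesis using assms(1)[OF True] by (simp add: fam_def True)
      next
        case False
        have "(\<Sum>k\<in>UNIV. M' $ c $ k * fam S r v k $ l) = (\<Sum>k\<in>UNIV. if k = c then fam S r v k $ l else 0)"
          by (rule sum.cong) (auto simp: M'_def False axis_def)
        then show ?thesis by (simp add: fam_def False)
      qed
      then show ?thesis by (simp add: vec_eq_iff matrix_matrix_mult_def)
    qed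
    then show ?thesis using M0[OF M'_def] by (simp add: rdet_def det_mul)
  qed
  show ?thesis
  proof (rule antisym)
    show "covol S w \<le> \<bar>det M\<bar> * covol S v"
      unfolding covol_le_iff e by (auto simp: abs_mult intro!: mult_left_mono covol_ge)
    obtain r where "\<bar>rdet (fam S r v)\<bar> = covol S v" by (rule covol_attained)
    then show "\<bar>det M\<bar> * covol S v \<le> covol S w"
      using covol_ge[of S r w] e[of r] by (simp add: abs_mult)
  qed
qed

lemma inj_on_extend_bij:
  fixes r :: "'k::finite \<Rightarrow> 'k"
  assumes "inj_on r U"
  obtains p where "bij p" "\<And>c. c \<in> U \<Longrightarrow> p c = r c"
proof -
  have "card (-U) = card (-(r ` U))"
    using assms by (simp add: Compl_eq_Diff_UNIV card_Diff_subset card_image)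
  then obtain q where q: "bij_betw q (-U) (-(r ` U))"
    using finite_same_card_bij[of "-U" "-(r ` U)"] by auto
  have "bij_betw (\<lambda>c. if c \<in> U then r c else q c) (U \<union> -U) (r ` U \<union> -(r ` U))"
    using assms q by (intro bij_betw_disjoint_Un) (auto simp: bij_betw_def)
  then have "bij (\<lambda>c. if c \<in> U then r c else q c)" by simp
  then show ?thesis by (rule that) auto
qed

text \<open>Jacobi's identity between complementary minors of a matrix and of its inverse.\<close>

lemma covol_dual_le:
  fixes A B :: "real^'k::finite^'k"
  assumes "B ** A = mat 1" "det A = 1"
  shows "covol (-S) (\<lambda>c. column c B) \<le> covol S (\<lambda>c. row c A)"
  unfolding covol_le_iff
proof
  fix r
  let ?N = "fam (-S) r (\<lambda>c. column c B)"
  show "\<bar>rdet ?N\<bar> \<le> covol S (\<lambda>c. row c A)"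
  proof (cases "rdet ?N = 0")
    case False
    then have "inj_on r S" using fam_inj by fastforce
    then obtain p where p: "bij p" "\<And>c. c \<in> S \<Longrightarrow> p c = r c" by (rule inj_on_extend_bij) blast
    let ?N3 = "\<chi> c k. if c \<in> S then axis c 1 $ k else B $ p c $ k"
    let ?N2 = "\<chi> c k. ?N c $ p k"
    have "\<bar>rdet ?N\<bar> = \<bar>det ?N2\<bar>"
      using abs_rdet_permute_columns[OF p(1), of ?N] by (simp add: rdet_def)
    also have "det ?N2 = det (\<chi> c k. if c \<in> S then axis c 1 $ k else if k \<in> S then 0 else B $ p k $ c)"
      using p bij_is_inj[OF p(1)]
      by (intro det_block_cong[of "-S"])
         (auto simp: fam_def vec_eq_iff axis_def column_def p(2)[symmetric] inj_eq)
    also have "\<dots> = det (transpose (\<chi> c k. if c \<in> S then axis c 1 $ k else if k \<in> S then 0 else B $ p k $ c))"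
      by simp
    also have "transpose (\<chi> c k. if c \<in> S then axis c 1 $ k else if k \<in> S then 0 else B $ p k $ c)
      = (\<chi> c k. if c \<in> S then axis c 1 $ k else if k \<in> S then 0 else B $ p c $ k)"
      by (auto simp: transpose_def vec_eq_iff axis_def)
    also have "det (\<chi> c k. if c \<in> S then axis c 1 $ k else if k \<in> S then 0 else B $ p c $ k) = det ?N3"
      by (rule det_block_cong[of "-S"]) (auto simp: vec_eq_iff)
    \<comment> \<open>Multiplication by \<open>A\<close> turns the unit rows into rows of
      \<open>A\<close> and the rows of \<open>B\<close> into unit rows, which makes the minor of
      \<open>B\<close> the complementary minor of \<open>A\<close>.\<close>
    also have "det ?N3 = det (?N3 ** A)" using assms by (simp add: det_mul)
    also have "?N3 ** A = (\<chi> c. fam S p (\<lambda>c. row c A) c)"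
    proof -
      have "(\<Sum>k\<in>UNIV. (if c \<in> S then axis c 1 $ k else B $ p c $ k) * A $ k $ l) = fam S p (\<lambda>c. row c A) c $ l" for c l
      proof (cases "c \<in> S")
        case True
        have "(\<Sum>k\<in>UNIV. axis c 1 $ k * A $ k $ l) = (\<Sum>k\<in>UNIV. if k = c then A $ k $ l else 0)"
          by (rule sum.cong) (auto simp: axis_def)
        then show ?thesis using True by (simp add: fam_def row_def)
      next
        case False
        have "(\<Sum>k\<in>UNIV. B $ p c $ k * A $ k $ l) = (B ** A) $ p c $ l"
          by (simp add: matrix_matrix_mult_def)
        then show ?thesis using False by (auto simp: fam_def assms mat_def axis_def)
      qed
      then show ?thesis by (simp add: vec_eq_iff matrix_matrix_mult_def)
    qed
    also have "det (\<chi> c. fam S p (\<lambda>c. row c A) c) = rdet (fam S p (\<lambda>c. row c A))"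
      by (simp add: rdet_def)
    also have "\<bar>\<dots>\<bar> \<le> covol S (\<lambda>c. row c A)" by (rule covol_ge)
    finally show ?thesis by simp
  qed (simp add: covol_nonneg)
qed

lemma linear_vector_matrix_mult: "linear (\<lambda>x::real^'k::finite. x v* (H :: real^'m^'k))"
  by (rule linearI)
     (auto simp: vec_eq_iff vector_matrix_mult_def ring_distribs sum.distrib sum_distrib_left mult_ac)

text \<open>Normalising at a largest minor bounds the other entries by \<open>1\<close>, by Cramer's rule.\<close>

lemma covol_pivots:
  fixes v :: "'k::finite \<Rightarrow> real^'k"
  assumes "covol S v > 0"
  obtains p w where "bij p" "\<And>c c'. c \<in> S \<Longrightarrow> c' \<in> S \<Longrightarrow> w c $ p c' = (if c = c' then 1 else 0)"
    "\<And>c k. c \<in> S \<Longrightarrow> \<bar>w c $ k\<bar> \<le> 1"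
    "\<And>H. covol S v * covol S (\<lambda>c. w c v* H) \<le> real CARD('k) ^ card S * covol S (\<lambda>c. v c v* H)"
proof -
  obtain r where r: "\<bar>rdet (fam S r v)\<bar> = covol S v" by (rule covol_attained)
  let ?F = "fam S r v"
  have nz: "rdet ?F \<noteq> 0" using r assms by auto
  then have ir: "inj_on r (-S)" by (rule fam_inj)
  then obtain p where p: "bij p" "\<And>c. c \<in> -S \<Longrightarrow> p c = r c" by (rule inj_on_extend_bij) blast
  define a where "a k c = rdet (?F(c := axis k 1)) / rdet ?F" for k c
  \<comment> \<open>Maximality of the minor: exchanging one unit row for another cannot increase the
    determinant.\<close>
  have a1: "\<bar>a k c\<bar> \<le> 1" if "c \<notin> S" for k c
    using that covol_ge[of S "r(c := k)" v] r assms by (simp add: a_def fam_upd_notin divide_le_eq)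
  \<comment> \<open>For \<open>c\<close> in \<open>S\<close>, removing from the unit vector at
    \<open>p c\<close> its components along the unit rows of the minor leaves a combination of the
    rows of \<open>S\<close> with the required pivots.\<close>
  define w where "w c = (\<Sum>c'\<in>S. a (p c) c' *\<^sub>R v c')" for c
  have w: "w c = axis (p c) 1 - (\<Sum>c'\<in>-S. a (p c) c' *\<^sub>R axis (p c') 1)" for c
  proof -
    have "axis (p c) 1 = (\<Sum>c'\<in>UNIV. a (p c) c' *\<^sub>R ?F c')"
      unfolding a_def by (rule rdet_nonzero_expand[OF nz])
    also have "\<dots> = (\<Sum>c'\<in>S. a (p c) c' *\<^sub>R ?F c') + (\<Sum>c'\<in>-S. a (p c) c' *\<^sub>R ?F c')"
      by (subst sum.union_disjoint[symmetric]) auto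
    also have "\<dots> = w c + (\<Sum>c'\<in>-S. a (p c) c' *\<^sub>R axis (p c') 1)"
      unfolding w_def by (intro arg_cong2[where f="(+)"] sum.cong) (auto simp: fam_def p)
    finally show ?thesis by simp
  qed
  have wk: "w c $ p k = (if c = k then 1 else 0) - (if k \<in> S then 0 else a (p c) k)" for c k
  proof -
    have "(\<Sum>c'\<in>-S. a (p c) c' * (axis (p c') 1 :: real^'k) $ p k)
        = (\<Sum>c'\<in>-S. if c' = k then a (p c) k else 0)"
      using bij_is_inj[OF p(1)] by (intro sum.cong) (auto simp: axis_def inj_eq)
    then show ?thesis
      unfolding w using bij_is_inj[OF p(1)] by (simp add: axis_def inj_eq)
  qed
  have w1: "\<bar>w c $ k\<bar> \<le> 1" if "c \<in> S" for c k
  proof -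
    obtain k' where "k = p k'" using bij_is_surj[OF p(1)] by (metis surjD)
    then show ?thesis using wk[of c k'] a1[of k' "p c"] that by (auto split: if_splits)
  qed
  let ?M = "\<chi> c k. if c \<in> S then a (p c) k else axis c 1 $ k"
  have comb: "covol S (\<lambda>c. w c v* H) = \<bar>det ?M\<bar> * covol S (\<lambda>c. v c v* H)" for H
  proof (rule covol_combination)
    fix c assume "c \<in> S"
    have "w c v* H = (\<Sum>c'\<in>S. a (p c) c' *\<^sub>R (v c' v* H))"
      unfolding w_def
      by (simp add: linear_sum[OF linear_vector_matrix_mult] linear_cmul[OF linear_vector_matrix_mult])
    then show "w c v* H = (\<Sum>c'\<in>S. ?M $ c $ c' *\<^sub>R (v c' v* H))" using \<open>c \<in> S\<close> by simp
  qed (auto simp: vec_eq_iff)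
  \<comment> \<open>The case \<open>H = mat 1\<close> bounds the determinant of the base change,
    since the entries of the \<open>w c\<close> are at most 1; the bound then serves every
    \<open>H\<close>.\<close>
  have "\<bar>det ?M\<bar> * covol S v = covol S w" using comb[of "mat 1"] by simp
  also have "\<dots> \<le> (\<Prod>c\<in>S. n1 (w c))" by (rule covol_le_prod)
  also have "\<dots> \<le> (\<Prod>c\<in>S. real CARD('k))"
    using n1_le_CARD[of _ 1] w1 by (intro prod_mono) (auto simp: n1_nonneg)
  finally have dM: "\<bar>det ?M\<bar> * covol S v \<le> real CARD('k) ^ card S" by simp
  show ?thesis
  proof (rule that[OF p(1)])
    show "w c $ p c' = (if c = c' then 1 else 0)" if "c \<in> S" "c' \<in> S" for c c'
      using wk[of c c'] that by simp
    show "covol S v * covol S (\<lambda>c. w c v* H) \<le> real CARD('k) ^ card S * covol S (\<lambda>c. v c v* H)" for H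
      using mult_right_mono[OF dM covol_nonneg[of S "\<lambda>c. v c v* H"]] by (simp add: comb mult_ac)
  qed (use w1 in auto)
qed

section \<open>Integer matrices and their minors\<close>

lemma row_matrix_mult: "(Z ** A) $ c = Z $ c v* (A :: real^'m^'k::finite)"
  by (simp add: vec_eq_iff matrix_matrix_mult_def vector_matrix_mult_def mult.commute)

lemma det_Ints: "(\<And>i j. A $ i $ j \<in> \<int>) \<Longrightarrow> det (A :: real^'k::finite^'k) \<in> \<int>"
  unfolding det_def by (intro Ints_sum Ints_mult Ints_prod) auto

lemma SLZ_mult: "A \<in> SLZ \<Longrightarrow> B \<in> SLZ \<Longrightarrow> A ** B \<in> SLZ" for A B :: "real^'k::finite^'k"
proof -
  assume "A \<in> SLZ" "B \<in> SLZ"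
  moreover from this have "(A ** B) $ i $ j \<in> \<int>" for i j
    unfolding matrix_matrix_mult_def by (auto simp: SLZ_def intro!: Ints_sum Ints_mult)
  ultimately show ?thesis by (simp add: SLZ_def det_mul)
qed

lemma mat_1_SLZ: "mat 1 \<in> SLZ"
  unfolding SLZ_def by (simp add: det_I) (simp add: mat_def)

lemma SLZ_transpose: "A \<in> SLZ \<Longrightarrow> transpose A \<in> (SLZ :: (real^'k::finite^'k) set)"
  by (auto simp: SLZ_def transpose_def) (metis det_transpose transpose_def)

text \<open>Fill up the minor by unit rows and multiply by \<open>A\<close> and \<open>H\<close>,
  both of determinant 1: the unit rows become rows of \<open>A ** H\<close>. For integral
  \<open>Z\<close> a nonzero left side is at least 1, which bounds the covolume from below.\<close>

lemma minor_le_covol: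
  fixes A H Z :: "real^'k::finite^'k"
  assumes "det A = 1" "det H = 1" "\<And>k. n1 (H $ k) \<le> b" "1 \<le> b"
  shows "\<bar>rdet (fam S r (\<lambda>c. Z $ c))\<bar>
    \<le> b ^ CARD('k) * (\<Prod>c\<in>-S. n1 (A $ r c)) * covol S (\<lambda>c. (Z ** A) $ c v* H)"
proof -
  let ?u = "\<lambda>c. (fam S r (\<lambda>c. Z $ c) c v* A) v* H"
  have "rdet (fam S r (\<lambda>c. Z $ c)) = rdet ?u"
    using assms by (simp add: rdet_vector_matrix_mult[of "\<lambda>c. fam S r (\<lambda>c. Z $ c) c v* A"] rdet_vector_matrix_mult)
  then have "\<bar>rdet (fam S r (\<lambda>c. Z $ c))\<bar> \<le> (\<Prod>c\<in>-S. n1 (?u c)) * covol S ?u"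
    using rdet_le_prod_covol by metis
  also have "covol S ?u = covol S (\<lambda>c. (Z ** A) $ c v* H)"
    by (rule covol_cong) (simp add: fam_def row_matrix_mult)
  also have "(\<Prod>c\<in>-S. n1 (?u c)) \<le> (\<Prod>c\<in>-S. b * n1 (A $ r c))"
  proof (intro prod_mono conjI n1_nonneg)
    fix c assume "c \<in> -S"
    have "axis (r c) 1 v* A = A $ r c"
      by (simp add: vec_eq_iff vector_matrix_mult_def axis_def if_distrib[where f="\<lambda>z. z * _"] cong: if_cong)
    then have "?u c = A $ r c v* H" using \<open>c \<in> -S\<close> by (simp add: fam_def)
    then show "n1 (?u c) \<le> b * n1 (A $ r c)"
      using n1_vector_matrix_mult_le[of H b "A $ r c"] assms by (simp add: row_def)
  qed
  also have "\<dots> = b ^ card (-S) * (\<Prod>c\<in>-S. n1 (A $ r c))" by (simp add: prod.distrib)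
  also have "\<dots> \<le> b ^ CARD('k) * (\<Prod>c\<in>-S. n1 (A $ r c))"
    using assms by (intro mult_right_mono power_increasing prod_nonneg) (auto simp: n1_nonneg card_mono)
  finally show ?thesis by (simp add: covol_nonneg mult_right_mono)
qed

lemma covol_pos_det:
  fixes A :: "real^'k::finite^'k"
  assumes "det A = 1" shows "covol J (($) A) > 0"
proof -
  have "rdet (($) A) = 1" using assms by (simp add: rdet_def)
  then have "1 \<le> (\<Prod>c\<in>-J. n1 (A $ c)) * covol J (($) A)" using rdet_le_prod_covol[of "($) A" J] by simp
  then have "covol J (($) A) \<noteq> 0" by auto
  then show ?thesis using covol_nonneg[of J "($) A"] by simp
qed

lemma fam_Ints:
  assumes "Z \<in> SLZ" shows "rdet (fam S r (\<lambda>c. Z $ c)) \<in> \<int>"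
  unfolding rdet_def by (rule det_Ints) (use assms in \<open>auto simp: fam_def SLZ_def axis_def\<close>)

lemma Ints_abs_ge_1: "x \<in> \<int> \<Longrightarrow> x \<noteq> 0 \<Longrightarrow> 1 \<le> \<bar>x\<bar>" for x :: real
  by (auto elim!: Ints_cases)

text \<open>The rows of \<open>Z\<close> have positive covolume, and the determinant attaining it is
  an integer.\<close>

lemma SLZ_minor:
  assumes "Z \<in> SLZ"
  obtains r where "1 \<le> \<bar>rdet (fam S r (\<lambda>c. Z $ c))\<bar>"
  using covol_pos_det[of Z S] assms fam_Ints[OF assms, of S] Ints_abs_ge_1 covol_attained
  unfolding SLZ_def by (metis (mono_tags, lifting) abs_zero less_irrefl mem_Collect_eq)

subsection \<open>Reduced lattice bases\<close>

text \<open>Shears suffice: a signed exchange of two vectors, the other move of the reduction, is a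
  product of three of them.\<close>

inductive_set bases :: "real^'k::finite^'k \<Rightarrow> ('k \<Rightarrow> real^'k) set" for A where
  base: "($) A \<in> bases A"
| shear: "v \<in> bases A \<Longrightarrow> c \<noteq> j \<Longrightarrow> v(c := v c + of_int n *\<^sub>R v j) \<in> bases A"

lemma bases_SLZ: "v \<in> bases A \<Longrightarrow> \<exists>Z\<in>SLZ. v = ($) (Z ** A)"
proof (induction rule: bases.induct)
  case base
  then show ?case by (intro bexI[of _ "mat 1"]) (auto simp: mat_1_SLZ)
next
  case (shear v c j n)
  then obtain Z where Z: "Z \<in> SLZ" "v = ($) (Z ** A)" by blast
  let ?Z = "\<chi> i. ((($) Z)(c := Z $ c + of_int n *\<^sub>R Z $ j)) i"
  have "det ?Z = rdet ((($) Z)(c := Z $ c + of_int n *\<^sub>R Z $ j))" by (simp add: rdet_def)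
  also have "\<dots> = rdet (($) Z) + of_int n * rdet ((($) Z)(c := Z $ j))"
    by (simp add: rdet_add rdet_scale)
  also have "rdet ((($) Z)(c := Z $ j)) = 0" using shear by (intro rdet_identical[of c j]) auto
  also have "rdet (($) Z) = 1" using Z by (simp add: rdet_def SLZ_def)
  finally have "?Z \<in> SLZ" using Z by (auto simp: SLZ_def)
  moreover have "v(c := v c + of_int n *\<^sub>R v j) = ($) (?Z ** A)"
    by (auto simp: Z row_matrix_mult linear_add[OF linear_vector_matrix_mult] linear_cmul[OF linear_vector_matrix_mult])
  ultimately show ?case by blast
qed

lemma covol_shear_le: "c \<in> S \<Longrightarrow> j \<in> S \<Longrightarrow> c \<noteq> j \<Longrightarrow> covol S (v(c := v c + a *\<^sub>R v j)) \<le> covol S v"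
proof -
  assume a: "c \<in> S" "j \<in> S" "c \<noteq> j"
  have 1: "covol S (v(c := a *\<^sub>R v j)) \<le> \<bar>a\<bar> * covol S (v(c := v j))"
    using covol_upd_sum_le[OF a(1), of v "\<lambda>_::unit. a" "\<lambda>_. v j" UNIV] by simp
  have 2: "covol S (v(c := v j)) = 0" by (rule covol_dup[of c _ j]) (use a in auto)
  have 3: "v(c := v c) = v" by simp
  show ?thesis using covol_upd_add_le[OF a(1), of v "v c" "a *\<^sub>R v j"] 1 unfolding 2 3 by linarith
qed

lemma covol_shear:
  assumes "c \<in> S" "j \<in> S" "c \<noteq> j"
  shows "covol S (v(c := v c + a *\<^sub>R v j)) = covol S v"
proof (rule antisym)
  show "covol S v \<le> covol S (v(c := v c + a *\<^sub>R v j))"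
    using covol_shear_le[OF assms, of "v(c := v c + a *\<^sub>R v j)" "-a"] assms by simp
qed (rule covol_shear_le[OF assms])

lemma bases_sum:
  assumes "v \<in> bases A" "finite I" "c \<notin> I"
  shows "v(c := v c + (\<Sum>j\<in>I. of_int (n j) *\<^sub>R v j)) \<in> bases A"
    and "I \<subseteq> S \<Longrightarrow> c \<in> S \<Longrightarrow> covol S (v(c := v c + (\<Sum>j\<in>I. of_int (n j) *\<^sub>R v j))) = covol S v"
proof -
  have "v(c := v c + (\<Sum>j\<in>I. of_int (n j) *\<^sub>R v j)) \<in> bases A \<and>
    (I \<subseteq> S \<longrightarrow> c \<in> S \<longrightarrow> covol S (v(c := v c + (\<Sum>j\<in>I. of_int (n j) *\<^sub>R v j))) = covol S v)"
    using assms(2,3)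
  proof (induction I)
    case (insert i I)
    let ?v = "v(c := v c + (\<Sum>j\<in>I. of_int (n j) *\<^sub>R v j))"
    have e: "v(c := v c + (\<Sum>j\<in>insert i I. of_int (n j) *\<^sub>R v j)) = ?v(c := ?v c + of_int (n i) *\<^sub>R ?v i)"
      using insert by (auto simp: add_ac)
    have ic: "c \<noteq> i" "c \<notin> I" using insert by auto
    have IH: "?v \<in> bases A" "I \<subseteq> S \<Longrightarrow> c \<in> S \<Longrightarrow> covol S ?v = covol S v"
      using insert.IH[OF ic(2)] by blast+
    have "covol S (?v(c := ?v c + of_int (n i) *\<^sub>R ?v i)) = covol S v" if "insert i I \<subseteq> S" "c \<in> S"
      using covol_shear[of c S i ?v "of_int (n i)"] ic IH(2) that by simp
    then show ?case
      unfolding e using bases.shear[OF IH(1) ic(1), of "n i"] by blast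
  qed (use assms in auto)
  then show "v(c := v c + (\<Sum>j\<in>I. of_int (n j) *\<^sub>R v j)) \<in> bases A"
    and "I \<subseteq> S \<Longrightarrow> c \<in> S \<Longrightarrow> covol S (v(c := v c + (\<Sum>j\<in>I. of_int (n j) *\<^sub>R v j))) = covol S v"
    by auto
qed

lemma bases_swap:
  assumes "v \<in> bases A" "a \<noteq> b"
  shows "v(a := v b, b := - v a) \<in> bases A"
    and "a \<in> S \<Longrightarrow> b \<in> S \<Longrightarrow> covol S (v(a := v b, b := - v a)) = covol S v"
proof -
  let ?v1 = "v(a := v a + of_int 1 *\<^sub>R v b)"
  let ?v2 = "?v1(b := ?v1 b + of_int (-1) *\<^sub>R ?v1 a)"
  let ?v3 = "?v2(a := ?v2 a + of_int 1 *\<^sub>R ?v2 b)"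
  have e: "v(a := v b, b := - v a) = ?v3" using assms by (auto simp: fun_eq_iff)
  show "v(a := v b, b := - v a) \<in> bases A"
    unfolding e using assms by (intro bases.shear) auto
  show "covol S (v(a := v b, b := - v a)) = covol S v" if "a \<in> S" "b \<in> S"
  proof -
    have "covol S ?v3 = covol S ?v2" by (rule covol_shear) (use assms that in auto)
    also have "\<dots> = covol S ?v1" by (rule covol_shear) (use assms that in auto)
    also have "\<dots> = covol S v" by (rule covol_shear) (use assms that in auto)
    finally show ?thesis unfolding e .
  qed
qed

text \<open>Discreteness of the lattice: some minor of the integral base change is at least 1. The
  bound is uniform over all bases, so the product minimised below has a positive infimum.\<close>

lemma bases_covol_ge:
  assumes "det A = 1"
  obtains \<epsilon> where "\<epsilon> > 0" "\<And>v S. v \<in> bases A \<Longrightarrow> \<epsilon> \<le> covol S v"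
proof -
  define B where "B = 1 + (\<Sum>k\<in>UNIV. n1 (A $ k))"
  have B1: "1 \<le> B" unfolding B_def by (simp add: sum_nonneg n1_nonneg)
  have B: "n1 (A $ k) \<le> B" for k
    unfolding B_def using member_le_sum[of k UNIV "\<lambda>k. n1 (A $ k)"] by (simp add: n1_nonneg)
  show ?thesis
  proof (rule that[of "1 / B ^ CARD('a)"])
    fix v S assume "v \<in> bases A"
    then obtain Z where Z: "Z \<in> SLZ" "v = ($) (Z ** A)" using bases_SLZ by blast
    obtain r where "1 \<le> \<bar>rdet (fam S r (\<lambda>c. Z $ c))\<bar>" using SLZ_minor[OF Z(1)] by blast
    also have "\<dots> \<le> (\<Prod>c\<in>-S. n1 (A $ r c)) * covol S (($) (Z ** A))"
    proof -
      have "n1 (mat 1 $ k) \<le> 1" for k :: 'a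
        by (simp add: n1_def mat_def if_distrib[where f=abs] cong: if_cong)
      from minor_le_covol[OF assms _ this, where Z=Z] show ?thesis by simp
    qed
    also have "(\<Prod>c\<in>-S. n1 (A $ r c)) \<le> (\<Prod>c\<in>-S. B)" by (intro prod_mono) (auto simp: n1_nonneg B)
    also have "\<dots> \<le> B ^ CARD('a)" using B1 by (auto intro!: power_increasing card_mono)
    finally show "1 / B ^ CARD('a) \<le> covol S v"
      using B1 Z by (simp add: divide_le_eq covol_nonneg mult_right_mono mult.commute)
  qed (use B1 in auto)
qed

lemma prod_telescope_ratio:
  fixes f :: "nat \<Rightarrow> real"
  assumes "\<And>k. f k > 0"
  shows "(\<Prod>k<n. f (Suc k) / f k) = f n / f 0"
proof (induction n)
  case (Suc n)
  then show ?case using assms[of n] by simp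
qed (use assms[of 0] in simp)

text \<open>The basis comes from nearly minimising the product of the covolumes of the flag spanned by the
  basis vectors, which is what the LLL algorithm decreases. Shears make the basis size reduced
  and leave the flag unchanged, and an exchange of two consecutive vectors changes only one member of
  the flag.\<close>

theorem reduced_basis_exists:
  obtains C where "C \<ge> 1"
    "\<And>A :: real^'k::finite^'k. det A = 1 \<Longrightarrow> \<exists>Z\<in>SLZ. (\<Prod>c\<in>UNIV. n1 ((Z ** A) $ c)) \<le> C"
proof -
  let ?d = "CARD('k)"
  \<comment> \<open>Near minimality up to 5/4 and coefficients of size at most 1/2 lead in the
    exchange argument to \<open>3/10 * q k \<le> ?d * q (Suc k)\<close>, and 10/3 is below
    4.\<close>
  define E where "E = 4 * real ?d"
  have d1: "1 \<le> real ?d" by (simp add: Suc_leI)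
  have E1: "E \<ge> 1" using d1 unfolding E_def by linarith
  obtain e :: "nat \<Rightarrow> 'k" where e: "bij_betw e {..<?d} UNIV"
    using bij_betw_from_nat_into_finite[of "UNIV :: 'k set"] by auto
  define F where "F k = e ` {..<k}" for k
  have F_Suc: "F (Suc k) = insert (e k) (F k)" for k by (simp add: F_def lessThan_Suc)
  have e_inj: "e i = e j \<longleftrightarrow> i = j" if "i < ?d" "j < ?d" for i j
    using e that by (auto simp: bij_betw_def inj_on_def)
  have e_F: "e i \<in> F k \<longleftrightarrow> i < k" if "i < ?d" "k \<le> ?d" for i k
    unfolding F_def using e_inj that by force
  have F_d: "F ?d = UNIV" using e by (simp add: F_def bij_betw_def)
  define N where "N k v = covol (F k) v" for k v
  have main: "\<exists>Z\<in>SLZ. (\<Prod>c\<in>UNIV. n1 ((Z ** A) $ c)) \<le> (real ?d * (2 * E) ^ ?d) ^ ?d"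
    if det: "det A = 1" for A :: "real^'k^'k"
  proof -
    obtain \<epsilon> where eps: "\<epsilon> > 0" "\<And>v S. v \<in> bases A \<Longrightarrow> \<epsilon> \<le> covol S v"
      using bases_covol_ge[OF det] by blast
    have Npos: "N k v > 0" if "v \<in> bases A" for k v
      using eps(1) eps(2)[OF that, of "F k"] unfolding N_def by linarith
    define P where "P v = (\<Prod>k\<le>?d. N k v)" for v
    have Pge: "\<epsilon> ^ Suc ?d \<le> P v" if "v \<in> bases A" for v
    proof -
      have "(\<Prod>k\<le>?d. \<epsilon>) \<le> P v" unfolding P_def N_def using eps that by (intro prod_mono) auto
      then show ?thesis by simp
    qed
    let ?I = "Inf (P ` bases A)"
    have "\<epsilon> ^ Suc ?d \<le> ?I"
      using Pge bases.base by (intro cINF_greatest) auto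
    moreover have "0 < \<epsilon> ^ Suc ?d" using eps(1) by simp
    \<comment> \<open>Positivity of the infimum provides a basis within the factor 5/4 of it, which
      replaces a minimiser.\<close>
    ultimately have I: "?I < 5/4 * ?I" by linarith
    have bdd: "bdd_below (P ` bases A)" using Pge by (auto intro!: bdd_belowI)
    obtain v0 where v0: "v0 \<in> bases A" "P v0 < 5/4 * ?I"
      using cInf_lessD[OF _ I] bases.base by blast
    have near: "P v0 \<le> 5/4 * P v" if "v \<in> bases A" for v
      using cINF_lower[OF bdd that] v0(2) by linarith
    \<comment> \<open>\<open>y\<close> plays the role of the Gram-Schmidt vector, of length at most
      \<open>?d\<close> times the ratio of consecutive covolumes; the bound 1/2 is size
      reduction.\<close>
    define red where "red v k \<longleftrightarrow> (\<exists>y \<mu>. v (e k) = y + (\<Sum>j<k. \<mu> j *\<^sub>R v (e j)) \<and>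
      N k v * n1 y \<le> real ?d * N (Suc k) v \<and> (\<forall>j. \<bar>\<mu> j\<bar> \<le> 1/2))" for v k
    have "n \<le> ?d \<Longrightarrow> \<exists>v\<in>bases A. (\<forall>k. N k v = N k v0) \<and> (\<forall>k<n. red v k)" for n
    proof (induction n)
      case 0
      then show ?case using v0 by auto
    next
      case (Suc n)
      then obtain v where v: "v \<in> bases A" "\<And>k. N k v = N k v0" "\<And>k. k < n \<Longrightarrow> red v k" by auto
      have en: "e n \<notin> F n" using Suc e_F[of n n] by simp
      have "covol (F n) v > 0" using Npos[OF v(1), of n] by (simp add: N_def)
      then obtain a y where ay: "v (e n) = (\<Sum>c\<in>F n. a c *\<^sub>R v c) + y"
        "covol (F n) v * n1 y \<le> real ?d * covol (insert (e n) (F n)) v"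
        using covol_residual en by blast
      define v' where "v' = v(e n := v (e n) + (\<Sum>c\<in>F n. of_int (- round (a c)) *\<^sub>R v c))"
      have v'b: "v' \<in> bases A" unfolding v'_def by (rule bases_sum) (use v en in \<open>auto simp: F_def\<close>)
      have Nv': "N k v' = N k v" for k
      proof (cases "e n \<in> F k")
        case False
        then show ?thesis unfolding N_def v'_def by (intro covol_cong) auto
      next
        case True
        have "F n \<subseteq> F k"
        proof (cases "k \<le> ?d")
          case True
          then have "n < k" using e_F[of n k] Suc \<open>e n \<in> F k\<close> by simp
          then show ?thesis unfolding F_def by auto
        next
          case False
          then have "F ?d \<subseteq> F k" unfolding F_def by auto
          then show ?thesis using F_d by auto
        qed
        then show ?thesis
          unfolding N_def v'_def by (intro bases_sum(2)[OF v(1)]) (use True en in \<open>auto simp: F_def\<close>)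
      qed
      have v'e: "v' (e j) = v (e j)" if "j < n" for j
        using that Suc e_inj[of j n] by (simp add: v'_def)
      have "red v' k" if "k < n" for k
        using v(3)[OF that] that v'e unfolding red_def Nv' by simp
      moreover have "red v' n"
      proof -
        have sF: "(\<Sum>c\<in>F n. g c) = (\<Sum>j<n. g (e j))" for g :: "'k \<Rightarrow> real^'k"
          unfolding F_def using Suc e_inj by (subst sum.reindex) (auto simp: inj_on_def)
        have "v' (e n) = y + (\<Sum>c\<in>F n. (a c - of_int (round (a c))) *\<^sub>R v c)"
          unfolding v'_def using ay(1) by (simp add: sum_subtractf algebra_simps sum_negf)
        also have "\<dots> = y + (\<Sum>j<n. (a (e j) - of_int (round (a (e j)))) *\<^sub>R v' (e j))"
          unfolding sF using v'e by simp
        finally show ?thesis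
          unfolding red_def Nv' using ay(2) of_int_round_abs_le
          by (intro exI[of _ y] exI[of _ "\<lambda>j. a (e j) - of_int (round (a (e j)))"])
             (auto simp: N_def F_Suc abs_minus_commute)
      qed
      ultimately show ?case using v'b Nv' v(2) by (intro bexI[of _ v']) (auto simp: less_Suc_eq)
    qed
    from this[of ?d] obtain v where v: "v \<in> bases A" "\<And>k. N k v = N k v0" "\<And>k. k < ?d \<Longrightarrow> red v k"
      by auto
    define q where "q k = N (Suc k) v / N k v" for k
    have qpos: "q k > 0" for k using Npos[OF v(1)] by (simp add: q_def)
    \<comment> \<open>The analogue of the Lovasz condition: exchanging the vectors \<open>k\<close>
      and \<open>Suc k\<close> changes only \<open>N (Suc k)\<close> in the product, so near
      minimality bounds \<open>N (Suc k) v\<close> by 5/4 of its new value.\<close>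
    have swap: "q k \<le> E * q (Suc k)" if k: "Suc k < ?d" for k
    proof -
      let ?a = "e k" and ?b = "e (Suc k)"
      have ab: "?a \<noteq> ?b" using e_inj[of k "Suc k"] k by simp
      define v' where "v' = v(?a := v ?b, ?b := - v ?a)"
      have v'b: "v' \<in> bases A" unfolding v'_def by (rule bases_swap(1)[OF v(1) ab])
      have Nv': "N j v' = N j v" if "j \<le> ?d" "j \<noteq> Suc k" for j
      proof (cases "j \<le> k")
        case True
        then have "?a \<notin> F j" "?b \<notin> F j" using e_F k by auto
        then show ?thesis unfolding N_def v'_def by (intro covol_cong) auto
      next
        case False
        then have "?a \<in> F j" "?b \<in> F j" using e_F k that by auto
        then show ?thesis unfolding N_def v'_def by (rule bases_swap(2)[OF v(1) ab])
      qed
      have split: "P w = N (Suc k) w * (\<Prod>j\<in>{..?d}-{Suc k}. N j w)" for w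
        unfolding P_def using k by (subst prod.remove[of _ "Suc k"]) auto
      have R: "(\<Prod>j\<in>{..?d}-{Suc k}. N j v') = (\<Prod>j\<in>{..?d}-{Suc k}. N j v)"
        using Nv' by (intro prod.cong) auto
      have "P v = P v0" unfolding P_def using v(2) by simp
      then have "P v \<le> 5/4 * P v'" using near[OF v'b] by simp
      moreover have "0 < (\<Prod>j\<in>{..?d}-{Suc k}. N j v)" using Npos[OF v(1)] by (intro prod_pos) auto
      ultimately have 1: "N (Suc k) v \<le> 5/4 * N (Suc k) v'"
        unfolding split R by (metis mult.assoc mult_le_cancel_right_pos)
      obtain y \<mu> where y: "v ?b = y + (\<Sum>j<Suc k. \<mu> j *\<^sub>R v (e j))"
        "N (Suc k) v * n1 y \<le> real ?d * N (Suc (Suc k)) v" "\<And>j. \<bar>\<mu> j\<bar> \<le> 1/2"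
        using v(3)[OF k] unfolding red_def by auto
      let ?S = "F (Suc k)"
      have aS: "?a \<in> ?S" by (simp add: F_Suc)
      have "N (Suc k) v' = covol ?S (v(?a := v ?b))"
        unfolding N_def v'_def using e_F[of "Suc k" "Suc k"] k by (intro covol_cong) auto
      also have "\<dots> \<le> covol ?S (v(?a := y)) + covol ?S (v(?a := (\<Sum>j<Suc k. \<mu> j *\<^sub>R v (e j))))"
        unfolding y(1) by (rule covol_upd_add_le[OF aS])
      also have "covol ?S (v(?a := (\<Sum>j<Suc k. \<mu> j *\<^sub>R v (e j))))
          \<le> (\<Sum>j<Suc k. \<bar>\<mu> j\<bar> * covol ?S (v(?a := v (e j))))"
        by (rule covol_upd_sum_le[OF aS])
      \<comment> \<open>For \<open>j < k\<close> the vector \<open>v (e j)\<close> occurs twice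
        among the rows of \<open>?S\<close>, so only \<open>j = k\<close> contributes.\<close>
      also have "\<dots> = \<bar>\<mu> k\<bar> * N (Suc k) v"
      proof -
        have "covol ?S (v(?a := v (e j))) = 0" if "j < k" for j
          using that k e_inj[of j k] e_F[of j "Suc k"] aS by (intro covol_dup[of ?a _ "e j"]) auto
        then show ?thesis by (simp add: N_def)
      qed
      also have "\<dots> \<le> 1/2 * N (Suc k) v"
        using y(3) Npos[OF v(1), of "Suc k"] by (intro mult_right_mono) auto
      also have "covol ?S (v(?a := y)) \<le> n1 y * N k v"
      proof -
        have "?a \<notin> F k" using e_F[of k k] k by simp
        moreover from this have "covol (F k) (v(?a := y)) = covol (F k) v" by (intro covol_cong) auto
        ultimately show ?thesis
          using covol_insert_le[of ?a "F k" "v(?a := y)"] unfolding N_def by (simp add: F_Suc)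
      qed
      finally have "N (Suc k) v' \<le> n1 y * N k v + 1/2 * N (Suc k) v" by linarith
      with 1 have "3/10 * N (Suc k) v \<le> n1 y * N k v" by linarith
      then have "3/10 * q k \<le> n1 y"
        using Npos[OF v(1), of k] by (simp add: q_def field_simps)
      moreover have "n1 y \<le> real ?d * q (Suc k)"
        using y(2) Npos[OF v(1), of "Suc k"] by (simp add: q_def field_simps)
      moreover have "0 \<le> real ?d * q (Suc k)" using qpos[of "Suc k"] by simp
      ultimately show ?thesis unfolding E_def by linarith
    qed
    have qq: "q j \<le> E ^ (k - j) * q k" if "j \<le> k" "k < ?d" for j k
      using that
    proof (induction k)
      case (Suc k)
      show ?case
      proof (cases "j = Suc k")
        case False
        then have "q j \<le> E ^ (k - j) * q k" using Suc by simp
        also have "\<dots> \<le> E ^ (k - j) * (E * q (Suc k))" using E1 swap[of k] Suc by (intro mult_left_mono) auto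
        also have "\<dots> = E ^ (Suc k - j) * q (Suc k)" using Suc False by (simp add: Suc_diff_le)
        finally show ?thesis .
      qed simp
    qed simp
    \<comment> \<open>\<open>qq\<close> bounds the earlier ratios by
      \<open>E ^ (k - j) * q k\<close>; the 2 in \<open>2 * E\<close> absorbs the sum over the
      earlier vectors.\<close>
    have rowb: "k < ?d \<Longrightarrow> n1 (v (e k)) \<le> real ?d * (2 * E) ^ k * q k" for k
    proof (induction k rule: less_induct)
      case (less k)
      obtain y \<mu> where y: "v (e k) = y + (\<Sum>j<k. \<mu> j *\<^sub>R v (e j))"
        "N k v * n1 y \<le> real ?d * N (Suc k) v" "\<And>j. \<bar>\<mu> j\<bar> \<le> 1/2"
        using v(3)[OF less(2)] unfolding red_def by auto
      have "n1 (v (e k)) \<le> n1 y + (\<Sum>j<k. n1 (\<mu> j *\<^sub>R v (e j)))"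
        unfolding y(1) by (rule order_trans[OF n1_add add_left_mono[OF n1_sum]])
      also have "n1 y \<le> real ?d * q k"
        using y(2) Npos[OF v(1), of k] by (simp add: q_def field_simps)
      also have "(\<Sum>j<k. n1 (\<mu> j *\<^sub>R v (e j))) \<le> (\<Sum>j<k. real ?d * E ^ k * q k * 2 ^ j)"
      proof (rule sum_mono)
        fix j assume j: "j \<in> {..<k}"
        have "n1 (\<mu> j *\<^sub>R v (e j)) \<le> 1 * n1 (v (e j))"
          unfolding n1_scale using y(3)[of j] by (intro mult_right_mono n1_nonneg) auto
        also have "\<dots> \<le> real ?d * (2 * E) ^ j * q j" using less j by simp
        also have "\<dots> \<le> real ?d * (2 * E) ^ j * (E ^ (k - j) * q k)"
          using qq[of j k] j less E1 by (intro mult_left_mono) auto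
        also have "\<dots> = real ?d * E ^ k * q k * 2 ^ j"
          using j by (simp add: power_mult_distrib mult_ac flip: power_add)
        finally show "n1 (\<mu> j *\<^sub>R v (e j)) \<le> \<dots>" .
      qed
      also have "\<dots> = real ?d * E ^ k * q k * (2 ^ k - 1)"
        by (simp add: sum_distrib_left[symmetric] geometric_sum lessThan_atLeast0 mask_eq_sum_exp flip: lessThan_atLeast0)
      finally have "n1 (v (e k)) \<le> real ?d * q k + real ?d * E ^ k * q k * (2 ^ k - 1)" by simp
      moreover have "real ?d * q k \<le> real ?d * E ^ k * q k"
        using E1 qpos[of k] d1 by (simp add: mult_le_cancel_right1 one_le_power)
      ultimately have "n1 (v (e k)) \<le> real ?d * E ^ k * q k * 2 ^ k" by (simp add: algebra_simps)
      then show ?case by (simp add: power_mult_distrib mult_ac)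
    qed
    have "(\<Prod>c\<in>UNIV. n1 (v c)) = (\<Prod>k<?d. n1 (v (e k)))"
      using prod.reindex_bij_betw[OF e, of "\<lambda>c. n1 (v c)"] by simp
    also have "\<dots> \<le> (\<Prod>k<?d. (real ?d * (2 * E) ^ ?d) * q k)"
    proof (intro prod_mono conjI n1_nonneg)
      fix k assume "k \<in> {..<?d}"
      then have "n1 (v (e k)) \<le> real ?d * (2 * E) ^ k * q k" using rowb by simp
      also have "\<dots> \<le> (real ?d * (2 * E) ^ ?d) * q k"
        using E1 qpos[of k] \<open>k \<in> _\<close> by (intro mult_right_mono mult_left_mono power_increasing) auto
      finally show "n1 (v (e k)) \<le> \<dots>" .
    qed
    also have "\<dots> = (real ?d * (2 * E) ^ ?d) ^ ?d * (\<Prod>k<?d. q k)" by (simp add: prod.distrib)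
    \<comment> \<open>The ratios telescope to the covolume of the full lattice, which is 1.\<close>
    also have "(\<Prod>k<?d. q k) = N ?d v / N 0 v"
      unfolding q_def using prod_telescope_ratio[of "\<lambda>k. N k v"] Npos[OF v(1)] by simp
    also have "N 0 v = 1" by (simp add: N_def F_def covol_empty)
    also have "N ?d v = 1"
    proof -
      obtain Z where "Z \<in> SLZ" "v = ($) (Z ** A)" using bases_SLZ[OF v(1)] by blast
      then show ?thesis unfolding N_def F_d covol_UNIV rdet_def using det by (simp add: det_mul SLZ_def)
    qed
    finally have "(\<Prod>c\<in>UNIV. n1 (v c)) \<le> (real ?d * (2 * E) ^ ?d) ^ ?d" by simp
    then show ?thesis using bases_SLZ[OF v(1)] by auto
  qed
  show ?thesis
  proof (rule that[OF _ main])
    have "1 * 1 \<le> real ?d * (2 * E) ^ ?d" by (intro mult_mono one_le_power) (use d1 E1 in auto)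
    then have "1 \<le> real ?d * (2 * E) ^ ?d" by simp
    then show "1 \<le> (real ?d * (2 * E) ^ ?d) ^ ?d" by (rule one_le_power)
  qed
qed

subsection \<open>Averages of covolumes over grids\<close>

lemma rdet_zero_column: "(\<And>c. w c $ q = 0) \<Longrightarrow> rdet w = 0"
  unfolding rdet_def by (rule det_zero_column(1)[of q]) (simp add: column_def vec_eq_iff)

text \<open>Exchange the unit row \<open>c\<close> for \<open>x\<close> and expand: the other
  columns in the image of \<open>-T\<close> repeat a unit row and drop out. Hence the bounds for
  different \<open>c\<close> each contain one coordinate \<open>x $ r c\<close> of their own, plus
  coordinates outside that image.\<close>

lemma covol_insert_ge:
  assumes r: "\<bar>rdet (fam T r u)\<bar> = covol T u" "covol T u > 0" and jc: "j \<notin> T" "c \<notin> T"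
  defines "\<theta> \<equiv> \<lambda>c k. rdet ((fam T r u)(c := axis k 1)) / rdet (fam T r u)"
  shows "covol T u * \<bar>x $ r c + (\<Sum>k\<in>-r`(-T). \<theta> c k * x $ k)\<bar> \<le> covol (insert j T) (u(j := x))"
proof -
  let ?F = "fam T r u"
  have nz: "rdet ?F \<noteq> 0" using r by auto
  have inj: "inj_on r (-T)" by (rule fam_inj[OF nz])
  let ?g = "\<lambda>k. x $ k * rdet (?F(c := axis k 1))"
  have Frc: "?F(c := axis (r c) 1) = ?F" using jc by (auto simp: fam_def)
  have zero: "?g k = 0" if k: "k \<in> r ` (-T) - {r c}" for k
  proof -
    obtain c' where c': "k = r c'" "c' \<notin> T" "k \<noteq> r c" using k by auto
    then have "c' \<noteq> c" by auto
    have "rdet (?F(c := axis k 1)) = 0"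
      by (rule rdet_identical[of c c']) (use c' \<open>c' \<noteq> c\<close> in \<open>auto simp: fam_def\<close>)
    then show ?thesis by simp
  qed
  have "rdet (?F(c := x)) = (\<Sum>k\<in>UNIV. ?g k)" by (rule rdet_expand)
  also have "\<dots> = (\<Sum>k\<in>r`(-T). ?g k) + (\<Sum>k\<in>-r`(-T). ?g k)"
    by (subst sum.union_disjoint[symmetric]) auto
  also have "(\<Sum>k\<in>r`(-T). ?g k) = ?g (r c) + (\<Sum>k\<in>r`(-T) - {r c}. ?g k)"
    using jc by (intro sum.remove) auto
  also have "(\<Sum>k\<in>r`(-T) - {r c}. ?g k) = 0" using zero by (intro sum.neutral) auto
  finally have e: "rdet (?F(c := x)) = ?g (r c) + 0 + (\<Sum>k\<in>-r`(-T). ?g k)" .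
  have "rdet (?F(c := x)) = rdet ?F * (x $ r c + (\<Sum>k\<in>-r`(-T). \<theta> c k * x $ k))"
    unfolding e Frc \<theta>_def using nz by (simp add: distrib_left sum_distrib_left mult_ac)
  moreover have "\<bar>rdet ((fam T r (u(j := x)))(c := (u(j := x)) j))\<bar> \<le> covol (insert j T) (u(j := x))"
    by (rule rdet_exchange_le) (use jc in auto)
  moreover have "fam T r (u(j := x)) = ?F" using jc by (auto simp: fam_def)
  ultimately show ?thesis using r by (simp add: abs_mult)
qed

text \<open>A column that vanishes on all rows of \<open>T\<close> must carry a unit row in a
  maximal minor. Taking this unit row away leaves a zero column, so the mixed terms of
  \<open>covol_insert_ge\<close> vanish.\<close>

lemma covol_insert_ge_fresh:
  assumes pos: "covol T u > 0" and j: "j \<notin> T" and q: "\<And>c. c \<in> T \<Longrightarrow> u c $ q = 0"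
  shows "covol T u * \<bar>x $ q\<bar> \<le> covol (insert j T) (u(j := x))"
proof -
  obtain r where r: "\<bar>rdet (fam T r u)\<bar> = covol T u" by (rule covol_attained)
  let ?F = "fam T r u"
  have nz: "rdet ?F \<noteq> 0" using r pos by auto
  have inj: "inj_on r (-T)" by (rule fam_inj[OF nz])
  have "q \<in> r ` (-T)"
  proof (rule ccontr)
    assume "q \<notin> r ` (-T)"
    then have "rdet ?F = 0" using q by (intro rdet_zero_column[of _ q]) (auto simp: fam_def axis_def)
    then show False using nz by simp
  qed
  then obtain c where c: "c \<notin> T" "q = r c" by auto
  have "rdet (?F(c := axis k 1)) = 0" if "k \<in> -r`(-T)" for k
    using that c q inj by (intro rdet_zero_column[of _ q]) (auto simp: fam_def axis_def inj_on_def)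
  then have "(\<Sum>k\<in>-r`(-T). rdet (?F(c := axis k 1)) / rdet ?F * x $ k) = 0"
    by (intro sum.neutral) auto
  then show ?thesis using covol_insert_ge[OF r pos j c(1), of x] c by simp
qed

section \<open>Counting on product grids\<close>

lemma sum_PiE_split:
  assumes "Q \<subseteq> X"
  shows "(\<Sum>s\<in>PiE X (\<lambda>_. G). F s)
    = (\<Sum>s\<in>PiE (X - Q) (\<lambda>_. G). \<Sum>y\<in>PiE Q (\<lambda>_. G). F (\<lambda>i. if i \<in> Q then y i else s i))"
  unfolding sum.cartesian_product
  by (rule sum.reindex_bij_witness[where i="\<lambda>(s, y) i. if i \<in> Q then y i else s i"
        and j="\<lambda>s. (restrict s (X - Q), restrict s Q)"])
     (use assms in \<open>auto simp: PiE_def extensional_def fun_eq_iff restrict_def Pi_def intro!: arg_cong[where f=F]\<close>)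

text \<open>The centres \<open>b\<close> depend only on the coordinates outside \<open>R\<close>.
  Once these are fixed, each coordinate in \<open>R\<close> is confined to an interval, and the
  counts multiply.\<close>

lemma card_near_le:
  fixes G :: "real set"
  assumes G: "finite G" and X: "finite X" "R \<subseteq> X"
    and reg: "\<And>c. real (card {y\<in>G. \<bar>y - c\<bar> \<le> \<rho>}) \<le> C0 * \<rho> * real (card G)"
    and b: "\<And>y y' r. (\<And>k. k \<in> X - R \<Longrightarrow> y k = y' k) \<Longrightarrow> b y r = b y' r"
  shows "real (card {y \<in> PiE X (\<lambda>_. G). \<forall>r\<in>R. \<bar>y r - b y r\<bar> \<le> \<rho>})
    \<le> (C0 * \<rho>) ^ card R * real (card G) ^ card X"
proof -
  have fin: "finite R" "finite (X - R)" using X finite_subset by auto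
  let ?A = "{y \<in> PiE X (\<lambda>_. G). \<forall>r\<in>R. \<bar>y r - b y r\<bar> \<le> \<rho>}"
  let ?B = "SIGMA z:PiE (X - R) (\<lambda>_. G). PiE R (\<lambda>r. {x\<in>G. \<bar>x - b z r\<bar> \<le> \<rho>})"
  let ?f = "\<lambda>y. (restrict y (X - R), restrict y R)"
  have finB: "finite ?B" using fin G by (intro finite_SigmaI finite_PiE) auto
  have "inj_on ?f ?A"
  proof (rule inj_onI)
    fix y y' assume y: "y \<in> ?A" "y' \<in> ?A" "?f y = ?f y'"
    then have "y i = y' i" if "i \<in> X" for i
      using that by (cases "i \<in> R") (auto dest: fun_cong[of _ _ i])
    then show "y = y'" using y by (intro PiE_ext[of y X "\<lambda>_. G" y']) auto
  qed
  moreover have "?f ` ?A \<subseteq> ?B"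
  proof (rule image_subsetI)
    fix y assume y: "y \<in> ?A"
    have "b (restrict y (X - R)) r = b y r" for r by (rule b) auto
    then show "?f y \<in> ?B" using y X by (auto simp: PiE_iff)
  qed
  ultimately have "card ?A \<le> card ?B" using finB by (meson card_inj_on_le)
  also have "card ?B = (\<Sum>z\<in>PiE (X - R) (\<lambda>_. G). \<Prod>r\<in>R. card {x\<in>G. \<bar>x - b z r\<bar> \<le> \<rho>})"
    using fin G by (subst card_SigmaI) (auto simp: card_PiE intro!: finite_PiE)
  finally have "real (card ?A) \<le> (\<Sum>z\<in>PiE (X - R) (\<lambda>_. G). \<Prod>r\<in>R. real (card {x\<in>G. \<bar>x - b z r\<bar> \<le> \<rho>}))"
    by (simp flip: of_nat_prod of_nat_sum)
  also have "\<dots> \<le> (\<Sum>z\<in>PiE (X - R) (\<lambda>_. G). \<Prod>r\<in>R. C0 * \<rho> * real (card G))"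
    by (intro sum_mono prod_mono) (auto simp: reg)
  also have "\<dots> = real (card G) ^ card (X - R) * (C0 * \<rho> * real (card G)) ^ card R"
    using fin by (simp add: card_PiE)
  also have "\<dots> = (C0 * \<rho>) ^ card R * real (card G) ^ (card (X - R) + card R)"
    by (simp add: power_mult_distrib power_add)
  also have "card (X - R) + card R = card X"
    using X fin by (metis Diff_disjoint Un_Diff_cancel2 card_Un_disjoint inf_commute sup.absorb1)
  finally show ?thesis .
qed

text \<open>Dyadic decomposition according to the size of \<open>X\<close>.\<close>

lemma sum_powr_le:
  fixes X :: "'a \<Rightarrow> real"
  assumes Y: "finite Y" and X: "\<And>y. y \<in> Y \<Longrightarrow> \<eta> \<le> X y" and eta: "0 < \<eta>" "\<eta> \<le> exp (-1)"
    and card: "\<And>\<rho>. \<eta> \<le> \<rho> \<Longrightarrow> real (card {y\<in>Y. X y \<le> \<rho>}) \<le> M * \<rho> ^ n"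
    and M: "real (card Y) \<le> M" and b: "0 < \<beta>"
  shows "\<beta> \<le> real n \<Longrightarrow> (\<Sum>y\<in>Y. X y powr (-\<beta>)) \<le> 4 * 2 powr \<beta> * ln (1 / \<eta>) * M"
    and "\<beta> + 1 \<le> real n \<Longrightarrow> (\<Sum>y\<in>Y. X y powr (-\<beta>)) \<le> 4 * 2 powr \<beta> * M"
proof -
  let ?g = "\<lambda>y j. if X y \<le> 2 powr (- real j) then 2 powr (\<beta> * (real j + 1)) else 0"
  let ?p = "\<lambda>j. 2 powr ((\<beta> - real n) * real j)"
  \<comment> \<open>The finest dyadic scale: \<open>2 powr (- real L)\<close> is still at least
    \<open>\<eta>\<close>, where the counting hypothesis applies, and no value of \<open>X\<close>
    lies below \<open>\<eta>\<close>.\<close>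
  define L where "L = nat \<lfloor>log 2 (1 / \<eta>)\<rfloor>"
  let ?G = "\<Sum>j\<le>L. ?p j"
  have eta1: "\<eta> < 1" using eta exp_less_one_iff[of "-1::real"] by linarith
  have lpos: "0 \<le> log 2 (1 / \<eta>)" using eta eta1 by (simp add: zero_le_log_cancel_iff)
  have L1: "real L \<le> log 2 (1 / \<eta>)" unfolding L_def using lpos by simp
  have L2: "log 2 (1 / \<eta>) < real L + 1" unfolding L_def using lpos by linarith
  have etaL: "\<eta> \<le> 2 powr (- real L)"
  proof -
    have "2 powr real L \<le> 1 / \<eta>" using L1 eta by (simp add: le_log_iff)
    then show ?thesis using eta by (simp add: powr_minus field_simps)
  qed
  have etaL1: "2 powr (- (real L + 1)) < \<eta>"
  proof -
    have "1 / \<eta> < 2 powr (real L + 1)" using L2 eta by (simp add: log_less_iff)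
    then have "1 < 2 powr (real L + 1) * \<eta>" using eta by (simp add: field_simps)
    then show ?thesis
      unfolding powr_minus_divide by (subst divide_less_eq) (simp add: mult.commute)
  qed
  have M0: "0 \<le> M" using M by linarith
  have pt: "X y powr (-\<beta>) \<le> 1 + (\<Sum>j\<le>L. ?g y j)"
    if y: "y \<in> Y" for y
  proof (cases "X y \<le> 1")
    case False
    then have "X y powr (-\<beta>) \<le> 1 powr (-\<beta>)" using b by (intro powr_mono2') auto
    moreover have "0 \<le> (\<Sum>j\<le>L. ?g y j)"
      by (intro sum_nonneg) auto
    ultimately show ?thesis by simp
  next
    case True
    have Xpos: "X y > 0" using X[OF y] eta by linarith
    let ?J = "{j. j \<le> L \<and> X y \<le> 2 powr (- real j)}"
    define j where "j = Max ?J"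
    have "0 \<in> ?J" using True by simp
    then have j: "j \<in> ?J" unfolding j_def by (intro Max_in) auto
    have "2 powr (- (real j + 1)) \<le> X y"
    proof (cases "j = L")
      case True
      then show ?thesis using etaL1 X[OF y] by simp
    next
      case False
      have "Suc j \<notin> ?J" using Max_ge[of ?J "Suc j"] unfolding j_def[symmetric] by auto
      then show ?thesis using j False by (auto simp: add.commute)
    qed
    then have "X y powr (-\<beta>) \<le> (2 powr (- (real j + 1))) powr (-\<beta>)"
      using b by (intro powr_mono2') auto
    also have "\<dots> = 2 powr (\<beta> * (real j + 1))" by (simp add: powr_powr algebra_simps)
    also have "\<dots> \<le> (\<Sum>j\<le>L. ?g y j)"
      using member_le_sum[of j "{..L}" "?g y"] j
      by simp
    finally show ?thesis by linarith
  qed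
  have "(\<Sum>y\<in>Y. X y powr (-\<beta>)) \<le> (\<Sum>y\<in>Y. 1 + (\<Sum>j\<le>L. ?g y j))"
    by (rule sum_mono[OF pt])
  also have "\<dots> = real (card Y) + (\<Sum>j\<le>L. 2 powr (\<beta> * (real j + 1)) * real (card {y\<in>Y. X y \<le> 2 powr (- real j)}))"
  proof -
    have "(\<Sum>y\<in>Y. \<Sum>j\<le>L. ?g y j)
      = (\<Sum>j\<le>L. \<Sum>y\<in>Y. ?g y j)"
      by (rule sum.swap)
    also have "\<dots> = (\<Sum>j\<le>L. 2 powr (\<beta> * (real j + 1)) * real (card {y\<in>Y. X y \<le> 2 powr (- real j)}))"
      by (rule sum.cong) (use Y in \<open>simp_all add: sum.If_cases Int_def\<close>)
    finally show ?thesis by (simp add: sum.distrib)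
  qed
  also have "\<dots> \<le> M + (\<Sum>j\<le>L. 2 powr (\<beta> * (real j + 1)) * (M * (2 powr (- real j)) ^ n))"
  proof (intro add_mono M sum_mono mult_left_mono card)
    fix j assume "j \<in> {..L}"
    then have "2 powr (- real L) \<le> 2 powr (- real j)" by (intro powr_mono) auto
    then show "\<eta> \<le> 2 powr (- real j)" using etaL by linarith
  qed auto
  also have "\<dots> = M + 2 powr \<beta> * M * ?G"
  proof -
    have "2 powr (\<beta> * (real j + 1)) * (M * (2 powr (- real j)) ^ n) = 2 powr \<beta> * M * ?p j" for j
    proof -
      have "2 powr (\<beta> * (real j + 1)) * (2 powr (- real j)) ^ n = 2 powr (\<beta> * (real j + 1) + (- real j) * real n)"
      proof -
        have "(2 powr (- real j)) ^ n = 2 powr ((- real j) * real n)"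
          by (simp add: powr_powr flip: powr_realpow)
        then show ?thesis by (simp only: powr_add)
      qed
      also have "\<dots> = 2 powr \<beta> * ?p j"
        by (simp add: algebra_simps flip: powr_add)
      finally show ?thesis by (simp add: mult_ac)
    qed
    then show ?thesis unfolding sum_distrib_left by (simp only:)
  qed
  finally have main: "(\<Sum>y\<in>Y. X y powr (-\<beta>)) \<le> M + 2 powr \<beta> * M * ?G" .
  have two: "1 \<le> 2 powr \<beta>" using b by (simp add: ge_one_powr_ge_zero)
  have MM: "M \<le> 2 powr \<beta> * M" using two M0 by (simp add: mult_le_cancel_right1)
  have ln1: "1 \<le> ln (1 / \<eta>)" using eta by (simp add: ln_div) (metis exp_ge_zero ln_exp ln_mono minus_le_iff)
  have Lln: "real L \<le> 2 * ln (1 / \<eta>)"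
  proof -
    have "1/2 \<le> ln (2::real)" using ln_2_less_1 ln2_ge_two_thirds by linarith
    have "real L * (1/2) \<le> log 2 (1 / \<eta>) * ln 2"
      using L1 lpos \<open>1/2 \<le> ln (2::real)\<close> by (intro mult_mono) auto
    also have "\<dots> = ln (1 / \<eta>)" by (simp add: log_def)
    finally show ?thesis by simp
  qed
  show "(\<Sum>y\<in>Y. X y powr (-\<beta>)) \<le> 4 * 2 powr \<beta> * ln (1 / \<eta>) * M" if "\<beta> \<le> real n"
  proof -
    \<comment> \<open>Up to the critical exponent every scale contributes at most 1, so the number
      of scales appears, a logarithm.\<close>
    have "?G \<le> (\<Sum>j\<le>L. 1)"
    proof (rule sum_mono)
      fix j
      have "?p j \<le> 2 powr 0"
        using that by (intro powr_mono) (auto simp: mult_nonpos_nonneg)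
      then show "?p j \<le> 1" by simp
    qed
    then have "?G \<le> 3 * ln (1 / \<eta>)" using Lln ln1 by simp
    then have "2 powr \<beta> * M * ?G \<le> 2 powr \<beta> * M * (3 * ln (1 / \<eta>))"
      using M0 by (intro mult_left_mono) auto
    moreover have "2 powr \<beta> * M * 1 \<le> 2 powr \<beta> * M * ln (1 / \<eta>)" using M0 ln1 by (intro mult_left_mono) auto
    ultimately show ?thesis using main MM by (simp add: algebra_simps)
  qed
  show "(\<Sum>y\<in>Y. X y powr (-\<beta>)) \<le> 4 * 2 powr \<beta> * M" if "\<beta> + 1 \<le> real n"
  proof -
    \<comment> \<open>At distance 1 from the critical exponent the contributions decay
      geometrically.\<close>
    have "?G \<le> (\<Sum>j\<le>L. (1/2) ^ j)"
    proof (rule sum_mono)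
      fix j
      have "?p j \<le> 2 powr (-1 * real j)"
        using that by (intro powr_mono mult_right_mono) auto
      also have "\<dots> = (1/2) ^ j" by (simp add: powr_minus powr_realpow power_one_over inverse_eq_divide)
      finally show "?p j \<le> (1/2) ^ j" .
    qed
    also have "\<dots> \<le> 2"
      using sum_le_suminf[of "\<lambda>j. (1/2::real) ^ j" "{..L}"] suminf_geometric[of "1/2::real"] by simp
    finally have "2 powr \<beta> * M * ?G \<le> 2 powr \<beta> * M * 2"
      using M0 by (intro mult_left_mono) auto
    moreover have "0 \<le> 2 powr \<beta> * M" using M0 by simp
    ultimately show ?thesis using main MM by linarith
  qed
qed

text \<open>By continuity of the determinant. This fixes the size of the unipotent boxes: within
  them the rows with pivots in the expanding block stay independent.\<close>

lemma det_near_id: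
  obtains \<epsilon> where "\<epsilon> > 0"
    "\<And>B :: real^'k::finite^'k. (\<And>i j. \<bar>B $ i $ j - mat 1 $ i $ j\<bar> \<le> \<epsilon>) \<Longrightarrow> 1/2 \<le> \<bar>det B\<bar>"
proof -
  have "continuous_on UNIV (det :: real^'k^'k \<Rightarrow> real)"
    unfolding det_def by (intro continuous_intros)
  then have "isCont (det :: real^'k^'k \<Rightarrow> real) (mat 1)"
    by (simp add: continuous_on_eq_continuous_at)
  then obtain \<delta> where \<delta>: "\<delta> > 0" "\<And>B :: real^'k^'k. dist B (mat 1) < \<delta> \<Longrightarrow> dist (det B) (det (mat 1 :: real^'k^'k)) < 1/2"
    unfolding continuous_at_eps_delta by (metis half_gt_zero zero_less_one)
  define \<epsilon> where "\<epsilon> = \<delta> / (2 * real CARD('k) * real CARD('k))"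
  have c: "real CARD('k) > 0" by simp
  show ?thesis
  proof (rule that[of \<epsilon>])
    show "\<epsilon> > 0" using \<delta> by (simp add: \<epsilon>_def)
    fix B :: "real^'k^'k" assume B: "\<And>i j. \<bar>B $ i $ j - mat 1 $ i $ j\<bar> \<le> \<epsilon>"
    have "norm (B - mat 1) \<le> (\<Sum>i\<in>UNIV. norm ((B - mat 1) $ i))"
      unfolding norm_vec_def[of "B - mat 1"] by (rule L2_set_le_sum) auto
    also have "\<dots> \<le> (\<Sum>i\<in>UNIV. \<Sum>j\<in>UNIV. \<bar>(B - mat 1) $ i $ j\<bar>)"
      by (intro sum_mono norm_le_l1_cart)
    also have "\<dots> \<le> (\<Sum>i\<in>(UNIV :: 'k set). \<Sum>j\<in>(UNIV :: 'k set). \<epsilon>)"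
      using B by (intro sum_mono) simp
    also have "\<dots> = \<delta> / 2" using c by (simp add: \<epsilon>_def)
    also have "\<dots> < \<delta>" using \<delta> by simp
    finally have "dist (det B) 1 < 1/2" using \<delta>(2)[of B] by (simp add: dist_norm)
    then show "1/2 \<le> \<bar>det B\<bar>" unfolding dist_real_def by linarith
  qed
qed

text \<open>The flow divided by its expanding factor, acting on row vectors from the right: the
  columns in \<open>P\<close> receive multiples of the columns outside \<open>P\<close>, and the
  latter shrink by \<open>\<eta>\<close>.\<close>

definition Hmat :: "'k::finite set \<Rightarrow> real \<Rightarrow> ('k \<times> 'k \<Rightarrow> real) \<Rightarrow> real^'k^'k" where
  "Hmat P \<eta> s = (\<chi> i j. if i = j then (if j \<in> P then 1 else \<eta>)
     else if j \<in> P \<and> i \<notin> P then s (j, i) else 0)"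

lemma Hmat_nth:
  "(x v* Hmat P \<eta> s) $ j = (if j \<in> P then x $ j + (\<Sum>i\<in>-P. s (j, i) * x $ i) else \<eta> * x $ j)"
proof (cases "j \<in> P")
  case True
  have "(\<Sum>i\<in>UNIV. Hmat P \<eta> s $ i $ j * x $ i)
      = (\<Sum>i\<in>UNIV. (if i = j then x $ j else 0) + (if i \<in> -P then s (j, i) * x $ i else 0))"
    by (rule sum.cong) (use True in \<open>auto simp: Hmat_def\<close>)
  also have "\<dots> = x $ j + (\<Sum>i\<in>-P. s (j, i) * x $ i)"
    by (simp add: sum.distrib sum.If_cases Compl_eq)
  finally show ?thesis using True by (simp add: vector_matrix_mult_def mult.commute)
next
  case False
  have "(\<Sum>i\<in>UNIV. Hmat P \<eta> s $ i $ j * x $ i) = (\<Sum>i\<in>UNIV. if i = j then \<eta> * x $ j else 0)"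
    by (rule sum.cong) (use False in \<open>auto simp: Hmat_def\<close>)
  then show ?thesis using False by (simp add: vector_matrix_mult_def mult.commute)
qed

text \<open>The average of \<open>covol S\<close> to the power \<open>-card P / card S\<close> over a grid of unipotent
  matrices. After pivoting, the rows with pivot in \<open>P\<close> stay almost orthonormal, and the row \<open>j\<close> with
  pivot \<open>p j\<close> outside \<open>P\<close> is the only one that involves the column \<open>p j\<close> of \<open>s\<close>. Adding
  these rows one at a time, each step multiplies the covolume by the distance of a random point to a
  subspace of codimension at least \<open>card P - card S + 1\<close>. The exponent is critical at most in the last
  step, whence a single logarithm.\<close>

lemma sum_covol_powr_le:
  fixes P S :: "'k::finite set" and G :: "real set" and u :: "'k \<Rightarrow> real^'k"
  assumes S: "S \<noteq> {}" "card S \<le> card P"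
    and id: "\<And>B :: real^'k^'k. (\<And>i j. \<bar>B $ i $ j - mat 1 $ i $ j\<bar> \<le> real CARD('k) * \<epsilon>) \<Longrightarrow> 1/2 \<le> \<bar>det B\<bar>"
    and e0: "0 < \<epsilon>" and G: "finite G" "\<And>y. y \<in> G \<Longrightarrow> \<bar>y\<bar> \<le> \<epsilon>"
    and reg: "\<And>c \<rho>. \<eta> \<le> \<rho> \<Longrightarrow> real (card {y\<in>G. \<bar>y - c\<bar> \<le> \<rho>}) \<le> C0 * \<rho> * real (card G)"
    and C0: "1 \<le> C0" and eta: "0 < \<eta>" "\<eta> \<le> exp (-1)" and u: "covol S u > 0"
  defines "\<beta> \<equiv> real (card P) / real (card S)"
  shows "(\<Sum>s\<in>PiE (P \<times> -P) (\<lambda>_. G). covol S (\<lambda>c. u c v* Hmat P \<eta> s) powr (-\<beta>))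
    \<le> (real CARD('k) ^ card S) powr \<beta> * (2 powr \<beta> * (4 * 2 powr \<beta> * C0 ^ CARD('k)) ^ CARD('k))
        * ln (1 / \<eta>) * real (card G) ^ card (P \<times> -P) * covol S u powr (-\<beta>)"
proof -
  let ?d = "CARD('k)"
  let ?X = "P \<times> -P"
  let ?Z = "PiE ?X (\<lambda>_. G)"
  obtain p w where p: "bij p"
    and pw: "\<And>c c'. c \<in> S \<Longrightarrow> c' \<in> S \<Longrightarrow> w c $ p c' = (if c = c' then 1 else 0)"
    and w1: "\<And>c k. c \<in> S \<Longrightarrow> \<bar>w c $ k\<bar> \<le> 1"
    and uw: "\<And>H. covol S u * covol S (\<lambda>c. w c v* H) \<le> real ?d ^ card S * covol S (\<lambda>c. u c v* H)"
    using covol_pivots[OF u] by blast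
  define v where "v s c = w c v* Hmat P \<eta> s" for s c
  define D where "D T s = covol T (v s)" for T s
  define S1 where "S1 = {c \<in> S. p c \<in> P}"
  define S2 where "S2 = {c \<in> S. p c \<notin> P}"
  have fS: "finite S" "card S > 0" using S by (auto simp: card_gt_0_iff)
  have b0: "\<beta> > 0" using S fS by (simp add: \<beta>_def)
  define B where "B = 4 * 2 powr \<beta> * C0 ^ ?d"
  have two1: "1 \<le> 2 powr \<beta>" using b0 by (simp add: ge_one_powr_ge_zero)
  have B1: "1 \<le> B"
  proof -
    have "1 * 1 * 1 \<le> 4 * 2 powr \<beta> * C0 ^ ?d" by (intro mult_mono two1 one_le_power C0) auto
    then show ?thesis by (simp add: B_def)
  qed
  have ln1: "1 \<le> ln (1 / \<eta>)" using eta by (simp add: ln_div) (metis exp_ge_zero ln_exp ln_mono minus_le_iff)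
  have pinj: "p c = p c' \<longleftrightarrow> c = c'" for c c' using p by (auto simp: bij_def inj_eq)
  \<comment> \<open>At the pivots of \<open>S1\<close> the rows \<open>w\<close> form an identity
    block, which \<open>s\<close> perturbs by at most \<open>?d * \<epsilon>\<close> because the
    entries of \<open>w\<close> are at most 1.\<close>
  have start: "1/2 \<le> D S1 s" if s: "s \<in> ?Z" for s
  proof -
    let ?B = "\<chi> c k. if c \<in> S1 then (if k \<in> S1 then v s c $ p k else 0) else axis c 1 $ k"
    have "1/2 \<le> \<bar>det ?B\<bar>"
    proof (rule id)
      fix i j
      show "\<bar>?B $ i $ j - mat 1 $ i $ j\<bar> \<le> real ?d * \<epsilon>"
      proof (cases "i \<in> S1 \<and> j \<in> S1")
        case True
        have "\<bar>\<Sum>l\<in>-P. s (p j, l) * w i $ l\<bar> \<le> (\<Sum>l\<in>-P. \<epsilon> * 1)"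
          by (rule order_trans[OF sum_abs sum_mono], unfold abs_mult, intro mult_mono)
             (use True s G w1 e0 in \<open>auto simp: S1_def PiE_iff\<close>)
        also have "\<dots> \<le> real ?d * \<epsilon>"
          using e0 by (simp add: mult_right_mono card_mono)
        finally show ?thesis
          using True pw[of i j] by (auto simp: v_def Hmat_nth S1_def mat_def)
      next
        case False
        then show ?thesis using e0 by (auto simp: mat_def axis_def)
      qed
    qed
    also have "det ?B = det (\<chi> c k. fam S1 p (v s) c $ p k)"
      by (rule det_block_cong[of S1]) (auto simp: fam_def vec_eq_iff axis_def pinj)
    also have "\<bar>\<dots>\<bar> = \<bar>rdet (fam S1 p (v s))\<bar>"
      using abs_rdet_permute_columns[OF p, of "fam S1 p (v s)"] by (simp add: rdet_def)
    also have "\<dots> \<le> D S1 s" unfolding D_def by (rule covol_ge)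
    finally show ?thesis .
  qed
  have step: "(\<forall>s\<in>?Z. D (S1 \<union> insert j U) s > 0) \<and>
      (\<Sum>s\<in>?Z. D (S1 \<union> insert j U) s powr (-\<beta>))
      \<le> B * (if insert j U = S2 then ln (1 / \<eta>) else 1) * (\<Sum>s\<in>?Z. D (S1 \<union> U) s powr (-\<beta>))"
    if U: "insert j U \<subseteq> S2" "j \<notin> U" and pos: "\<And>s. s \<in> ?Z \<Longrightarrow> D (S1 \<union> U) s > 0" for j U
  proof -
    define T where "T = S1 \<union> U"
    have T: "T \<subseteq> S" "j \<notin> T" "j \<in> S" "p j \<notin> P" using U by (auto simp: T_def S1_def S2_def)
    have T': "S1 \<union> insert j U = insert j T" by (auto simp: T_def)
    have Sj: "insert j T = S \<longleftrightarrow> insert j U = S2"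
      using U by (auto simp: T_def S1_def S2_def)
    let ?Q = "P \<times> {p j}"
    have QX: "?Q \<subseteq> ?X" using T by auto
    \<comment> \<open>The rows in \<open>T\<close> vanish at the pivot of \<open>j\<close> and do
      not see the coordinates in \<open>?Q\<close>; averaging over these alone leaves
      \<open>D T\<close> fixed.\<close>
    have vT: "v s c = v s' c" if c: "c \<in> T" and ss: "\<And>i. i \<notin> ?Q \<Longrightarrow> s i = s' i" for s s' c
    proof -
      have "w c $ p j = 0" using pw[of c j] c T by auto
      then have "s (k, i) * w c $ i = s' (k, i) * w c $ i" for k i
        using ss[of "(k, i)"] by (cases "i = p j") auto
      then have "(\<Sum>i\<in>-P. s (k, i) * w c $ i) = (\<Sum>i\<in>-P. s' (k, i) * w c $ i)" for k
        by (simp only:)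
      then show ?thesis by (simp add: v_def vec_eq_iff Hmat_nth)
    qed
    have DT: "D T s = D T s'" if "\<And>i. i \<notin> ?Q \<Longrightarrow> s i = s' i" for s s'
      unfolding D_def by (rule covol_cong) (rule vT, use that in auto)
    \<comment> \<open>The column \<open>p j\<close> is zero on \<open>T\<close> and
      \<open>\<eta>\<close> on row \<open>j\<close>. This lower cut-off turns the divergence at the
      critical exponent into a logarithm.\<close>
    have eta_step: "\<eta> * D T s \<le> D (insert j T) s" if s: "s \<in> ?Z" for s
    proof -
      have "covol T (v s) * \<bar>v s j $ p j\<bar> \<le> covol (insert j T) ((v s)(j := v s j))"
      proof (rule covol_insert_ge_fresh)
        show "covol T (v s) > 0" using pos[OF s] by (simp add: D_def T_def)
        show "v s c $ p j = 0" if "c \<in> T" for c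
        proof -
          have "c \<in> S" "c \<noteq> j" using that T by auto
          then show ?thesis using pw[of c j] T by (simp add: v_def Hmat_nth)
        qed
      qed (use T in auto)
      moreover have "v s j $ p j = \<eta>" using pw[of j j] T by (simp add: v_def Hmat_nth)
      ultimately show ?thesis using eta by (simp add: D_def mult.commute)
    qed
    have pos': "D (insert j T) s > 0" if s: "s \<in> ?Z" for s
    proof -
      have "0 < \<eta> * D T s" using eta pos[OF s] by (simp add: T_def)
      then show ?thesis using eta_step[OF s] by linarith
    qed
    let ?fac = "B * (if insert j U = S2 then ln (1 / \<eta>) else 1)"
    have fibre: "(\<Sum>y\<in>PiE ?Q (\<lambda>_. G). D (insert j T) (\<lambda>i. if i \<in> ?Q then y i else s i) powr (-\<beta>))
      \<le> ?fac * (\<Sum>y\<in>PiE ?Q (\<lambda>_. G). D T (\<lambda>i. if i \<in> ?Q then y i else s i) powr (-\<beta>))"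
      if s: "s \<in> PiE (?X - ?Q) (\<lambda>_. G)" for s
    proof -
      define m where "m y = (\<lambda>i. if i \<in> ?Q then y i else s i)" for y
      let ?Y = "PiE ?Q (\<lambda>_. G)"
      have mX: "m y \<in> ?Z" if "y \<in> ?Y" for y
        using that s QX by (auto simp: m_def PiE_iff extensional_def)
      define D0 where "D0 = D T s"
      have D0: "D T (m y) = D0" for y unfolding D0_def by (rule DT) (simp add: m_def)
      show ?thesis
      proof (cases "?Y = {}")
        case False
        then obtain y0 where "y0 \<in> ?Y" by auto
        then have D0pos: "D0 > 0" using pos[OF mX] D0 by (simp add: T_def)
        obtain r where r: "\<bar>rdet (fam T r (v s))\<bar> = covol T (v s)" by (rule covol_attained)
        have rpos: "covol T (v s) > 0" using D0pos by (simp add: D0_def D_def)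
        then have "rdet (fam T r (v s)) \<noteq> 0" using r by auto
        then have rinj: "inj_on r (-T)" by (rule fam_inj)
        define R where "R = r ` (-T) \<inter> P"
        define cr where "cr k = inv_into (-T) r k" for k
        have cr: "cr k \<notin> T" "r (cr k) = k" if "k \<in> R" for k
          using that inv_into_into[of k r "-T"] f_inv_into_f[of k r "-T"] by (auto simp: cr_def R_def)
        define \<theta> where "\<theta> c k = rdet ((fam T r (v s))(c := axis k 1)) / rdet (fam T r (v s))" for c k
        define \<kappa> where "\<kappa> k = w j $ k + (\<Sum>i\<in>-P-{p j}. s (k, i) * w j $ i)" for k
        \<comment> \<open>The centre of the interval to which a small covolume confines
          \<open>y rq\<close>. It involves only coordinates of \<open>y\<close> whose first index
          lies outside the image of \<open>-T\<close>, as \<open>card_near_le\<close>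
          requires.\<close>
        define b where "b y rq = - (\<kappa> (fst rq) + (\<Sum>k\<in>-r`(-T). \<theta> (cr (fst rq)) k *
          (if k \<in> P then \<kappa> k + y (k, p j) else \<eta> * w j $ k)))" for y :: "'k \<times> 'k \<Rightarrow> real" and rq :: "'k \<times> 'k"
        let ?R = "R \<times> {p j}"
        have vj: "v (m y) j $ k = (if k \<in> P then \<kappa> k + y (k, p j) else \<eta> * w j $ k)" for y k
        proof -
          have "(\<Sum>i\<in>-P. m y (k, i) * w j $ i) = m y (k, p j) * w j $ p j + (\<Sum>i\<in>-P-{p j}. m y (k, i) * w j $ i)"
            using T by (intro sum.remove) auto
          also have "(\<Sum>i\<in>-P-{p j}. m y (k, i) * w j $ i) = (\<Sum>i\<in>-P-{p j}. s (k, i) * w j $ i)"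
            by (rule sum.cong) (auto simp: m_def)
          finally have e: "(\<Sum>i\<in>-P. m y (k, i) * w j $ i)
            = m y (k, p j) * w j $ p j + (\<Sum>i\<in>-P-{p j}. s (k, i) * w j $ i)" .
          have "k \<in> P \<Longrightarrow> m y (k, p j) = y (k, p j)" by (simp add: m_def)
          then show ?thesis
            unfolding v_def Hmat_nth e \<kappa>_def using pw[of j j] T by simp
        qed
        have Xb: "D0 * \<bar>y (k, p j) - b y (k, p j)\<bar> \<le> D (insert j T) (m y)" if k: "k \<in> R" for y k
        proof -
          have "covol T (v s) * \<bar>v (m y) j $ r (cr k) + (\<Sum>l\<in>-r`(-T). \<theta> (cr k) l * v (m y) j $ l)\<bar>
              \<le> covol (insert j T) ((v s)(j := v (m y) j))"
            unfolding \<theta>_def by (rule covol_insert_ge[OF r rpos]) (use T cr[OF k] in auto)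
          also have "covol (insert j T) ((v s)(j := v (m y) j)) = D (insert j T) (m y)"
            unfolding D_def
          proof (rule covol_cong)
            fix c assume "c \<in> insert j T"
            then show "((v s)(j := v (m y) j)) c = v (m y) c"
              using vT[of c s "m y"] by (auto simp: m_def)
          qed
          finally have le: "covol T (v s) * \<bar>v (m y) j $ r (cr k) + (\<Sum>l\<in>-r`(-T). \<theta> (cr k) l * v (m y) j $ l)\<bar>
              \<le> D (insert j T) (m y)" .
          have "k \<in> P" using k by (simp add: R_def)
          then have e: "y (k, p j) - b y (k, p j)
              = v (m y) j $ r (cr k) + (\<Sum>l\<in>-r`(-T). \<theta> (cr k) l * v (m y) j $ l)"
            unfolding b_def vj cr(2)[OF k] fst_conv by (simp only: if_True)
          show ?thesis using le unfolding e D0_def D_def[of T] .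
        qed
        define Xf where "Xf y = D (insert j T) (m y) / D0" for y
        define n where "n = card R"
        have finR: "finite R" by simp
        have cardR: "card ?R = n" by (simp add: n_def)
        \<comment> \<open>The image of \<open>-T\<close> under \<open>r\<close> misses only
          \<open>card T\<close> columns, so at least \<open>card P - card T\<close> coordinates are
          confined at once.\<close>
        have nT: "card P \<le> n + card T"
        proof -
          have "card P \<le> card (R \<union> - r ` (-T))" by (rule card_mono) (auto simp: R_def)
          also have "\<dots> \<le> n + card (- r ` (-T))" unfolding n_def by (rule card_Un_le)
          also have "card (- r ` (-T)) = card T"
            using rinj card_mono[of UNIV T] by (simp add: Compl_eq_Diff_UNIV card_Diff_subset card_image)
          finally show ?thesis .
        qed
        have cardST: "card T + 1 \<le> card S" using T fS by (metis Suc_eq_plus1 card_insert_disjoint card_mono finite_subset insert_subset)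
        have cardG: "real (card ?Y) = real (card G) ^ card ?Q" by (simp add: card_PiE)
        define M where "M = C0 ^ n * real (card G) ^ card ?Q"
        have nd: "n \<le> ?d" unfolding n_def by (simp add: card_mono)
        have Mle: "M \<le> C0 ^ ?d * real (card ?Y)"
          unfolding M_def cardG using C0 nd by (intro mult_right_mono power_increasing) auto
        have A: "finite ?Y" using G by (simp add: finite_PiE)
        have Bx: "\<eta> \<le> Xf y" if "y \<in> ?Y" for y
          using eta_step[OF mX[OF that]] D0pos by (simp add: Xf_def D0 field_simps)
        have Cx: "real (card {y\<in>?Y. Xf y \<le> \<rho>}) \<le> M * \<rho> ^ n" if rho: "\<eta> \<le> \<rho>" for \<rho>
        proof -
          have "{y\<in>?Y. Xf y \<le> \<rho>} \<subseteq> {y\<in>?Y. \<forall>rq\<in>?R. \<bar>y rq - b y rq\<bar> \<le> \<rho>}"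
          proof safe
            fix y k assume y: "y \<in> ?Y" "Xf y \<le> \<rho>" and k: "k \<in> R"
            have "\<bar>y (k, p j) - b y (k, p j)\<bar> \<le> Xf y"
              using Xb[OF k, of y] D0pos by (simp add: Xf_def field_simps)
            then show "\<bar>y (k, p j) - b y (k, p j)\<bar> \<le> \<rho>" using y by simp
          qed
          then have "card {y\<in>?Y. Xf y \<le> \<rho>} \<le> card {y\<in>?Y. \<forall>rq\<in>?R. \<bar>y rq - b y rq\<bar> \<le> \<rho>}"
            using A by (intro card_mono) auto
          also have "real \<dots> \<le> (C0 * \<rho>) ^ card ?R * real (card G) ^ card ?Q"
          proof (rule card_near_le[OF G(1)])
            show "finite ?Q" by simp
            show "?R \<subseteq> ?Q" by (auto simp: R_def)
            show "b y rq = b y' rq" if yy: "\<And>k. k \<in> ?Q - ?R \<Longrightarrow> y k = y' k" for y y' rq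
            proof -
              have "(if k \<in> P then \<kappa> k + y (k, p j) else \<eta> * w j $ k) = (if k \<in> P then \<kappa> k + y' (k, p j) else \<eta> * w j $ k)"
                if "k \<in> - r ` (-T)" for k
                using yy[of "(k, p j)"] that by (auto simp: R_def)
              then have "(\<Sum>k\<in>-r`(-T). \<theta> (cr (fst rq)) k * (if k \<in> P then \<kappa> k + y (k, p j) else \<eta> * w j $ k))
                = (\<Sum>k\<in>-r`(-T). \<theta> (cr (fst rq)) k * (if k \<in> P then \<kappa> k + y' (k, p j) else \<eta> * w j $ k))"
                by (intro sum.cong refl arg_cong2[where f="(*)"])
              then show ?thesis by (simp only: b_def)
            qed
          qed (rule reg[OF rho])
          finally show ?thesis by (simp add: cardR M_def power_mult_distrib mult_ac)
        qed
        have Dx: "real (card ?Y) \<le> M"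
          unfolding M_def cardG using C0 by (simp add: mult_le_cancel_right1 one_le_power)
        have "(\<Sum>y\<in>?Y. Xf y powr (-\<beta>)) \<le> ?fac * real (card ?Y)"
        proof (cases "insert j U = S2")
          case True
          then have "insert j T = S" using Sj by simp
          then have "card S = card T + 1" using T fS finite_subset by (metis Suc_eq_plus1 card_insert_disjoint)
          then have nn: "card P + 1 \<le> n + card S" using nT by simp
          have "\<beta> \<le> real n"
          proof -
            \<comment> \<open>With \<open>card P = card S + a\<close> the codimension is at least
              \<open>a + 1\<close>, and \<open>card S * (a + 1)\<close> is at least
              \<open>card S + a\<close>; equality holds only for \<open>a = 0\<close> or
              \<open>card S = 1\<close>.\<close>
            have "card P \<le> card S * n"
            proof -
              obtain a where a: "card P = card S + a" using S le_iff_add by auto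
              then have "a + 1 \<le> n" using nn by simp
              then have "card S * (a + 1) \<le> card S * n" by (rule mult_le_mono2)
              moreover have "a \<le> card S * a" using fS by simp
              ultimately show ?thesis unfolding a distrib_left by linarith
            qed
            then have "real (card P) \<le> real n * real (card S)" by (metis mult.commute of_nat_le_iff of_nat_mult)
            then show ?thesis using fS by (simp add: \<beta>_def divide_le_eq)
          qed
          then have "(\<Sum>y\<in>?Y. Xf y powr (-\<beta>)) \<le> 4 * 2 powr \<beta> * ln (1 / \<eta>) * M"
            proof (intro sum_powr_le(1)[OF A _ eta _ Dx b0])
            show "real (card {y\<in>?Y. Xf y \<le> \<rho>}) \<le> M * \<rho> ^ n" if "\<eta> \<le> \<rho>" for \<rho>
              using that by (rule Cx)
          qed (rule Bx)
          also have "\<dots> \<le> 4 * 2 powr \<beta> * ln (1 / \<eta>) * (C0 ^ ?d * real (card ?Y))"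
            using ln1 by (intro mult_left_mono Mle) auto
          finally show ?thesis using True by (simp add: B_def mult_ac)
        next
          case False
          then have "card (insert j T) < card S"
            using Sj T fS by (metis insert_subset psubsetI psubset_card_mono)
          then have "card S \<ge> card T + 2" using T fS finite_subset by (metis Suc_eq_plus1 Suc_leI add_2_eq_Suc' card_insert_disjoint)
          then have nn: "card P + 2 \<le> n + card S" using nT by simp
          have "\<beta> + 1 \<le> real n"
          proof -
            \<comment> \<open>Before the last row one more codimension is available,
              \<open>a + 2\<close> in place of \<open>a + 1\<close>.\<close>
            have "card P + card S \<le> card S * n"
            proof -
              obtain a where a: "card P = card S + a" using S le_iff_add by auto
              then have "a + 2 \<le> n" using nn by simp
              then have "card S * (a + 2) \<le> card S * n" by (rule mult_le_mono2)
              moreover have "a \<le> card S * a" using fS by simp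
              ultimately show ?thesis unfolding a distrib_left by linarith
            qed
            then have "real (card P + card S) \<le> real n * real (card S)" by (metis mult.commute of_nat_le_iff of_nat_mult)
            moreover have "\<beta> + 1 = real (card P + card S) / real (card S)"
              using fS S by (simp add: \<beta>_def add_divide_distrib)
            ultimately show ?thesis using fS S by (simp add: divide_le_eq)
          qed
          then have "(\<Sum>y\<in>?Y. Xf y powr (-\<beta>)) \<le> 4 * 2 powr \<beta> * M"
            proof (intro sum_powr_le(2)[OF A _ eta _ Dx b0])
            show "real (card {y\<in>?Y. Xf y \<le> \<rho>}) \<le> M * \<rho> ^ n" if "\<eta> \<le> \<rho>" for \<rho>
              using that by (rule Cx)
          qed (rule Bx)
          also have "\<dots> \<le> 4 * 2 powr \<beta> * (C0 ^ ?d * real (card ?Y))"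
            by (intro mult_left_mono Mle) auto
          finally show ?thesis using False by (simp add: B_def mult_ac)
        qed
        then have le: "D0 powr (-\<beta>) * (\<Sum>y\<in>?Y. Xf y powr (-\<beta>)) \<le> D0 powr (-\<beta>) * (?fac * real (card ?Y))"
          by (intro mult_left_mono) auto
        have "D (insert j T) (m y) powr (-\<beta>) = D0 powr (-\<beta>) * Xf y powr (-\<beta>)" if "y \<in> ?Y" for y
        proof -
          have "0 \<le> Xf y" using Bx[OF that] eta by linarith
          moreover have "D (insert j T) (m y) = D0 * Xf y" using D0pos by (simp add: Xf_def)
          ultimately show ?thesis using D0pos by (simp add: powr_mult)
        qed
        then have "(\<Sum>y\<in>?Y. D (insert j T) (m y) powr (-\<beta>)) = D0 powr (-\<beta>) * (\<Sum>y\<in>?Y. Xf y powr (-\<beta>))"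
          unfolding sum_distrib_left by (rule sum.cong[OF refl])
        moreover have "(\<Sum>y\<in>?Y. D T (m y) powr (-\<beta>)) = real (card ?Y) * D0 powr (-\<beta>)"
          by (simp add: D0)
        ultimately have "(\<Sum>y\<in>?Y. D (insert j T) (m y) powr (-\<beta>)) \<le> ?fac * (\<Sum>y\<in>?Y. D T (m y) powr (-\<beta>))"
          using le by (simp only: mult_ac)
        then show ?thesis unfolding m_def .
      qed simp
    qed
    have "(\<Sum>s\<in>?Z. D (insert j T) s powr (-\<beta>))
      \<le> (\<Sum>s\<in>PiE (?X - ?Q) (\<lambda>_. G). ?fac * (\<Sum>y\<in>PiE ?Q (\<lambda>_. G). D T (\<lambda>i. if i \<in> ?Q then y i else s i) powr (-\<beta>)))"
      unfolding sum_PiE_split[OF QX] by (rule sum_mono[OF fibre])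
    also have "\<dots> = ?fac * (\<Sum>s\<in>?Z. D T s powr (-\<beta>))"
      unfolding sum_PiE_split[OF QX, of _ G] by (simp add: sum_distrib_left)
    finally show ?thesis using pos' unfolding T' T_def[symmetric] by blast
  qed
  define Km where "Km = real (card G) ^ card ?X"
  have "(\<forall>s\<in>?Z. D (S1 \<union> U) s > 0) \<and>
    (\<Sum>s\<in>?Z. D (S1 \<union> U) s powr (-\<beta>))
      \<le> 2 powr \<beta> * B ^ card U * (if U = S2 then ln (1 / \<eta>) else 1) * Km" if "U \<subseteq> S2" for U
  proof -
    have "finite U" by simp
    then show ?thesis using that
    proof (induction U)
      case empty
      have "(\<Sum>s\<in>?Z. D S1 s powr (-\<beta>)) \<le> (\<Sum>s\<in>?Z. (1/2) powr (-\<beta>))"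
        using start b0 by (intro sum_mono powr_mono2') auto
      also have "\<dots> = 2 powr \<beta> * Km"
        by (simp add: Km_def card_PiE powr_minus powr_divide)
      finally have 1: "(\<Sum>s\<in>?Z. D S1 s powr (-\<beta>)) \<le> 2 powr \<beta> * Km" .
      \<comment> \<open>If \<open>S2\<close> is empty the claim already carries the logarithm, which
        is at least 1.\<close>
      have "0 \<le> 2 powr \<beta> * Km" by (simp add: Km_def)
      then have "2 powr \<beta> * Km * 1 \<le> 2 powr \<beta> * Km * ln (1 / \<eta>)" using ln1 by (intro mult_left_mono)
      then have 2: "(\<Sum>s\<in>?Z. D S1 s powr (-\<beta>)) \<le> 2 powr \<beta> * Km * ln (1 / \<eta>)"
        using 1 by linarith
      have "\<forall>s\<in>?Z. D S1 s > 0"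
      proof
        fix s assume "s \<in> ?Z"
        from start[OF this] show "D S1 s > 0" by linarith
      qed
      then show ?case using 1 2 by (simp add: mult_ac)
    next
      case (insert j U)
      \<comment> \<open>As \<open>j\<close> is in \<open>S2\<close> but not in \<open>U\<close>, the
        induction hypothesis comes without the logarithm.\<close>
      then have IH: "\<forall>s\<in>?Z. D (S1 \<union> U) s > 0"
        "(\<Sum>s\<in>?Z. D (S1 \<union> U) s powr (-\<beta>)) \<le> 2 powr \<beta> * B ^ card U * Km"
        by (auto split: if_splits)
      let ?l = "if insert j U = S2 then ln (1 / \<eta>) else 1"
      have st: "\<forall>s\<in>?Z. D (S1 \<union> insert j U) s > 0"
        "(\<Sum>s\<in>?Z. D (S1 \<union> insert j U) s powr (-\<beta>))
          \<le> B * ?l * (\<Sum>s\<in>?Z. D (S1 \<union> U) s powr (-\<beta>))"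
        using step[of j U] insert IH(1) by blast+
      have "B * ?l * (\<Sum>s\<in>?Z. D (S1 \<union> U) s powr (-\<beta>)) \<le> B * ?l * (2 powr \<beta> * B ^ card U * Km)"
        using IH(2) B1 ln1 by (intro mult_left_mono) auto
      also have "\<dots> = 2 powr \<beta> * B ^ card (insert j U) * ?l * Km"
        using insert by (simp add: mult_ac)
      finally show ?case using st by linarith
    qed
  qed
  from this[of S2] have DS: "\<forall>s\<in>?Z. D S s > 0"
    "(\<Sum>s\<in>?Z. D S s powr (-\<beta>)) \<le> 2 powr \<beta> * B ^ card S2 * ln (1 / \<eta>) * Km"
  proof -
    have "S1 \<union> S2 = S" by (auto simp: S1_def S2_def)
    then show "\<forall>s\<in>?Z. D S s > 0"
      "(\<Sum>s\<in>?Z. D S s powr (-\<beta>)) \<le> 2 powr \<beta> * B ^ card S2 * ln (1 / \<eta>) * Km"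
      using \<open>S2 \<subseteq> S2 \<Longrightarrow> _\<close> by auto
  qed
  let ?c = "real ?d ^ card S"
  have c0: "0 < ?c" by simp
  have "covol S (\<lambda>c. u c v* Hmat P \<eta> s) powr (-\<beta>) \<le> ?c powr \<beta> * covol S u powr (-\<beta>) * D S s powr (-\<beta>)"
    if s: "s \<in> ?Z" for s
  proof -
    have "D S s > 0" using DS(1) s by blast
    then have "0 < covol S u * D S s / ?c" using u c0 by simp
    moreover have "covol S u * D S s / ?c \<le> covol S (\<lambda>c. u c v* Hmat P \<eta> s)"
      using uw[of "Hmat P \<eta> s"] c0 by (simp add: D_def v_def[abs_def] divide_le_eq mult.commute)
    ultimately have "covol S (\<lambda>c. u c v* Hmat P \<eta> s) powr (-\<beta>) \<le> (covol S u * D S s / ?c) powr (-\<beta>)"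
      using b0 by (intro powr_mono2') auto
    also have "\<dots> = ?c powr \<beta> * covol S u powr (-\<beta>) * D S s powr (-\<beta>)"
      using u \<open>D S s > 0\<close> c0 by (simp add: powr_divide powr_mult powr_minus field_simps)
    finally show ?thesis .
  qed
  then have "(\<Sum>s\<in>?Z. covol S (\<lambda>c. u c v* Hmat P \<eta> s) powr (-\<beta>))
    \<le> ?c powr \<beta> * covol S u powr (-\<beta>) * (\<Sum>s\<in>?Z. D S s powr (-\<beta>))"
    by (simp add: sum_mono sum_distrib_left)
  also have "\<dots> \<le> ?c powr \<beta> * covol S u powr (-\<beta>) * (2 powr \<beta> * B ^ card S2 * ln (1 / \<eta>) * Km)"
    using DS(2) by (intro mult_left_mono) auto
  also have "\<dots> \<le> ?c powr \<beta> * covol S u powr (-\<beta>) * (2 powr \<beta> * B ^ ?d * ln (1 / \<eta>) * Km)"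
    using B1 ln1 by (intro mult_left_mono mult_right_mono power_increasing) (auto simp: Km_def card_mono)
  finally show ?thesis unfolding B_def Km_def by (simp add: mult_ac)
qed

subsection \<open>Grids\<close>

text \<open>The midpoints of \<open>K\<close> equal cells of the interval from
  \<open>-\<epsilon>\<close> to \<open>\<epsilon>\<close>; a cell has half-width
  \<open>\<epsilon> / K\<close>.\<close>

definition gridpts :: "real \<Rightarrow> nat \<Rightarrow> real set" where
  "gridpts \<epsilon> K = (\<lambda>k. \<epsilon> * ((2 * real k + 1) / real K - 1)) ` {..<K}"

lemma finite_gridpts [simp]: "finite (gridpts \<epsilon> K)"
  by (simp add: gridpts_def)

lemma inj_gridpts: "\<epsilon> > 0 \<Longrightarrow> inj_on (\<lambda>k. \<epsilon> * ((2 * real k + 1) / real K - 1)) {..<K}"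
  by (rule inj_onI) (auto simp: field_simps)

lemma card_gridpts: "\<epsilon> > 0 \<Longrightarrow> card (gridpts \<epsilon> K) = K"
  unfolding gridpts_def by (simp add: card_image[OF inj_gridpts])

lemma gridpts_bound:
  assumes "\<epsilon> > 0" "y \<in> gridpts \<epsilon> K"
  shows "\<bar>y\<bar> \<le> \<epsilon>"
proof -
  obtain k where k: "k < K" "y = \<epsilon> * ((2 * real k + 1) / real K - 1)"
    using assms by (auto simp: gridpts_def)
  have "(2 * real k + 1) / real K \<le> 2" "0 \<le> (2 * real k + 1) / real K"
    using k by (auto simp: divide_le_eq)
  then have "\<bar>(2 * real k + 1) / real K - 1\<bar> \<le> 1" by linarith
  then show ?thesis using assms k by (simp add: abs_mult mult_left_le)
qed

lemma gridpts_cover: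
  assumes "\<epsilon> > 0" "\<bar>x\<bar> \<le> \<epsilon>" "K > 0"
  obtains y where "y \<in> gridpts \<epsilon> K" "\<bar>x - y\<bar> \<le> \<epsilon> / real K"
proof -
  define z where "z = (x / \<epsilon> + 1) / 2 * real K"
  have z: "0 \<le> z" "z \<le> real K"
  proof -
    have "-1 \<le> x / \<epsilon>" "x / \<epsilon> \<le> 1" using assms by (auto simp: field_simps)
    then show "0 \<le> z" unfolding z_def using assms by (intro mult_nonneg_nonneg) auto
    have "(x / \<epsilon> + 1) / 2 * real K \<le> 1 * real K"
      using \<open>x / \<epsilon> \<le> 1\<close> by (intro mult_right_mono) auto
    then show "z \<le> real K" by (simp add: z_def)
  qed
  have x: "x = \<epsilon> * (2 * z / real K - 1)"
    using assms by (simp add: z_def field_simps)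
  have close: "\<bar>x - \<epsilon> * ((2 * real k + 1) / real K - 1)\<bar> \<le> \<epsilon> / real K"
    if "real k \<le> z" "z \<le> real k + 1" for k
  proof -
    have "x - \<epsilon> * ((2 * real k + 1) / real K - 1) = \<epsilon> / real K * (2 * (z - real k) - 1)"
      unfolding x using assms by (simp add: field_simps)
    moreover have "\<bar>2 * (z - real k) - 1\<bar> \<le> 1" using that by (simp add: abs_le_iff)
    moreover have "\<bar>\<epsilon> / real K * (2 * (z - real k) - 1)\<bar> \<le> \<bar>\<epsilon> / real K\<bar>"
      unfolding abs_mult[of "\<epsilon> / real K"] using \<open>\<bar>2 * (z - real k) - 1\<bar> \<le> 1\<close> by (intro mult_left_le) auto
    ultimately show ?thesis using assms by simp
  qed
  show ?thesis
  proof (cases "z < real K")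
    case True
    define k where "k = nat \<lfloor>z\<rfloor>"
    have "k < K" using True z unfolding k_def by linarith
    moreover have "real k \<le> z" "z \<le> real k + 1" using z unfolding k_def by linarith+
    ultimately show ?thesis using close by (intro that) (auto simp: gridpts_def)
  next
    case False
    \<comment> \<open>Here \<open>z = K\<close> is the right end point, which belongs to the last
      cell.\<close>
    have "K - 1 < K" "real (K - 1) \<le> z" "z \<le> real (K - 1) + 1"
      using False z assms by (auto simp: of_nat_diff)
    then show ?thesis
      unfolding gridpts_def using close[of "K - 1"] by (intro that[unfolded gridpts_def, OF imageI]) auto
  qed
qed

lemma card_nat_spread_le:
  fixes A :: "nat set"
  assumes "finite A" "\<And>k l. k \<in> A \<Longrightarrow> l \<in> A \<Longrightarrow> real l - real k \<le> L" "0 \<le> L"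
  shows "real (card A) \<le> L + 1"
proof (cases "A = {}")
  case False
  let ?a = "Min A"
  have a: "?a \<in> A" "\<And>l. l \<in> A \<Longrightarrow> ?a \<le> l" using False assms by auto
  have "A \<subseteq> {?a..?a + nat \<lfloor>L\<rfloor>}"
  proof
    fix l assume l: "l \<in> A"
    then have "real l - real ?a \<le> L" using assms a by blast
    then have "l \<le> ?a + nat \<lfloor>L\<rfloor>" using assms(3) by linarith
    then show "l \<in> {?a..?a + nat \<lfloor>L\<rfloor>}" using a l by simp
  qed
  then have "card A \<le> Suc (nat \<lfloor>L\<rfloor>)" using card_mono[of "{?a..?a + nat \<lfloor>L\<rfloor>}" A] by simp
  then show ?thesis using assms(3) by linarith
qed (use assms in simp)

text \<open>The spacing is \<open>2 * \<epsilon> / K\<close>, so the interval contains at most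
  \<open>\<rho> * K / \<epsilon> + 1\<close> points; hypothesis \<open>r\<close> absorbs the
  1.\<close>

lemma card_gridpts_near:
  assumes e: "\<epsilon> > 0" and K: "K > 0" and r: "1 \<le> \<rho> * real K"
  shows "real (card {y \<in> gridpts \<epsilon> K. \<bar>y - c\<bar> \<le> \<rho>}) \<le> (1 + 1 / \<epsilon>) * \<rho> * real (card (gridpts \<epsilon> K))"
proof -
  let ?f = "\<lambda>k. \<epsilon> * ((2 * real k + 1) / real K - 1)"
  let ?A = "{k \<in> {..<K}. \<bar>?f k - c\<bar> \<le> \<rho>}"
  have rho: "\<rho> > 0" using r K by (metis less_le_trans of_nat_0_less_iff zero_less_mult_pos2 zero_less_one)
  have "{y \<in> gridpts \<epsilon> K. \<bar>y - c\<bar> \<le> \<rho>} = ?f ` ?A" by (auto simp: gridpts_def)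
  then have "card {y \<in> gridpts \<epsilon> K. \<bar>y - c\<bar> \<le> \<rho>} \<le> card ?A" by (simp add: card_image_le)
  also have "real (card ?A) \<le> \<rho> * real K / \<epsilon> + 1"
  proof (rule card_nat_spread_le)
    fix k l assume kl: "k \<in> ?A" "l \<in> ?A"
    then have "?f l - ?f k \<le> 2 * \<rho>" by (auto simp: abs_le_iff)
    moreover have "?f l - ?f k = \<epsilon> * 2 * (real l - real k) / real K"
      using K by (simp add: field_simps)
    ultimately have "\<epsilon> * 2 * (real l - real k) \<le> 2 * \<rho> * real K" using K by (simp add: divide_le_eq)
    then show "real l - real k \<le> \<rho> * real K / \<epsilon>" using e by (simp add: le_divide_eq mult.commute)
  qed (use rho e in auto)
  also have "\<dots> \<le> \<rho> * real K / \<epsilon> + \<rho> * real K" using r by simp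
  finally show ?thesis using e by (simp add: card_gridpts field_simps)
qed

section \<open>Matrix grids and unipotent coordinates\<close>

definition mgrid :: "real \<Rightarrow> nat \<Rightarrow> (real^'n^'m) set" where
  "mgrid \<epsilon> K = {y. \<forall>a b. y $ a $ b \<in> gridpts \<epsilon> K}"

text \<open>With this many cells per side, a cell enlarged by \<open>exp T\<close> fits into the
  initial box again.\<close>

definition npts :: "real \<Rightarrow> nat" where
  "npts T = nat \<lceil>exp T\<rceil>"

lemma npts_bounds: "exp T \<le> real (npts T)" "real (npts T) \<le> exp T + 1" "npts T > 0"
proof -
  have "0 < exp T" by simp
  then show "exp T \<le> real (npts T)" "real (npts T) \<le> exp T + 1" "npts T > 0"
    unfolding npts_def by linarith+
qed

text \<open>The unipotent coordinates of the flow and of its inverse transpose, as arguments of \<open>Hmat\<close>.\<close>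

definition upper :: "real^'n^'m \<Rightarrow> ('m::finite + 'n::finite) \<times> ('m + 'n) \<Rightarrow> real" where
  "upper y = restrict (\<lambda>(j, i). case (j, i) of (Inl a, Inr b) \<Rightarrow> y $ a $ b | _ \<Rightarrow> 0)
     (range Inl \<times> - range Inl)"

definition lower :: "real^'n^'m \<Rightarrow> ('m::finite + 'n::finite) \<times> ('m + 'n) \<Rightarrow> real" where
  "lower y = restrict (\<lambda>(j, i). case (j, i) of (Inr b, Inl a) \<Rightarrow> - y $ a $ b | _ \<Rightarrow> 0)
     (range Inr \<times> - range Inr)"

lemma Compl_range_sum: "- range Inl = range Inr" "- range Inr = range Inl"
  by (auto, metis rangeI sumE, metis rangeI sumE)

lemma upper_simp [simp]: "upper y (Inl a, Inr b) = y $ a $ b"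
  by (simp add: upper_def Compl_range_sum)

lemma lower_simp [simp]: "lower y (Inr b, Inl a) = - y $ a $ b"
  by (simp add: lower_def Compl_range_sum)

text \<open>The restriction in \<open>upper\<close> makes it a bijection of the matrix grid onto the
  extensional functions of the product grid.\<close>

lemma sum_mgrid_upper:
  "(\<Sum>y\<in>(mgrid \<epsilon> K :: (real^'n::finite^'m::finite) set). F (upper y))
    = (\<Sum>s\<in>PiE (range Inl \<times> - range Inl) (\<lambda>_. gridpts \<epsilon> K). F s)"
  by (rule sum.reindex_bij_witness[where j="upper" and i="\<lambda>s. \<chi> a b. s (Inl a, Inr b)"])
     (auto simp: mgrid_def vec_eq_iff PiE_iff upper_def Compl_range_sum extensional_def fun_eq_iff split: sum.splits)

lemma sum_mgrid_lower:
  "(\<Sum>y\<in>(mgrid \<epsilon> K :: (real^'n::finite^'m::finite) set). F (lower y))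
    = (\<Sum>s\<in>PiE (range Inr \<times> - range Inr) (\<lambda>_. uminus ` gridpts \<epsilon> K). F s)"
  by (rule sum.reindex_bij_witness[where j="lower" and i="\<lambda>s. \<chi> a b. - s (Inr b, Inl a)"])
     (auto simp: mgrid_def vec_eq_iff PiE_iff lower_def Compl_range_sum extensional_def fun_eq_iff image_iff
        minus_equation_iff[of _ "_ $ _"] split: sum.splits, metis minus_minus)

lemma card_mgrid:
  assumes "\<epsilon> > 0"
  shows "finite (mgrid \<epsilon> K :: (real^'n::finite^'m::finite) set)"
    "card (mgrid \<epsilon> K :: (real^'n::finite^'m::finite) set) = K ^ (CARD('m) * CARD('n))"
proof -
  let ?X = "range Inl \<times> - range Inl :: (('m + 'n) \<times> ('m + 'n)) set"
  let ?i = "\<lambda>s :: ('m + 'n) \<times> ('m + 'n) \<Rightarrow> real. (\<chi> a b. s (Inl a, Inr b)) :: real^'n^'m"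
  have "mgrid \<epsilon> K \<subseteq> ?i ` PiE ?X (\<lambda>_. gridpts \<epsilon> K)"
  proof
    fix y :: "real^'n^'m" assume y: "y \<in> mgrid \<epsilon> K"
    have "y = ?i (upper y)" by (simp add: vec_eq_iff)
    moreover have "upper y \<in> PiE ?X (\<lambda>_. gridpts \<epsilon> K)"
      using y by (auto simp: mgrid_def upper_def Compl_range_sum PiE_iff)
    ultimately show "y \<in> ?i ` PiE ?X (\<lambda>_. gridpts \<epsilon> K)" by blast
  qed
  then show fin: "finite (mgrid \<epsilon> K :: (real^'n::finite^'m::finite) set)"
    by (rule finite_subset) (intro finite_imageI finite_PiE, auto)
  have "real (card (mgrid \<epsilon> K :: (real^'n^'m) set)) = (\<Sum>y\<in>(mgrid \<epsilon> K :: (real^'n^'m) set). 1)" by simp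
  also have "\<dots> = (\<Sum>s\<in>PiE ?X (\<lambda>_. gridpts \<epsilon> K). 1)"
    by (rule sum_mgrid_upper[of "\<lambda>_. 1"])
  also have "\<dots> = real (K ^ (CARD('m) * CARD('n)))"
    using assms by (simp add: card_PiE card_gridpts card_cartesian_product Compl_range_sum card_image)
  finally show "card (mgrid \<epsilon> K :: (real^'n::finite^'m::finite) set) = K ^ (CARD('m) * CARD('n))"
    by (simp only: of_nat_eq_iff)
qed

subsection \<open>The flow\<close>

lemma det_gmat: "det (gmat t :: real^('m::finite + 'n::finite)^('m + 'n)) = 1"
proof -
  have "det (gmat t :: real^('m + 'n)^('m + 'n)) = (\<Prod>i\<in>UNIV. (gmat t :: real^('m + 'n)^('m + 'n)) $ i $ i)"
    by (rule det_diagonal) (simp add: gmat_def)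
  also have "\<dots> = (\<Prod>i\<in>UNIV <+> UNIV. (gmat t :: real^('m + 'n)^('m + 'n)) $ i $ i)" by simp
  also have "\<dots> = exp (real CARD('n) * t) ^ CARD('m) * exp (- real CARD('m) * t) ^ CARD('n)"
    by (subst prod.Plus) (auto simp: gmat_def)
  also have "\<dots> = 1" by (simp add: exp_of_nat_mult[symmetric] mult_ac flip: exp_add)
  finally show ?thesis .
qed

lemma det_umat: "det (umat s :: real^('m::finite + 'n::finite)^('m + 'n)) = 1"
proof -
  have "det (umat s :: real^('m + 'n)^('m + 'n)) = det (mat 1 :: real^('m + 'n)^('m + 'n))"
  proof (rule det_block_cong[of "range Inl"])
    fix c :: "'m + 'n"
    show "mat 1 $ c = axis c 1" by (auto simp: mat_def axis_def vec_eq_iff)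
    show "umat s $ c = axis c 1" if "c \<notin> range Inl"
      using that by (cases c) (auto simp: umat_def axis_def vec_eq_iff)
  next
    fix c k :: "'m + 'n" assume "c \<in> range Inl" "k \<in> range Inl"
    then show "umat s $ c $ k = mat 1 $ c $ k" by (auto simp: umat_def mat_def)
  qed
  then show ?thesis by simp
qed

lemma gmat_mult_nth: "(gmat t ** B) $ i $ j = gmat t $ i $ i * B $ i $ j"
  for B :: "real^('m::finite + 'n::finite)^('m + 'n)"
proof -
  have "(\<Sum>k\<in>UNIV. gmat t $ i $ k * B $ k $ j) = (\<Sum>k\<in>UNIV. if k = i then gmat t $ i $ i * B $ i $ j else 0)"
    by (rule sum.cong) (auto simp: gmat_def)
  then show ?thesis by (simp add: matrix_matrix_mult_def)
qed

lemma mult_gmat_nth: "(B ** gmat t) $ i $ j = B $ i $ j * gmat t $ j $ j"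
  for B :: "real^('m::finite + 'n::finite)^('m + 'n)"
proof -
  have "(\<Sum>k\<in>UNIV. B $ i $ k * gmat t $ k $ j) = (\<Sum>k\<in>UNIV. if k = j then B $ i $ j * gmat t $ j $ j else 0)"
    by (rule sum.cong) (auto simp: gmat_def)
  then show ?thesis by (simp add: matrix_matrix_mult_def)
qed

lemma gmat_add: "gmat s ** gmat t = (gmat (s + t) :: real^('m::finite + 'n::finite)^('m + 'n))"
proof -
  have "(gmat s ** gmat t) $ i $ j = (gmat (s + t) :: real^('m + 'n)^('m + 'n)) $ i $ j" for i j
    unfolding gmat_mult_nth by (auto simp: gmat_def distrib_left split: sum.splits simp flip: exp_add)
  then show ?thesis by (simp add: vec_eq_iff)
qed

lemma umat_add: "umat s ** umat t = (umat (s + t) :: real^('m::finite + 'n::finite)^('m + 'n))"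
proof -
  have "(umat s ** umat t) $ i $ j = (umat (s + t) :: real^('m + 'n)^('m + 'n)) $ i $ j" for i j
  proof -
    have "(\<Sum>k\<in>UNIV. umat s $ i $ k * umat t $ k $ j) =
       (\<Sum>k\<in>UNIV <+> UNIV. umat s $ i $ k * (umat t :: real^('m + 'n)^('m + 'n)) $ k $ j)" by simp
    also have "\<dots> = umat (s + t) $ i $ j"
      by (subst sum.Plus)
         (auto simp: umat_def split: sum.splits
           simp: if_distrib[where f="\<lambda>z. z * _"] if_distrib[where f="\<lambda>z. _ * z"] cong: if_cong)
    finally show ?thesis by (simp add: matrix_matrix_mult_def)
  qed
  then show ?thesis by (simp add: vec_eq_iff)
qed

lemma umat_0: "umat 0 = mat 1"
  by (auto simp: umat_def mat_def vec_eq_iff split: sum.splits)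

lemma gmat_0: "gmat 0 = mat 1"
  by (auto simp: gmat_def mat_def vec_eq_iff split: sum.splits)

text \<open>The self-similarity behind the covering: at time \<open>t\<close> a cell of relative
  size \<open>exp (- (m + n) t)\<close> has become a full box.\<close>

lemma gmat_umat:
  "gmat t ** umat s = umat (exp ((real CARD('m) + real CARD('n)) * t) *\<^sub>R s) **
    (gmat t :: real^('m::finite + 'n::finite)^('m + 'n))"
  by (simp add: vec_eq_iff gmat_mult_nth mult_gmat_nth)
     (auto simp: gmat_def umat_def algebra_simps split: sum.splits simp flip: exp_add)

lemma transpose_flow:
  "transpose (gmat t ** umat y) = exp (real CARD('n) * t) *\<^sub>R
     Hmat (range Inl) (exp (- (real CARD('m) + real CARD('n)) * t)) (upper y)"
  for y :: "real^'n::finite^'m::finite"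
  by (simp add: vec_eq_iff transpose_def gmat_mult_nth)
     (auto simp: gmat_def umat_def Hmat_def algebra_simps split: sum.splits simp flip: exp_add)

text \<open>The annihilator moves by the inverse; its expanding block consists of the last
  \<open>n\<close> coordinates, with factor \<open>exp (m t)\<close>.\<close>

lemma inverse_flow:
  "umat (- y) ** gmat (- t) = exp (real CARD('m) * t) *\<^sub>R
     Hmat (range Inr) (exp (- (real CARD('m) + real CARD('n)) * t)) (lower y)"
  for y :: "real^'n::finite^'m::finite"
  by (simp add: vec_eq_iff mult_gmat_nth)
     (auto simp: gmat_def umat_def Hmat_def algebra_simps split: sum.splits simp flip: exp_add)

text \<open>Exponents for which the averages of the powers of the covolumes contract by
  \<open>exp (- m n t)\<close>, up to the factor \<open>t\<close>.\<close>

definition height_exp :: "nat \<Rightarrow> nat \<Rightarrow> nat \<Rightarrow> real" where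
  "height_exp m n i = (if i \<le> m then real m / real i else real n / real (m + n - i))"

lemma scaleR_vector_matrix_mult: "x v* (a *\<^sub>R H) = a *\<^sub>R (x v* H)" for H :: "real^'m^'k::finite"
  by (simp add: vec_eq_iff vector_matrix_mult_def sum_distrib_left mult_ac)

lemma covol_dual_ge:
  fixes A B :: "real^'k::finite^'k"
  assumes "B ** A = mat 1" "det A = 1"
  shows "covol S (($) A) \<le> covol (-S) (\<lambda>c. column c B)"
proof -
  have "transpose A ** transpose B = mat 1"
    by (metis assms(1) matrix_transpose_mul transpose_mat)
  moreover have "det (transpose B) = 1" using assms by (metis det_I det_mul det_transpose mult.right_neutral)
  ultimately have "covol (- (-S)) (\<lambda>c. column c (transpose A)) \<le> covol (-S) (\<lambda>c. row c (transpose B))"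
    by (rule covol_dual_le)
  moreover have "(\<lambda>c. column c (transpose A)) = ($) A" "(\<lambda>c. row c (transpose B)) = (\<lambda>c. column c B)"
    by (simp_all add: fun_eq_iff column_def row_def transpose_def vec_eq_iff)
  ultimately show ?thesis by simp
qed

lemma gridpts_uminus_near:
  "card {y \<in> uminus ` gridpts \<epsilon> K. \<bar>y - c\<bar> \<le> \<rho>} = card {y \<in> gridpts \<epsilon> K. \<bar>y - (- c)\<bar> \<le> \<rho>}"
proof -
  have "{y \<in> uminus ` gridpts \<epsilon> K. \<bar>y - c\<bar> \<le> \<rho>} = uminus ` {y \<in> gridpts \<epsilon> K. \<bar>y - (- c)\<bar> \<le> \<rho>}"
    by (force simp: abs_minus_commute)
  then show ?thesis by (simp add: card_image)
qed

text \<open>For \<open>card J > m\<close> the estimate is applied to the annihilator, on which the flow acts with the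
  roles of the two blocks interchanged.\<close>

lemma sum_covol_flow_le:
  obtains \<epsilon> C where "0 < \<epsilon>" "\<epsilon> \<le> 1" "real CARD('m) * real CARD('n) * \<epsilon> < 1" "1 \<le> C"
    "\<And>t (A :: real^('m::finite + 'n::finite)^('m + 'n)) J.
      1 \<le> t \<Longrightarrow> det A = 1 \<Longrightarrow> 0 < card J \<Longrightarrow> card J < CARD('m) + CARD('n) \<Longrightarrow>
      (\<Sum>y\<in>mgrid \<epsilon> (npts ((real CARD('m) + real CARD('n)) * t)).
        covol J (\<lambda>c. A $ c v* transpose (gmat t ** umat y)) powr (- height_exp CARD('m) CARD('n) (card J)))
      \<le> C * t * exp (- real CARD('m) * real CARD('n) * t)
        * real (card (mgrid \<epsilon> (npts ((real CARD('m) + real CARD('n)) * t)) :: (real^'n^'m) set))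
        * covol J (($) A) powr (- height_exp CARD('m) CARD('n) (card J))"
proof -
  let ?m = "CARD('m)" and ?n = "CARD('n)"
  let ?d = "CARD('m + 'n)"
  have d: "?d = ?m + ?n" by simp
  obtain \<epsilon>1 where e1: "\<epsilon>1 > 0"
    "\<And>B :: real^('m + 'n)^('m + 'n). (\<And>i j. \<bar>B $ i $ j - mat 1 $ i $ j\<bar> \<le> \<epsilon>1) \<Longrightarrow> 1/2 \<le> \<bar>det B\<bar>"
    using det_near_id by blast
  \<comment> \<open>Dividing by the square of \<open>?d\<close> serves two purposes: perturbations
    of size \<open>?d * \<epsilon>\<close> stay within \<open>\<epsilon>1\<close>, and
    \<open>m n \<epsilon> < 1\<close> later turns a bound on entries into one on the Euclidean
    norm.\<close>
  define \<epsilon> where "\<epsilon> = min \<epsilon>1 (1/2) / (real ?d * real ?d)"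
  have dpos: "real ?d \<ge> 1" unfolding d using zero_less_card_finite[where 'a='m] by linarith
  have dd: "0 < real ?d * real ?d" using dpos by (intro mult_pos_pos) linarith+
  have e0: "\<epsilon> > 0" unfolding \<epsilon>_def using e1(1) by (intro divide_pos_pos dd) simp
  have "real ?d * real ?d * \<epsilon> = min \<epsilon>1 (1/2)"
    unfolding \<epsilon>_def by (metis dd less_irrefl nonzero_mult_div_cancel_left times_divide_eq_right)
  then have dde: "real ?d * real ?d * \<epsilon> \<le> 1/2" "real ?d * real ?d * \<epsilon> \<le> \<epsilon>1" by linarith+
  have de: "\<epsilon> \<le> real ?d * \<epsilon>" "real ?d * \<epsilon> \<le> real ?d * real ?d * \<epsilon>"
    using mult_right_mono[OF dpos, of \<epsilon>] mult_right_mono[OF dpos, of "real ?d * \<epsilon>"] e0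
    by (simp_all only: mult_1 mult.assoc) (use e0 dpos in simp)+
  have e_le: "\<epsilon> \<le> 1" using de dde by linarith
  have "real ?m * real ?n \<le> real ?d * real ?d" by (intro mult_mono) auto
  then have "real ?m * real ?n * \<epsilon> \<le> real ?d * real ?d * \<epsilon>" using e0 by (intro mult_right_mono) auto
  then have mne: "real ?m * real ?n * \<epsilon> < 1" using dde by linarith
  have id: "1/2 \<le> \<bar>det B\<bar>" if "\<And>i j. \<bar>B $ i $ j - mat 1 $ i $ j\<bar> \<le> real ?d * \<epsilon>" for B :: "real^('m + 'n)^('m + 'n)"
    using e1(2)[of B] that de(2) dde(2) by (meson order_trans)
  define C0 where "C0 = 1 + 1 / \<epsilon>"
  have C0: "1 \<le> C0" using e0 by (simp add: C0_def)
  define Q where "Q P S = (let \<beta> = real (card P) / real (card S) in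
     (real ?d ^ card S) powr \<beta> * (2 powr \<beta> * (4 * 2 powr \<beta> * C0 ^ ?d) ^ ?d))" for P S :: "('m + 'n) set"
  \<comment> \<open>Summing over all \<open>P\<close> and \<open>S\<close> gives one constant
    independent of the lattice, of \<open>J\<close> and of \<open>t\<close>.\<close>
  define D where "D = 1 + (\<Sum>P\<in>UNIV. \<Sum>S\<in>UNIV. Q P S)"
  have Q0: "0 \<le> Q P S" for P S using C0 by (simp add: Q_def Let_def)
  have QD: "Q P S \<le> D" for P S
  proof -
    have "Q P S \<le> (\<Sum>S\<in>UNIV. Q P S)" using Q0 by (intro member_le_sum) auto
    also have "\<dots> \<le> (\<Sum>P\<in>UNIV. \<Sum>S\<in>UNIV. Q P S)"
      using Q0 by (intro member_le_sum[of P UNIV "\<lambda>P. \<Sum>S\<in>UNIV. Q P S"] sum_nonneg) auto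
    finally show ?thesis by (simp add: D_def)
  qed
  have D1: "1 \<le> D" unfolding D_def using Q0 by (simp add: sum_nonneg)
  \<comment> \<open>The factor \<open>?d\<close> comes from the logarithm of
    \<open>1 / \<eta>\<close>, which is \<open>(m + n) t\<close>.\<close>
  define C where "C = D * real ?d"
  have C1: "1 \<le> C" unfolding C_def using mult_mono[OF D1 dpos] D1 by simp
  show ?thesis
  proof (rule that[OF e0 e_le mne C1])
    fix t :: real and A :: "real^('m + 'n)^('m + 'n)" and J :: "('m + 'n) set"
    assume t: "1 \<le> t" and A: "det A = 1" and J: "0 < card J" "card J < ?m + ?n"
    let ?T = "(real ?m + real ?n) * t"
    let ?K = "npts ?T"
    let ?Y = "mgrid \<epsilon> ?K :: (real^'n^'m) set"
    let ?\<eta> = "exp (- (real ?m + real ?n) * t)"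
    let ?\<beta> = "height_exp ?m ?n (card J)"
    have Jne: "J \<noteq> {}" using J(1) by auto
    have T: "1 \<le> ?T"
    proof -
      have "1 * 1 \<le> (real ?m + real ?n) * t" using t dpos d by (intro mult_mono) auto
      then show ?thesis by simp
    qed
    have eta: "0 < ?\<eta>" "?\<eta> \<le> exp (-1)" "ln (1 / ?\<eta>) = ?T"
    proof -
      have n: "- (real ?m + real ?n) * t = - ?T" by (rule minus_mult_left[symmetric])
      show "0 < ?\<eta>" "?\<eta> \<le> exp (-1)" "ln (1 / ?\<eta>) = ?T"
        unfolding n using T by (simp_all only: exp_gt_zero exp_le_cancel_iff neg_le_iff_le ln_div ln_exp exp_not_eq_zero ln_one) simp_all
    qed
    have reg: "real (card {y\<in>gridpts \<epsilon> ?K. \<bar>y - c\<bar> \<le> \<rho>}) \<le> C0 * \<rho> * real (card (gridpts \<epsilon> ?K))"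
      if rho: "?\<eta> \<le> \<rho>" for c \<rho>
      unfolding C0_def
    proof (rule card_gridpts_near[OF e0])
      show "?K > 0" by (rule npts_bounds)
      have "0 \<le> \<rho>" using rho eta(1) by linarith
      then have "?\<eta> * exp ?T \<le> \<rho> * real ?K"
        by (rule mult_mono[OF rho npts_bounds(1) _ exp_ge_zero])
      moreover have "?\<eta> * exp ?T = exp (- ?T + ?T)" by (simp only: exp_add minus_mult_left)
      ultimately show "1 \<le> \<rho> * real ?K" by simp
    qed
    have generic: "(\<Sum>s\<in>PiE (P \<times> -P) (\<lambda>_. G). covol S (\<lambda>c. u c v* Hmat P ?\<eta> s) powr (- (real (card P) / real (card S))))
      \<le> C * t * real (card ?Y) * covol S u powr (- (real (card P) / real (card S)))"
      if S: "S \<noteq> {}" "card S \<le> card P" and P: "card P * card (-P) = ?m * ?n" and u: "covol S u > 0"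
        and G: "G = gridpts \<epsilon> ?K \<or> G = uminus ` gridpts \<epsilon> ?K"
      for P S :: "('m + 'n) set" and G :: "real set" and u :: "'m + 'n \<Rightarrow> real^('m + 'n)"
    proof -
      have finG: "finite G" using G by auto
      have cG: "card G = ?K" using G e0 by (auto simp: card_image card_gridpts)
      have bG: "\<bar>y\<bar> \<le> \<epsilon>" if "y \<in> G" for y using G that gridpts_bound[OF e0] by auto
      have regG: "real (card {y\<in>G. \<bar>y - c\<bar> \<le> \<rho>}) \<le> C0 * \<rho> * real (card G)" if "?\<eta> \<le> \<rho>" for c \<rho>
        using G reg[OF that, of c] reg[OF that, of "-c"] cG e0
        by (auto simp: gridpts_uminus_near card_gridpts simp del: minus_minus)
      have "(\<Sum>s\<in>PiE (P \<times> -P) (\<lambda>_. G). covol S (\<lambda>c. u c v* Hmat P ?\<eta> s) powr (- (real (card P) / real (card S))))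
        \<le> Q P S * ?T * real (card G) ^ card (P \<times> -P) * covol S u powr (- (real (card P) / real (card S)))"
        using sum_covol_powr_le[OF S id e0 finG bG regG C0 eta(1,2) u] unfolding Q_def Let_def eta(3) .
      also have "real (card G) ^ card (P \<times> -P) = real (card ?Y)"
        by (simp add: cG card_mgrid[OF e0] card_cartesian_product P)
      also have "Q P S * ?T * real (card ?Y) * covol S u powr (- (real (card P) / real (card S)))
        \<le> D * ?T * real (card ?Y) * covol S u powr (- (real (card P) / real (card S)))"
        using QD T by (intro mult_right_mono) auto
      finally show ?thesis unfolding C_def d by (simp add: mult_ac)
    qed
    show "(\<Sum>y\<in>?Y. covol J (\<lambda>c. A $ c v* transpose (gmat t ** umat y)) powr (- ?\<beta>))
      \<le> C * t * exp (- real ?m * real ?n * t) * real (card ?Y) * covol J (($) A) powr (- ?\<beta>)"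
    proof (cases "card J \<le> ?m")
      case True
      let ?P = "range Inl :: ('m + 'n) set"
      have cP: "card ?P = ?m" "card (- ?P) = ?n" by (simp_all add: Compl_range_sum card_image)
      have b: "?\<beta> = real (card ?P) / real (card J)" using True by (simp add: height_exp_def cP)
      have Jpos: "covol J (($) A) > 0" by (rule covol_pos_det[OF A])
      have e: "covol J (\<lambda>c. A $ c v* transpose (gmat t ** umat y)) powr (- ?\<beta>)
         = exp (- real ?m * real ?n * t) * covol J (\<lambda>c. A $ c v* Hmat ?P ?\<eta> (upper y)) powr (- ?\<beta>)" for y :: "real^'n^'m"
      proof -
        have "covol J (\<lambda>c. A $ c v* transpose (gmat t ** umat y))
          = exp (real ?n * t) ^ card J * covol J (\<lambda>c. A $ c v* Hmat ?P ?\<eta> (upper y))"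
          unfolding transpose_flow scaleR_vector_matrix_mult covol_scaleR by simp
        \<comment> \<open>The exponent \<open>m / card J\<close> cancels the rank, so the rate is
          the same for all \<open>J\<close>.\<close>
        moreover have "(exp (real ?n * t) ^ card J) powr (- ?\<beta>) = exp (- real ?m * real ?n * t)"
        proof -
          have "real (card J) \<noteq> 0" using J(1) by linarith
          then show ?thesis
            unfolding b cP exp_of_nat_mult[symmetric] exp_powr_real exp_inj_iff by (simp add: field_simps del: card_0_eq)
        qed
        ultimately show ?thesis by (simp add: powr_mult covol_nonneg)
      qed
      have "(\<Sum>y\<in>?Y. covol J (\<lambda>c. A $ c v* transpose (gmat t ** umat y)) powr (- ?\<beta>))
        = exp (- real ?m * real ?n * t) * (\<Sum>y\<in>?Y. covol J (\<lambda>c. A $ c v* Hmat ?P ?\<eta> (upper y)) powr (- ?\<beta>))"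
        unfolding e by (simp add: sum_distrib_left)
      also have "(\<Sum>y\<in>?Y. covol J (\<lambda>c. A $ c v* Hmat ?P ?\<eta> (upper y)) powr (- ?\<beta>))
        = (\<Sum>s\<in>PiE (?P \<times> -?P) (\<lambda>_. gridpts \<epsilon> ?K). covol J (\<lambda>c. A $ c v* Hmat ?P ?\<eta> s) powr (- ?\<beta>))"
        by (rule sum_mgrid_upper)
      also have "\<dots> \<le> C * t * real (card ?Y) * covol J (($) A) powr (- ?\<beta>)"
        unfolding b by (rule generic) (use J True Jpos cP in auto)
      finally show ?thesis by (simp add: mult_ac mult_left_mono)
    next
      case False
      let ?P = "range Inr :: ('m + 'n) set"
      let ?S = "-J"
      have cP: "card ?P = ?n" "card (- ?P) = ?m" by (simp_all add: Compl_range_sum card_image)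
      have cS: "card ?S = ?m + ?n - card J" by (simp add: Compl_eq_Diff_UNIV card_Diff_subset)
      have b: "?\<beta> = real (card ?P) / real (card ?S)" using False by (simp add: height_exp_def cP cS)
      have b0: "?\<beta> > 0" unfolding b cP cS using J by simp
      have "invertible A" using A by (simp add: invertible_det_nz)
      then obtain B where B: "B ** A = mat 1" "A ** B = mat 1" by (auto simp: invertible_def)
      let ?u = "\<lambda>c. column c B"
      have AB: "covol J (($) A) \<le> covol ?S ?u" by (rule covol_dual_ge[OF B(1) A])
      have Jpos: "covol J (($) A) > 0" by (rule covol_pos_det[OF A])
      \<comment> \<open>After the flow, duality bounds the covolume of \<open>J\<close> below by
        that of the moved annihilator; before the flow, \<open>AB\<close> is the comparison in the
        opposite direction.\<close>
      have pos: "covol ?S (\<lambda>c. ?u c v* Hmat ?P ?\<eta> (lower y)) > 0 \<and>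
         exp (real ?m * t) ^ card ?S * covol ?S (\<lambda>c. ?u c v* Hmat ?P ?\<eta> (lower y))
          \<le> covol J (\<lambda>c. A $ c v* transpose (gmat t ** umat y))" for y :: "real^'n^'m"
      proof -
        let ?h = "gmat t ** umat y :: real^('m + 'n)^('m + 'n)"
        let ?hi = "umat (- y) ** gmat (- t) :: real^('m + 'n)^('m + 'n)"
        have hh: "?hi ** ?h = mat 1"
        proof -
          have "?hi ** ?h = umat (- y) ** ((gmat (- t) ** gmat t) ** umat y)" by (simp add: matrix_mul_assoc)
          then show ?thesis by (simp add: gmat_add gmat_0 umat_add umat_0)
        qed
        have "transpose ?hi ** B ** (A ** transpose ?h) = transpose ?hi ** (B ** A) ** transpose ?h"
          by (simp add: matrix_mul_assoc)
        also have "\<dots> = transpose (?h ** ?hi)" by (simp add: B matrix_transpose_mul)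
        also have "?h ** ?hi = mat 1" using hh matrix_left_right_inverse by blast
        finally have inv: "(transpose ?hi ** B) ** (A ** transpose ?h) = mat 1" by (simp add: transpose_mat)
        have dh: "det (A ** transpose ?h) = 1" by (simp add: det_mul A det_gmat det_umat)
        have col: "column c (transpose ?hi ** B) = exp (real ?m * t) *\<^sub>R (?u c v* Hmat ?P ?\<eta> (lower y))" for c
        proof -
          have "column c (transpose ?hi ** B) = ?u c v* ?hi"
            by (simp add: vec_eq_iff column_def matrix_matrix_mult_def vector_matrix_mult_def transpose_def mult.commute)
          then show ?thesis unfolding inverse_flow scaleR_vector_matrix_mult .
        qed
        have "covol ?S (\<lambda>c. column c (transpose ?hi ** B)) \<le> covol J (\<lambda>c. row c (A ** transpose ?h))"
          by (rule covol_dual_le[OF inv dh])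
        also have "(\<lambda>c. row c (A ** transpose ?h)) = (\<lambda>c. A $ c v* transpose ?h)"
          by (simp add: row_def row_matrix_mult)
        finally have le: "covol ?S (\<lambda>c. column c (transpose ?hi ** B)) \<le> covol J (\<lambda>c. A $ c v* transpose ?h)" .
        have "covol J (($) (A ** transpose ?h)) > 0" by (rule covol_pos_det[OF dh])
        then have "covol ?S (\<lambda>c. column c (transpose ?hi ** B)) > 0"
          using covol_dual_ge[OF inv dh, of J] by linarith
        then show ?thesis using le unfolding col covol_scaleR by (simp add: zero_less_mult_iff)
      qed
      have e: "covol J (\<lambda>c. A $ c v* transpose (gmat t ** umat y)) powr (- ?\<beta>)
         \<le> exp (- real ?m * real ?n * t) * covol ?S (\<lambda>c. ?u c v* Hmat ?P ?\<eta> (lower y)) powr (- ?\<beta>)" for y :: "real^'n^'m"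
      proof -
        have "covol J (\<lambda>c. A $ c v* transpose (gmat t ** umat y)) powr (- ?\<beta>)
          \<le> (exp (real ?m * t) ^ card ?S * covol ?S (\<lambda>c. ?u c v* Hmat ?P ?\<eta> (lower y))) powr (- ?\<beta>)"
          using pos[of y] b0 by (intro powr_mono2') auto
        moreover have "(exp (real ?m * t) ^ card ?S) powr (- ?\<beta>) = exp (- real ?m * real ?n * t)"
        proof -
          have "real (card ?S) > 0" using J(2) unfolding cS by simp
          then show ?thesis
            unfolding b cP exp_of_nat_mult[symmetric] exp_powr_real exp_inj_iff by (simp add: field_simps del: card_0_eq)
        qed
        ultimately show ?thesis by (simp add: powr_mult covol_nonneg)
      qed
      have "(\<Sum>y\<in>?Y. covol J (\<lambda>c. A $ c v* transpose (gmat t ** umat y)) powr (- ?\<beta>))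
        \<le> exp (- real ?m * real ?n * t) * (\<Sum>y\<in>?Y. covol ?S (\<lambda>c. ?u c v* Hmat ?P ?\<eta> (lower y)) powr (- ?\<beta>))"
        unfolding sum_distrib_left by (rule sum_mono[OF e])
      also have "(\<Sum>y\<in>?Y. covol ?S (\<lambda>c. ?u c v* Hmat ?P ?\<eta> (lower y)) powr (- ?\<beta>))
        = (\<Sum>s\<in>PiE (?P \<times> -?P) (\<lambda>_. uminus ` gridpts \<epsilon> ?K). covol ?S (\<lambda>c. ?u c v* Hmat ?P ?\<eta> s) powr (- ?\<beta>))"
        by (rule sum_mgrid_lower)
      also have "\<dots> \<le> C * t * real (card ?Y) * covol ?S ?u powr (- ?\<beta>)"
        unfolding b
      proof (rule generic)
        show "?S \<noteq> {}" using J cS by (metis card.empty less_irrefl zero_less_diff)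
        show "card ?S \<le> card ?P" using False unfolding cS cP by simp
        show "covol ?S ?u > 0" using AB Jpos by linarith
      qed (auto simp: cP)
      also have "\<dots> \<le> C * t * real (card ?Y) * covol J (($) A) powr (- ?\<beta>)"
        using AB Jpos b0 C1 t by (intro mult_left_mono powr_mono2') auto
      finally show ?thesis by (simp add: mult_ac mult_left_mono)
    qed
  qed
qed

subsection \<open>Minima of a reduced basis\<close>

text \<open>If the rows of \<open>A\<close> form a reduced basis, this is up to a constant the reciprocal of the least
  covolume of a sublattice of rank \<open>i\<close>.\<close>

definition alpha :: "nat \<Rightarrow> real^'k::finite^'k \<Rightarrow> real" where
  "alpha i A = Max ((\<lambda>J. 1 / (\<Prod>j\<in>J. n1 (A $ j))) ` {J. card J = i})"

lemma n1_row_pos: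
  assumes "det A = 1" shows "n1 (A $ j) > 0"
proof -
  have "1 \<le> (\<Prod>c\<in>UNIV. n1 (A $ c))"
    using covol_le_prod[of UNIV "($) A"] assms by (simp add: covol_UNIV rdet_def)
  then have "n1 (A $ j) \<noteq> 0" by (metis UNIV_I finite prod_zero_iff not_one_le_zero)
  then show ?thesis using n1_nonneg[of "A $ j"] by simp
qed

lemma prod_n1_pos: "det A = 1 \<Longrightarrow> (\<Prod>j\<in>J. n1 (A $ j)) > 0"
  by (intro prod_pos n1_row_pos)

lemma alpha_ge: "card J = i \<Longrightarrow> 1 / (\<Prod>j\<in>J. n1 (A $ j)) \<le> alpha i A"
  unfolding alpha_def by (rule Max_ge) auto

lemma alpha_attained:
  fixes A :: "real^'k::finite^'k"
  assumes "i \<le> CARD('k)"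
  obtains J where "card J = i" "alpha i A = 1 / (\<Prod>j\<in>J. n1 (A $ j))"
proof -
  obtain J0 :: "'k set" where "card J0 = i"
    using obtain_subset_with_card_n[OF assms] by blast
  then have "alpha i A \<in> (\<lambda>J. 1 / (\<Prod>j\<in>J. n1 (A $ j))) ` {J. card J = i}"
    unfolding alpha_def by (intro Max_in) auto
  then show ?thesis using that by auto
qed

lemma alpha_pos:
  fixes A :: "real^'k::finite^'k"
  assumes "det A = 1" "i \<le> CARD('k)"
  shows "alpha i A > 0"
proof -
  obtain J where "alpha i A = 1 / (\<Prod>j\<in>J. n1 (A $ j))" using alpha_attained[OF assms(2)] by blast
  then show ?thesis using prod_n1_pos[OF assms(1)] by simp
qed

lemma alpha_0: "alpha 0 (A :: real^'k::finite^'k) = 1"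
proof -
  have "{J :: 'k set. card J = 0} = {{}}" by auto
  then show ?thesis by (simp add: alpha_def)
qed

lemma alpha_CARD_le:
  fixes A :: "real^'k::finite^'k"
  assumes "det A = 1" shows "alpha CARD('k) A \<le> 1"
proof -
  obtain J where J: "card J = CARD('k)" "alpha CARD('k) A = 1 / (\<Prod>j\<in>J. n1 (A $ j))"
    using alpha_attained[of "CARD('k)" A] by blast
  then have "J = UNIV" by (simp add: card_eq_UNIV_imp_eq_UNIV)
  moreover have "1 \<le> (\<Prod>c\<in>UNIV. n1 (A $ c))"
    using covol_le_prod[of UNIV "($) A"] assms by (simp add: covol_UNIV rdet_def)
  ultimately show ?thesis using J by simp
qed

text \<open>A nonzero integral minor is at least 1 in \<open>minor_le_covol\<close>. The bound
  \<open>C\<close> on the product of all row norms trades the rows outside the column set of the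
  minor for reciprocals of those inside.\<close>

lemma inverse_covol_le:
  fixes A H Z :: "real^'k::finite^'k"
  assumes A: "det A = 1" "(\<Prod>c\<in>UNIV. n1 (A $ c)) \<le> C"
    and H: "det H = 1" "\<And>k. n1 (H $ k) \<le> b" "1 \<le> b" and Z: "Z \<in> SLZ"
    and r: "rdet (fam S r (($) Z)) \<noteq> 0"
  shows "1 / covol S (\<lambda>c. (Z ** A) $ c v* H) \<le> C * b ^ CARD('k) / (\<Prod>j\<in>-(r`(-S)). n1 (A $ j))"
proof -
  let ?V = "covol S (\<lambda>c. (Z ** A) $ c v* H)"
  let ?J = "-(r`(-S))"
  have inj: "inj_on r (-S)" by (rule fam_inj[OF r])
  have "1 \<le> \<bar>rdet (fam S r (($) Z))\<bar>" using Ints_abs_ge_1[OF fam_Ints[OF Z, of S r]] r by simp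
  also have "\<dots> \<le> b ^ CARD('k) * (\<Prod>c\<in>-S. n1 (A $ r c)) * ?V"
    by (rule minor_le_covol[OF A(1) H(1) H(2) H(3)])
  finally have 1: "1 \<le> b ^ CARD('k) * (\<Prod>c\<in>-S. n1 (A $ r c)) * ?V" .
  have Pj: "(\<Prod>j\<in>?J. n1 (A $ j)) > 0" by (rule prod_n1_pos[OF A(1)])
  have "(\<Prod>c\<in>-S. n1 (A $ r c)) * (\<Prod>j\<in>?J. n1 (A $ j)) = (\<Prod>c\<in>UNIV. n1 (A $ c))"
  proof -
    have "(\<Prod>c\<in>-S. n1 (A $ r c)) = (\<Prod>j\<in>r`(-S). n1 (A $ j))"
      using inj by (simp add: prod.reindex)
    also have "\<dots> * (\<Prod>j\<in>?J. n1 (A $ j)) = (\<Prod>c\<in>r`(-S) \<union> ?J. n1 (A $ c))"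
      by (subst prod.union_disjoint) auto
    finally show ?thesis by simp
  qed
  then have 2: "(\<Prod>c\<in>-S. n1 (A $ r c)) * (\<Prod>j\<in>?J. n1 (A $ j)) \<le> C" using A by simp
  have V: "?V > 0"
  proof -
    have "?V \<noteq> 0" using 1 by auto
    then show ?thesis using covol_nonneg[of S "\<lambda>c. (Z ** A) $ c v* H"] by simp
  qed
  have "(\<Prod>j\<in>?J. n1 (A $ j)) * 1 \<le> (\<Prod>j\<in>?J. n1 (A $ j)) * (b ^ CARD('k) * (\<Prod>c\<in>-S. n1 (A $ r c)) * ?V)"
    using 1 Pj by (intro mult_left_mono) auto
  also have "\<dots> = b ^ CARD('k) * ?V * ((\<Prod>c\<in>-S. n1 (A $ r c)) * (\<Prod>j\<in>?J. n1 (A $ j)))" by (simp add: mult_ac)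
  also have "\<dots> \<le> b ^ CARD('k) * ?V * C" using 2 V H(3) by (intro mult_left_mono) auto
  finally show ?thesis using Pj V by (simp add: field_simps)
qed

lemma card_Compl_image:
  fixes r :: "'k::finite \<Rightarrow> 'k"
  assumes "inj_on r (-S)" shows "card (-(r`(-S))) = card S"
  using assms card_mono[of UNIV S] by (simp add: Compl_eq_Diff_UNIV card_Diff_subset card_image)

text \<open>A nonzero minor of \<open>Z\<close> assigns to the row set attaining the left side a set
  of rows of \<open>A\<close> of the same size.\<close>

lemma alpha_translate_le:
  fixes A H Z :: "real^'k::finite^'k"
  assumes A: "det A = 1" "(\<Prod>c\<in>UNIV. n1 (A $ c)) \<le> C"
    and H: "det H = 1" "\<And>k. n1 (H $ k) \<le> b" "1 \<le> b" and Z: "Z \<in> SLZ"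
    and i: "i \<le> CARD('k)"
  shows "alpha i (Z ** A ** H) \<le> C * b ^ CARD('k) * alpha i A"
proof -
  let ?A = "Z ** A ** H"
  have dA: "det ?A = 1" using Z A H by (simp add: det_mul SLZ_def)
  obtain S where S: "card S = i" "alpha i ?A = 1 / (\<Prod>j\<in>S. n1 (?A $ j))" using alpha_attained[OF i] by blast
  obtain r where "1 \<le> \<bar>rdet (fam S r (($) Z))\<bar>" using SLZ_minor[OF Z] by blast
  then have r: "rdet (fam S r (($) Z)) \<noteq> 0" by auto
  have C: "0 \<le> C" using A prod_n1_pos[OF A(1), of UNIV] by linarith
  have "alpha i ?A \<le> 1 / covol S (($) ?A)"
    unfolding S using covol_le_prod[of S "($) ?A"] covol_pos_det[OF dA] by (simp add: frac_le)
  also have "covol S (($) ?A) = covol S (\<lambda>c. (Z ** A) $ c v* H)"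
    by (rule covol_cong) (simp add: row_matrix_mult[of "Z ** A"])
  also have "1 / \<dots> \<le> C * b ^ CARD('k) / (\<Prod>j\<in>-(r`(-S)). n1 (A $ j))"
    by (rule inverse_covol_le[OF A H Z r])
  also have "\<dots> = C * b ^ CARD('k) * (1 / (\<Prod>j\<in>-(r`(-S)). n1 (A $ j)))" by simp
  also have "\<dots> \<le> C * b ^ CARD('k) * alpha i A"
    using C H S card_Compl_image[OF fam_inj[OF r]] by (intro mult_left_mono alpha_ge) auto
  finally show ?thesis .
qed

text \<open>The converse of \<open>covol_le_prod\<close> up to the factor \<open>C\<close>: the rows
  of a reduced basis are nearly orthogonal.\<close>

lemma inverse_covol_le_alpha:
  fixes A :: "real^'k::finite^'k"
  assumes A: "det A = 1" "(\<Prod>c\<in>UNIV. n1 (A $ c)) \<le> C"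
  shows "1 / covol J (($) A) \<le> C / (\<Prod>j\<in>J. n1 (A $ j))"
proof -
  have "(\<lambda>c. (mat 1 ** A) $ c v* mat 1) = ($) A" by simp
  moreover have "fam J id (($) (mat 1 :: real^'k^'k)) = (\<lambda>c. axis (id c) 1)"
    by (auto simp: fam_def fun_eq_iff mat_def axis_def vec_eq_iff)
  then have "rdet (fam J id (($) (mat 1 :: real^'k^'k))) \<noteq> 0" using rdet_axis_bij[of "id :: 'k \<Rightarrow> 'k"] by auto
  moreover have "n1 (mat 1 $ k) \<le> 1" for k :: 'k
    by (simp add: n1_def mat_def if_distrib[where f=abs] cong: if_cong)
  ultimately show ?thesis
    using inverse_covol_le[OF A det_I _ order.refl mat_1_SLZ, of J id] by simp
qed

text \<open>A rank \<open>card J\<close> sublattice all of whose minors other than \<open>J\<close> vanish is contained in the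
  coordinate sublattice \<open>J\<close>.\<close>

lemma minors_concentrated_support:
  assumes r: "rdet (fam S r v) \<noteq> 0" and J: "- (r ` (-S)) = J"
    and others: "\<And>r'. rdet (fam S r' v) \<noteq> 0 \<Longrightarrow> - (r' ` (-S)) = J"
    and c: "c \<in> S" "q \<notin> J"
  shows "v c $ q = 0"
proof -
  obtain c' where c': "c' \<notin> S" "q = r c'" using J c by auto
  have inj: "inj_on r (-S)" by (rule fam_inj[OF r])
  have z: "rdet ((fam S r v)(c' := axis k 1)) = 0" if "k \<noteq> q" for k
  proof (cases "k \<in> J")
    case True
    have "q \<notin> (r(c' := k)) ` (-S)" using True c c' inj by (auto simp: inj_on_def)
    then have "- ((r(c' := k)) ` (-S)) \<noteq> J" using c by auto
    then show ?thesis using others[of "r(c' := k)"] c' by (auto simp: fam_upd_notin)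
  next
    case False
    then obtain c'' where "c'' \<notin> S" "k = r c''" using J by auto
    then show ?thesis using that c' by (intro rdet_identical[of c' c'']) (auto simp: fam_def)
  qed
  have "rdet ((fam S r v)(c' := v c)) = (\<Sum>k\<in>UNIV. v c $ k * rdet ((fam S r v)(c' := axis k 1)))"
    by (rule rdet_expand)
  also have "\<dots> = (\<Sum>k\<in>UNIV. if k = q then v c $ q * rdet ((fam S r v)(c' := axis q 1)) else 0)"
    by (rule sum.cong) (auto simp: z)
  also have "\<dots> = v c $ q * rdet ((fam S r v)(c' := axis q 1))" by simp
  also have "(fam S r v)(c' := axis q 1) = fam S r v" using c' by (auto simp: fam_def)
  finally have e: "rdet ((fam S r v)(c' := v c)) = v c $ q * rdet (fam S r v)" .
  have "rdet ((fam S r v)(c' := v c)) = 0"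
    by (rule rdet_identical[of c' c]) (use c c' in \<open>auto simp: fam_def\<close>)
  then show ?thesis using e r by simp
qed

text \<open>The rows \<open>S\<close> span a sublattice of finite index in that of the rows
  \<open>J\<close>; the index is the absolute value of a nonzero integral determinant.\<close>

lemma covol_supported_ge:
  fixes A H Z :: "real^'k::finite^'k"
  assumes Z: "Z \<in> SLZ" and r: "rdet (fam S r (($) Z)) \<noteq> 0" and J: "- (r ` (-S)) = J"
    and supp: "\<And>c q. c \<in> S \<Longrightarrow> q \<notin> J \<Longrightarrow> Z $ c $ q = 0"
  shows "covol J (\<lambda>c. A $ c v* H) \<le> covol S (\<lambda>c. (Z ** A) $ c v* H)"
proof -
  obtain p where p: "bij p" "\<And>c. c \<in> -S \<Longrightarrow> p c = r c"
    using inj_on_extend_bij[OF fam_inj[OF r]] by blast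
  have pS: "p ` S = J"
  proof -
    have "p ` S = - (p ` (-S))" using bij_image_Compl_eq[OF p(1), of "-S"] by simp
    also have "p ` (-S) = r ` (-S)" using p(2) by auto
    finally show ?thesis using J by simp
  qed
  let ?M = "\<chi> c k. if c \<in> S then Z $ c $ p k else axis c 1 $ k"
  let ?M' = "\<chi> c k. fam S r (($) Z) c $ p k"
  have "covol S (\<lambda>c. (Z ** A) $ c v* H) = \<bar>det ?M\<bar> * covol S (\<lambda>c. A $ p c v* H)"
  proof (rule covol_combination)
    fix c assume c: "c \<in> S"
    have "Z $ c v* A = (\<Sum>k\<in>UNIV. Z $ c $ k *\<^sub>R A $ k)"
      by (simp add: vec_eq_iff vector_matrix_mult_def mult.commute)
    also have "\<dots> = (\<Sum>k\<in>J. Z $ c $ k *\<^sub>R A $ k)"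
      using supp c by (intro sum.mono_neutral_right) auto
    also have "\<dots> = (\<Sum>k\<in>S. Z $ c $ p k *\<^sub>R A $ p k)"
      unfolding pS[symmetric] using bij_is_inj[OF p(1)] by (subst sum.reindex) (auto intro: inj_on_subset)
    finally show "(Z ** A) $ c v* H = (\<Sum>k\<in>S. ?M $ c $ k *\<^sub>R (A $ p k v* H))"
      using c by (simp add: row_matrix_mult linear_sum[OF linear_vector_matrix_mult] linear_cmul[OF linear_vector_matrix_mult])
  qed (auto simp: vec_eq_iff)
  moreover have "covol S (\<lambda>c. A $ p c v* H) = covol J (\<lambda>c. A $ c v* H)"
    using covol_permute[OF p(1), of S "\<lambda>c. A $ c v* H"] pS by simp
  moreover have "1 \<le> \<bar>det ?M\<bar>"
  proof (rule Ints_abs_ge_1)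
    show "det ?M \<in> \<int>" by (rule det_Ints) (use Z in \<open>auto simp: SLZ_def axis_def\<close>)
    have "det ?M = det ?M'"
    proof -
      have "det ?M = det (\<chi> c k. if c \<in> S then (if k \<in> S then Z $ c $ p k else 0) else axis c 1 $ k)"
        by (rule det_block_cong[of S]) (auto simp: vec_eq_iff)
      also have "\<dots> = det ?M'"
      proof (rule det_block_cong[of S])
        fix c assume "c \<notin> S"
        then have "fam S r (($) Z) c = axis (p c) 1" using p(2)[of c] by (simp add: fam_def)
        then show "?M' $ c = axis c 1"
          using bij_is_inj[OF p(1)] by (simp add: vec_eq_iff axis_def inj_eq)
      qed (auto simp: vec_eq_iff fam_def)
      finally show ?thesis .
    qed
    moreover have "\<bar>det ?M'\<bar> = \<bar>rdet (fam S r (($) Z))\<bar>"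
      using abs_rdet_permute_columns[OF p(1), of "fam S r (($) Z)"] by (simp add: rdet_def)
    ultimately show "det ?M \<noteq> 0" using r by auto
  qed
  ultimately show ?thesis
    using mult_right_mono[of 1 "\<bar>det ?M\<bar>" "covol J (\<lambda>c. A $ c v* H)"] covol_nonneg[of J "\<lambda>c. A $ c v* H"] by simp
qed

text \<open>If the \<open>i\<close> shortest basis vectors are much shorter than the others, they span the sublattice of
  rank \<open>i\<close> with the smallest covolume even after applying \<open>H\<close>.\<close>

lemma alpha_translate_gap:
  fixes A H Z :: "real^'k::finite^'k"
  assumes A: "det A = 1" "(\<Prod>c\<in>UNIV. n1 (A $ c)) \<le> C"
    and H: "det H = 1" "\<And>k. n1 (H $ k) \<le> b" "1 \<le> b" and Z: "Z \<in> SLZ"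
    and J: "card J = i" "i > 0"
    and gap: "\<And>a c. a \<notin> J \<Longrightarrow> c \<in> J \<Longrightarrow> \<Omega> * n1 (A $ c) < n1 (A $ a)"
    and \<Omega>: "1 \<le> \<Omega>" "C * b ^ CARD('k) * b ^ CARD('k) \<le> \<Omega>"
  shows "alpha i (Z ** A ** H) \<le> 1 / covol J (\<lambda>c. A $ c v* H)"
proof -
  let ?A = "Z ** A ** H"
  let ?l = "\<lambda>j. n1 (A $ j)"
  have dA: "det ?A = 1" using Z A H by (simp add: det_mul SLZ_def)
  have i: "i \<le> CARD('k)" using J by (auto simp: card_mono)
  obtain S where S: "card S = i" "alpha i ?A = 1 / (\<Prod>j\<in>S. n1 (?A $ j))" using alpha_attained[OF i] by blast
  have C: "0 \<le> C" using A prod_n1_pos[OF A(1), of UNIV] by linarith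
  have AH: "(\<lambda>c. (A ** H) $ c) = (\<lambda>c. A $ c v* H)" by (simp add: row_matrix_mult)
  have "det (A ** H) = 1" using A H by (simp add: det_mul)
  then have pos: "covol J (\<lambda>c. A $ c v* H) > 0" using covol_pos_det[of "A ** H" J] AH by simp
  have *: "alpha i ?A \<le> 1 / covol S (\<lambda>c. (Z ** A) $ c v* H)"
  proof -
    have "alpha i ?A \<le> 1 / covol S (($) ?A)"
      unfolding S using covol_le_prod[of S "($) ?A"] covol_pos_det[OF dA] by (simp add: frac_le)
    also have "covol S (($) ?A) = covol S (\<lambda>c. (Z ** A) $ c v* H)"
      by (rule covol_cong) (simp add: row_matrix_mult[of "Z ** A"])
    finally show ?thesis .
  qed
  show ?thesis
  proof (cases "\<exists>r. rdet (fam S r (($) Z)) \<noteq> 0 \<and> - (r ` (-S)) \<noteq> J")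
    case True
    then obtain r where r: "rdet (fam S r (($) Z)) \<noteq> 0" "- (r ` (-S)) \<noteq> J" by blast
    let ?J = "- (r ` (-S))"
    have cJ: "card ?J = card J" using card_Compl_image[OF fam_inj[OF r(1)]] S J by simp
    define B where "B = Max (?l ` J)"
    have Jne: "J \<noteq> {}" using J by auto
    have B: "?l c \<le> B" if "c \<in> J" for c unfolding B_def using that by (intro Max_ge) auto
    have "B \<in> ?l ` J" unfolding B_def using Jne by (intro Max_in) auto
    then obtain c0 where c0: "c0 \<in> J" "B = ?l c0" by auto
    have B0: "0 < B" using c0 n1_row_pos[OF A(1)] by simp
    have ck: "card (?J - J) = card (J - ?J)"
      using cJ by (metis card_Diff_subset_Int card_Int_Diff finite finite_Int inf_commute add_left_cancel)
    have ck1: "card (J - ?J) \<ge> 1"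
    proof -
      have "\<not> J \<subseteq> ?J" using cJ r(2) card_subset_eq[of ?J J] by auto
      then have "J - ?J \<noteq> {}" by auto
      then show ?thesis by (simp add: Suc_leI card_gt_0_iff)
    qed
    \<comment> \<open>Another column set exchanges at least one row of \<open>J\<close>, and every
      row brought in is more than \<open>\<Omega>\<close> times longer than each row of
      \<open>J\<close>.\<close>
    have "\<Omega> * (\<Prod>j\<in>J. ?l j) \<le> (\<Prod>j\<in>?J. ?l j)"
    proof -
      let ?k = "card (J - ?J)"
      have "\<Omega> * (\<Prod>j\<in>J - ?J. ?l j) \<le> \<Omega> * B ^ ?k"
        using prod_mono[of "J - ?J" ?l "\<lambda>_. B"] B \<Omega> by (intro mult_left_mono) (auto simp: n1_nonneg)
      also have "\<dots> \<le> \<Omega> ^ ?k * B ^ ?k"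
        using power_increasing[OF ck1 \<Omega>(1)] B0 by (intro mult_right_mono) auto
      also have "\<dots> = (\<Prod>j\<in>?J - J. \<Omega> * B)" by (simp add: ck power_mult_distrib)
      also have "\<dots> \<le> (\<Prod>j\<in>?J - J. ?l j)"
      proof (intro prod_mono conjI)
        fix j assume "j \<in> ?J - J"
        then show "\<Omega> * B \<le> ?l j" using gap[of j c0] c0 by auto
      qed (use B0 \<Omega> in auto)
      finally have "\<Omega> * (\<Prod>j\<in>J - ?J. ?l j) \<le> (\<Prod>j\<in>?J - J. ?l j)" .
      then have "\<Omega> * (\<Prod>j\<in>J - ?J. ?l j) * (\<Prod>j\<in>J \<inter> ?J. ?l j) \<le> (\<Prod>j\<in>?J - J. ?l j) * (\<Prod>j\<in>J \<inter> ?J. ?l j)"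
        by (intro mult_right_mono) (auto intro: prod_nonneg simp: n1_nonneg)
      moreover have "(\<Prod>j\<in>J - ?J. ?l j) * (\<Prod>j\<in>J \<inter> ?J. ?l j) = (\<Prod>j\<in>J. ?l j)"
        by (subst prod.union_disjoint[symmetric]) (auto intro: prod.cong)
      moreover have "(\<Prod>j\<in>?J - J. ?l j) * (\<Prod>j\<in>J \<inter> ?J. ?l j) = (\<Prod>j\<in>?J. ?l j)"
        by (subst prod.union_disjoint[symmetric]) (auto intro: prod.cong)
      ultimately show ?thesis by (simp add: mult.assoc)
    qed
    then have 1: "C * b ^ CARD('k) * b ^ CARD('k) * (\<Prod>j\<in>J. ?l j) \<le> (\<Prod>j\<in>?J. ?l j)"
      using \<Omega>(2) prod_n1_pos[OF A(1), of J] by (meson less_imp_le mult_right_mono order_trans)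
    have "covol J (\<lambda>c. A $ c v* H) \<le> (\<Prod>c\<in>J. n1 (A $ c v* H))" by (rule covol_le_prod)
    also have "\<dots> \<le> (\<Prod>c\<in>J. b * ?l c)"
      using n1_vector_matrix_mult_le[of H b] H(2) by (intro prod_mono) (auto simp: n1_nonneg row_def)
    also have "\<dots> = b ^ card J * (\<Prod>j\<in>J. ?l j)" by (simp add: prod.distrib)
    also have "\<dots> \<le> b ^ CARD('k) * (\<Prod>j\<in>J. ?l j)"
      using H(3) prod_n1_pos[OF A(1), of J] by (intro mult_right_mono power_increasing) (auto simp: card_mono)
    finally have 2: "covol J (\<lambda>c. A $ c v* H) \<le> b ^ CARD('k) * (\<Prod>j\<in>J. ?l j)" .
    have "alpha i ?A \<le> 1 / covol S (\<lambda>c. (Z ** A) $ c v* H)" by (rule *)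
    also have "\<dots> \<le> C * b ^ CARD('k) / (\<Prod>j\<in>?J. ?l j)" by (rule inverse_covol_le[OF A H Z r(1)])
    also have "\<dots> \<le> 1 / covol J (\<lambda>c. A $ c v* H)"
    proof -
      have "C * b ^ CARD('k) * covol J (\<lambda>c. A $ c v* H) \<le> C * b ^ CARD('k) * (b ^ CARD('k) * (\<Prod>j\<in>J. ?l j))"
        using 2 C H(3) by (intro mult_left_mono) auto
      also have "\<dots> \<le> (\<Prod>j\<in>?J. ?l j)" using 1 by (simp add: mult.assoc)
      finally show ?thesis using pos prod_n1_pos[OF A(1), of ?J] by (simp add: field_simps)
    qed
    finally show ?thesis .
  next
    case False
    obtain r where "1 \<le> \<bar>rdet (fam S r (($) Z))\<bar>" using SLZ_minor[OF Z] by blast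
    then have r: "rdet (fam S r (($) Z)) \<noteq> 0" by auto
    have rJ: "- (r ` (-S)) = J" using False r by blast
    \<comment> \<open>All nonzero minors now have column set \<open>J\<close>, so the sublattice
      lies in the one spanned by the rows \<open>J\<close>.\<close>
    have "covol J (\<lambda>c. A $ c v* H) \<le> covol S (\<lambda>c. (Z ** A) $ c v* H)"
      by (rule covol_supported_ge[OF Z r rJ])
         (rule minors_concentrated_support[OF r rJ], use False in auto)
    then show ?thesis using * pos by (meson frac_le order_trans zero_le_one order_refl)
  qed
qed

text \<open>Adding \<open>a\<close> to \<open>J\<close> and removing \<open>c\<close> from
  \<open>J\<close> give competitors for the two neighbouring ranks, at the loss of the ratio of the
  two norms.\<close>

lemma alpha_close:
  fixes A :: "real^'k::finite^'k"
  assumes A: "det A = 1" and J: "alpha (card J) A = 1 / (\<Prod>j\<in>J. n1 (A $ j))"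
    and ac: "a \<notin> J" "c \<in> J" "n1 (A $ a) \<le> \<Omega> * n1 (A $ c)"
  shows "(alpha (card J) A)\<^sup>2 \<le> \<Omega> * (alpha (card J + 1) A * alpha (card J - 1) A)"
proof -
  let ?l = "\<lambda>j. n1 (A $ j)"
  let ?P = "\<Prod>j\<in>J. ?l j"
  have P: "?P > 0" "?l a > 0" "?l c > 0" using prod_n1_pos[OF A] n1_row_pos[OF A] by auto
  have p1: "(\<Prod>j\<in>insert a J. ?l j) = ?l a * ?P" using ac by simp
  have p2: "(\<Prod>j\<in>J - {c}. ?l j) = ?P / ?l c" using ac P by (simp add: prod.remove[of J c])
  have "1 / (\<Prod>j\<in>insert a J. ?l j) \<le> alpha (card J + 1) A" by (rule alpha_ge) (use ac in simp)
  moreover have "1 / (\<Prod>j\<in>J - {c}. ?l j) \<le> alpha (card J - 1) A" by (rule alpha_ge) (use ac in simp)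
  ultimately have "(1 / (?l a * ?P)) * (1 / (?P / ?l c)) \<le> alpha (card J + 1) A * alpha (card J - 1) A"
    unfolding p1 p2 using P by (intro mult_mono) (auto intro: order_trans[rotated])
  moreover have O: "0 < \<Omega>" using ac P by (metis less_le_trans zero_less_mult_pos2)
  ultimately have "\<Omega> * ((1 / (?l a * ?P)) * (1 / (?P / ?l c))) \<le> \<Omega> * (alpha (card J + 1) A * alpha (card J - 1) A)"
    by (intro mult_left_mono) auto
  moreover have "(alpha (card J) A)\<^sup>2 \<le> \<Omega> * ((1 / (?l a * ?P)) * (1 / (?P / ?l c)))"
  proof -
    have "\<Omega> * ((1 / (?l a * ?P)) * (1 / (?P / ?l c))) = (\<Omega> * ?l c / ?l a) * (1 / ?P)\<^sup>2"
      using P by (simp add: power2_eq_square field_simps)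
    moreover have "1 \<le> \<Omega> * ?l c / ?l a" using ac P by simp
    then have "1 * (1 / ?P)\<^sup>2 \<le> (\<Omega> * ?l c / ?l a) * (1 / ?P)\<^sup>2"
      by (rule mult_right_mono) simp
    ultimately show ?thesis unfolding J by linarith
  qed
  ultimately show ?thesis by linarith
qed

subsection \<open>The height function\<close>

lemma lcoset_SLR: "g <#\<^bsub>SLR\<^esub> X = (\<lambda>y. g ** y) ` X"
  by (auto simp: l_coset_def SLR_def)

lemma XSpace_iff: "x \<in> XSpace \<longleftrightarrow> (\<exists>g. det g = 1 \<and> x = (\<lambda>z. g ** z) ` SLZ)"
  by (auto simp: XSpace_def LCOSETS_def lcoset_SLR) (auto simp: SLR_def)

lemma act_eq: "act g x = (\<lambda>y. g ** y) ` x"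
  by (simp add: act_def lcoset_SLR)

lemma act_act: "act g (act h x) = act (g ** h) x"
  by (simp add: act_eq image_image matrix_mul_assoc)

lemma act_XSpace: "det h = 1 \<Longrightarrow> x \<in> XSpace \<Longrightarrow> act h x \<in> XSpace"
  by (auto simp: act_eq XSpace_iff image_image matrix_mul_assoc det_mul) (metis det_mul mult.right_neutral)

text \<open>In Cramer's rule the denominator is 1 and the numerators are integral.\<close>

lemma SLZ_inverse:
  fixes A :: "real^'k::finite^'k"
  assumes "A \<in> SLZ"
  obtains B where "B \<in> SLZ" "A ** B = mat 1"
proof -
  define c where "c j = (\<chi> k. det (\<chi> i l. if l = k then axis j 1 $ i else A $ i $ l) / det A)" for j
  let ?B = "transpose (\<chi> j. c j)"
  have dA: "det A = 1" using assms by (simp add: SLZ_def)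
  have "A *v c j = axis j 1" for j
    using cramer[of A "c j" "axis j 1"] dA by (simp add: c_def)
  then have AB: "A ** ?B = mat 1"
    by (simp add: vec_eq_iff matrix_matrix_mult_def matrix_vector_mult_def transpose_def mat_def axis_def)
  have "det ?B = 1" using AB dA by (metis det_I det_mul mult_1)
  moreover have "?B $ i $ j \<in> \<int>" for i j
  proof -
    have "det (\<chi> i' l. if l = i then axis j 1 $ i' else A $ i' $ l) \<in> \<int>"
      by (rule det_Ints) (use assms in \<open>auto simp: SLZ_def axis_def\<close>)
    then show ?thesis using dA by (simp add: c_def transpose_def)
  qed
  ultimately have "?B \<in> SLZ" by (simp add: SLZ_def)
  then show ?thesis using AB by (rule that)
qed

text \<open>Names the conclusion of \<open>reduced_basis_exists\<close> for a fixed constant; the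
  type argument records the dimension.\<close>

definition reduction_bound :: "('k::finite) itself \<Rightarrow> real \<Rightarrow> bool" where
  "reduction_bound _ C \<longleftrightarrow> 1 \<le> C \<and>
     (\<forall>A :: real^'k^'k. det A = 1 \<longrightarrow> (\<exists>Z\<in>SLZ. (\<Prod>c\<in>UNIV. n1 ((Z ** A) $ c)) \<le> C))"

text \<open>The rows of \<open>rep C x\<close> form a reduced basis of the lattice of \<open>x\<close>; the choice is void unless
  \<open>reduction_bound\<close> holds for \<open>C\<close>.\<close>

definition rep :: "real \<Rightarrow> (real^'k::finite^'k) set \<Rightarrow> real^'k^'k" where
  "rep C x = (SOME A. det A = 1 \<and> transpose A \<in> x \<and> (\<Prod>c\<in>UNIV. n1 (A $ c)) \<le> C)"

lemma rep:
  fixes x :: "(real^'k::finite^'k) set"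
  assumes C: "reduction_bound TYPE('k) C" and x: "x \<in> XSpace"
  shows "det (rep C x) = 1" "transpose (rep C x) \<in> x" "(\<Prod>c\<in>UNIV. n1 (rep C x $ c)) \<le> C"
proof -
  obtain g where g: "det g = 1" "x = (\<lambda>z. g ** z) ` SLZ" using x by (auto simp: XSpace_iff)
  obtain Z where Z: "Z \<in> SLZ" "(\<Prod>c\<in>UNIV. n1 ((Z ** transpose g) $ c)) \<le> C"
    using C g unfolding reduction_bound_def by (metis det_transpose)
  have "transpose (Z ** transpose g) = g ** transpose Z" by (simp add: matrix_transpose_mul)
  then have "transpose (Z ** transpose g) \<in> x" using g SLZ_transpose[OF Z(1)] by auto
  moreover have "det (Z ** transpose g) = 1" using Z g by (simp add: det_mul SLZ_def)
  ultimately have "\<exists>A. det A = 1 \<and> transpose A \<in> x \<and> (\<Prod>c\<in>UNIV. n1 (A $ c)) \<le> C" using Z by blast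
  from someI_ex[OF this] show "det (rep C x) = 1" "transpose (rep C x) \<in> x" "(\<Prod>c\<in>UNIV. n1 (rep C x $ c)) \<le> C"
    unfolding rep_def by blast+
qed

text \<open>Up to \<open>h\<close> both representatives are bases of the same lattice and differ by
  an integral base change. Transposes occur because elements of \<open>x\<close> have the basis
  vectors as columns.\<close>

lemma rep_act:
  fixes x :: "(real^'k::finite^'k) set"
  assumes C: "reduction_bound TYPE('k) C" and x: "x \<in> XSpace" and h: "det h = 1"
  obtains Z where "Z \<in> SLZ" "rep C (act h x) = Z ** rep C x ** transpose h"
proof -
  obtain g where g: "det g = 1" "x = (\<lambda>z. g ** z) ` SLZ" using x by (auto simp: XSpace_iff)
  obtain z2 where z2: "z2 \<in> SLZ" "transpose (rep C x) = g ** z2" using rep(2)[OF C x] g by auto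
  have "transpose (rep C (act h x)) \<in> act h x" by (rule rep(2)[OF C act_XSpace[OF h x]])
  then obtain z1 where z1: "z1 \<in> SLZ" "transpose (rep C (act h x)) = h ** (g ** z1)"
    using g by (auto simp: act_eq)
  obtain w where w: "w \<in> SLZ" "z2 ** w = mat 1" using SLZ_inverse[OF z2(1)] by blast
  have "g = transpose (rep C x) ** w" unfolding z2 by (simp add: w flip: matrix_mul_assoc)
  then have "transpose (rep C (act h x)) = h ** (transpose (rep C x) ** (w ** z1))"
    unfolding z1 by (metis matrix_mul_assoc)
  then have "rep C (act h x) = transpose (h ** (transpose (rep C x) ** (w ** z1)))"
    by (metis transpose_transpose)
  also have "\<dots> = transpose (w ** z1) ** rep C x ** transpose h" by (simp add: matrix_transpose_mul)
  finally show ?thesis using SLZ_transpose[OF SLZ_mult[OF w(1) z1(1)]] by (intro that)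
qed

text \<open>As all terms contract at the same rate, they may be added. The weight of rank
  \<open>i\<close> is \<open>e\<close> times the geometric mean of the weights of ranks
  \<open>i - 1\<close> and \<open>i + 1\<close>.\<close>

definition height :: "real \<Rightarrow> real \<Rightarrow> (real^('m::finite + 'n::finite)^('m + 'n)) set \<Rightarrow> real" where
  "height C e x = 1 + (\<Sum>i\<in>{1..<CARD('m) + CARD('n)}.
     (e ^ (i * (CARD('m) + CARD('n) - i)) * alpha i (rep C x)) powr height_exp CARD('m) CARD('n) i)"

lemma height_exp_bounds:
  assumes "0 < i" "i < m + n"
  shows "1 \<le> height_exp m n i" "height_exp m n i \<le> real (m + n)"
proof -
  show "1 \<le> height_exp m n i" using assms by (auto simp: height_exp_def)
  have "real m / real i \<le> real m / 1" "real n / real (m + n - i) \<le> real n / 1"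
    using assms by (intro divide_left_mono; simp)+
  then show "height_exp m n i \<le> real (m + n)" by (simp add: height_exp_def)
qed

text \<open>The reciprocal of \<open>height_exp\<close>, extended by \<open>0\<close> to \<open>j = 0\<close> and \<open>j = m + n\<close>. The extension is
  concave in \<open>j\<close>, but not strictly.\<close>

definition iota :: "nat \<Rightarrow> nat \<Rightarrow> nat \<Rightarrow> real" where
  "iota m n j = (if j \<le> m then real j / real m else (real m + real n - real j) / real n)"

lemma iota_inverse: "0 < i \<Longrightarrow> i < m + n \<Longrightarrow> iota m n i = 1 / height_exp m n i"
  by (auto simp: iota_def height_exp_def of_nat_diff)

lemma iota_concave:
  assumes "0 < i" "i < m + n" "0 < m" "0 < n"
  shows "iota m n (i + 1) + iota m n (i - 1) \<le> 2 * iota m n i"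
proof -
  consider "i < m" | "i = m" | "m < i" by linarith
  then show ?thesis
  proof cases
    case 1
    then have "i - 1 \<le> m" by simp
    then show ?thesis using 1 assms by (simp add: iota_def of_nat_diff field_simps)
  next
    case 2
    have "iota m n (i + 1) \<le> 1" using 2 assms by (simp add: iota_def divide_le_eq)
    moreover have "iota m n (i - 1) \<le> 1" using 2 assms by (simp add: iota_def divide_le_eq of_nat_diff)
    moreover have "iota m n i = 1" using 2 assms by (simp add: iota_def)
    ultimately show ?thesis by linarith
  next
    case 3
    have e1: "iota m n (i - 1) = (real m + real n - real (i - 1)) / real n"
      using 3 assms by (cases "i - 1 = m") (auto simp: iota_def)
    have e2: "iota m n (i + 1) = (real m + real n - real (i + 1)) / real n"
      "iota m n i = (real m + real n - real i) / real n" using 3 by (auto simp: iota_def)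
    show ?thesis unfolding e1 e2 using 3 assms by (simp add: of_nat_diff field_simps)
  qed
qed

context
  fixes C :: real
  assumes C: "reduction_bound TYPE('m::finite + 'n::finite) C"
begin


lemma reduction_bound_ge_1: "1 \<le> C" using C by (simp add: reduction_bound_def)

lemma height_ge_1: "1 \<le> height C e (x :: (real^('m + 'n)^('m + 'n)) set)"
  unfolding height_def by (simp add: sum_nonneg)

lemma height_term_le:
  assumes "0 < i" "i < (CARD('m) + CARD('n))"
  shows "(e ^ (i * (CARD('m) + CARD('n) - i)) * alpha i (rep C x)) powr height_exp CARD('m) CARD('n) i
    \<le> height C e (x :: (real^('m + 'n)^('m + 'n)) set)"
  unfolding height_def
  using member_le_sum[of i "{1..<(CARD('m) + CARD('n))}" "\<lambda>i. (e ^ (i * (CARD('m) + CARD('n) - i)) * alpha i (rep C x)) powr height_exp CARD('m) CARD('n) i"] assms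
  by simp

text \<open>Each \<open>a j\<close> is at most the height to the power \<open>iota\<close>, also at
  the ends, where \<open>alpha\<close> is at most 1; concavity of \<open>iota\<close> then bounds
  the total exponent by 1.\<close>

lemma height_neighbours_le:
  fixes x :: "(real^('m + 'n)^('m + 'n)) set"
  assumes x: "x \<in> XSpace" and e: "0 < e" "e \<le> 1" and i: "0 < i" "i < (CARD('m) + CARD('n))"
  defines "a \<equiv> \<lambda>j. e ^ (j * ((CARD('m) + CARD('n)) - j)) * alpha j (rep C x)"
  shows "(a (i + 1) * a (i - 1)) powr (height_exp CARD('m) CARD('n) i / 2) \<le> height C e x"
proof -
  let ?d = "CARD('m) + CARD('n)"
  let ?f = "height C e x" and ?m = "CARD('m)" and ?n = "CARD('n)"
  let ?\<beta> = "height_exp ?m ?n"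
  have f1: "1 \<le> ?f" by (rule height_ge_1)
  have pos: "0 < a j" if "j \<le> ?d" for j
    unfolding a_def using alpha_pos[OF rep(1)[OF C x], of j] e that by simp
  have le: "a j \<le> ?f powr iota ?m ?n j" if j: "j \<le> ?d" for j
  proof -
    consider "j = 0" | "j = ?d" | "0 < j" "j < ?d" using j by linarith
    then show ?thesis
    proof cases
      case 1
      then show ?thesis using f1 by (simp add: a_def iota_def alpha_0)
    next
      case 2
      have "alpha ?d (rep C x) \<le> 1" using alpha_CARD_le[OF rep(1)[OF C x]] by simp
      then have "a j \<le> 1" using 2 by (simp add: a_def)
      moreover have "iota ?m ?n j = 0" using 2 by (simp add: iota_def)
      ultimately show ?thesis using f1 by simp
    next
      case 3
      have b: "1 \<le> ?\<beta> j" by (rule height_exp_bounds) (use 3 in auto)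
      have "a j = (a j powr ?\<beta> j) powr (1 / ?\<beta> j)" using pos[OF j] b by (simp add: powr_powr)
      also have "\<dots> \<le> ?f powr (1 / ?\<beta> j)"
        unfolding a_def using b 3 by (intro powr_mono2 height_term_le) auto
      finally show ?thesis using 3 by (simp add: iota_inverse)
    qed
  qed
  have b: "1 \<le> ?\<beta> i" by (rule height_exp_bounds) (use i in auto)
  have "(a (i + 1) * a (i - 1)) powr (?\<beta> i / 2) \<le> (?f powr iota ?m ?n (i + 1) * ?f powr iota ?m ?n (i - 1)) powr (?\<beta> i / 2)"
    using pos[of "i + 1"] pos[of "i - 1"] i b by (intro powr_mono2 mult_mono le) (auto intro: mult_nonneg_nonneg less_imp_le)
  also have "\<dots> = ?f powr ((iota ?m ?n (i + 1) + iota ?m ?n (i - 1)) * (?\<beta> i / 2))"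
    by (simp only: powr_add[symmetric] powr_powr)
  also have "\<dots> \<le> ?f powr 1"
  proof (rule powr_mono[OF _ f1])
    have "(iota ?m ?n (i + 1) + iota ?m ?n (i - 1)) * (?\<beta> i / 2) \<le> (2 * iota ?m ?n i) * (?\<beta> i / 2)"
      using b i by (intro mult_right_mono iota_concave) auto
    also have "\<dots> = 1" using iota_inverse[of i ?m ?n] i b by simp
    finally show "(iota ?m ?n (i + 1) + iota ?m ?n (i - 1)) * (?\<beta> i / 2) \<le> 1" .
  qed
  finally show ?thesis using f1 by simp
qed

lemma powr_le_power:
  assumes "1 \<le> B" "b \<le> real n" shows "B powr b \<le> B ^ n"
  using powr_mono[OF assms(2,1)] assms(1) by (simp add: powr_realpow)

text \<open>In the absence of a gap after the \<open>i\<close>-th minimum the \<open>i\<close>-th term is controlled by its two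
  neighbours, with a constant that \<open>e\<close> makes small because \<open>i (d - i)\<close> is strictly concave;
  otherwise a single sublattice is responsible for the \<open>i\<close>-th term.\<close>

lemma height_average:
  fixes t :: real and Y :: "(real^'n^'m) set"
  assumes flow: "1 \<le> D" "\<And>(A :: real^('m + 'n)^('m + 'n)) J.
      det A = 1 \<Longrightarrow> 0 < card J \<Longrightarrow> card J < CARD('m) + CARD('n) \<Longrightarrow>
      (\<Sum>y\<in>Y. covol J (\<lambda>c. A $ c v* transpose (gmat t ** umat y)) powr (- height_exp CARD('m) CARD('n) (card J)))
      \<le> D * t * exp (- real CARD('m) * real CARD('n) * t) * real (card Y)
        * covol J (($) A) powr (- height_exp CARD('m) CARD('n) (card J))"
    and Y: "finite Y" "\<And>y a b. y \<in> Y \<Longrightarrow> \<bar>y $ a $ b\<bar> \<le> 1" and t: "1 \<le> t"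
  obtains e where "0 < e" "e \<le> 1"
    "\<And>x :: (real^('m + 'n)^('m + 'n)) set. x \<in> XSpace \<Longrightarrow>
       (\<Sum>y\<in>Y. height C e (act (gmat t) (act (umat y) x))) \<le>
         real (card Y) * (real (CARD('m) + CARD('n)) * (D * C ^ (CARD('m) + CARD('n))) * t * exp (- real CARD('m) * real CARD('n) * t) * height C e x + 1)"
proof -
  let ?d = "CARD('m) + CARD('n)"
  let ?m = "CARD('m)" and ?n = "CARD('n)"
  let ?\<beta> = "height_exp ?m ?n"
  let ?x = "\<lambda>x y. act (gmat t) (act (umat y) x)"
  define k0 where "k0 = exp (- real ?m * real ?n * t)"
  have k0: "0 < k0" "k0 \<le> 1" using t by (simp_all add: k0_def)
  define b where "b = real ?d * exp (real ?n * t)"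
  have b1: "1 \<le> b"
  proof -
    have "1 * 1 \<le> real ?d * exp (real ?n * t)"
      using t zero_less_card_finite[where 'a='m] by (intro mult_mono) (auto simp del: zero_less_card_finite)
    then show ?thesis by (simp add: b_def)
  qed
  define B where "B = C * b ^ ?d"
  have B1: "1 \<le> B" unfolding B_def using mult_mono[OF reduction_bound_ge_1 one_le_power[OF b1, of "CARD('m) + CARD('n)"]] reduction_bound_ge_1 by simp
  define \<Omega> where "\<Omega> = B * b ^ ?d"
  have O1: "1 \<le> \<Omega>" unfolding \<Omega>_def using mult_mono[OF B1 one_le_power[OF b1, of "CARD('m) + CARD('n)"]] B1 by simp
  \<comment> \<open>Solves \<open>B\<^sup>2 * \<Omega> * e\<^sup>2 = k0\<^sup>2\<close>: here
    \<open>b\<close> bounds the rows of \<open>H y\<close>, \<open>B\<close> the growth of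
    \<open>alpha\<close> under it, and \<open>\<Omega>\<close> is the gap for
    \<open>alpha_translate_gap\<close>. All of them depend on \<open>t\<close>.\<close>
  define e where "e = k0 / (B * sqrt \<Omega>)"
  have BO: "1 \<le> B * sqrt \<Omega>" using mult_mono[of 1 B 1 "sqrt \<Omega>"] B1 O1 by simp
  have e0: "0 < e" "e \<le> 1" using k0 BO by (auto simp: e_def divide_le_eq)
  have e2: "B\<^sup>2 * \<Omega> * e\<^sup>2 = k0\<^sup>2"
    using BO O1 B1 by (simp add: e_def power_divide power_mult_distrib)
  define H where "H y = (transpose (gmat t ** umat y) :: real^('m + 'n)^('m + 'n))" for y :: "real^'n^'m"
  have dH: "det (gmat t ** umat y :: real^('m + 'n)^('m + 'n)) = 1" for y :: "real^'n^'m"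
    by (simp add: det_mul det_gmat det_umat)
  have nH: "n1 (H y $ k) \<le> b" if y: "y \<in> Y" for y k
  proof -
    have "\<bar>H y $ k $ j\<bar> \<le> exp (real ?n * t)" for j
    proof -
      have "\<bar>(gmat t :: real^('m + 'n)^('m + 'n)) $ j $ j\<bar> \<le> exp (real ?n * t)"
        using t by (cases j) (auto simp: gmat_def intro: order_trans[of _ 0])
      moreover have "\<bar>(umat y :: real^('m + 'n)^('m + 'n)) $ j $ k\<bar> \<le> 1"
        using Y(2)[OF y] by (auto simp: umat_def split: sum.splits)
      ultimately have "\<bar>(gmat t :: real^('m + 'n)^('m + 'n)) $ j $ j * umat y $ j $ k\<bar> \<le> exp (real ?n * t) * 1"
        unfolding abs_mult by (intro mult_mono) auto
      then show ?thesis by (simp add: H_def transpose_def gmat_mult_nth)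
    qed
    then have "n1 (H y $ k) \<le> real CARD('m + 'n) * exp (real ?n * t)" by (rule n1_le_CARD)
    then show ?thesis by (simp add: b_def)
  qed
  define k1 where "k1 = D * C ^ ?d * t * k0"
  have Cd: "1 \<le> C ^ ?d" using reduction_bound_ge_1 by (rule one_le_power)
  have k01: "k0 \<le> k1"
  proof -
    have "1 * 1 * 1 * k0 \<le> D * C ^ ?d * t * k0"
      using flow(1) Cd t k0 by (intro mult_mono) auto
    then show ?thesis by (simp add: k1_def)
  qed
  have trm: "(\<Sum>y\<in>Y. (e ^ (i * (?d - i)) * alpha i (rep C (?x x y))) powr ?\<beta> i)
      \<le> real (card Y) * (k1 * height C e x)"
    if x: "x \<in> XSpace" and i: "0 < i" "i < ?d" for x :: "(real^('m + 'n)^('m + 'n)) set" and i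
  proof -
    let ?A = "rep C x"
    let ?f = "height C e x"
    let ?q = "e ^ (i * (?d - i))"
    have A: "det ?A = 1" "(\<Prod>c\<in>UNIV. n1 (?A $ c)) \<le> C" using rep[OF C x] by auto
    have f1: "1 \<le> ?f" by (rule height_ge_1)
    have be: "1 \<le> ?\<beta> i" "?\<beta> i \<le> real ?d" using height_exp_bounds[OF i] by auto
    have iC: "i \<le> CARD('m + 'n)" using i by simp
    obtain J where J: "card J = i" "alpha i ?A = 1 / (\<Prod>j\<in>J. n1 (?A $ j))" using alpha_attained[OF iC] by blast
    have ap: "0 < alpha i ?A" by (rule alpha_pos[OF A(1) iC])
    have rp: "\<exists>Z\<in>SLZ. rep C (?x x y) = Z ** ?A ** H y" for y
      unfolding act_act H_def using rep_act[OF C x dH] by metis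
    have ap': "0 < alpha i (rep C (?x x y))" for y
      by (rule alpha_pos[OF rep(1)[OF C] iC]) (simp add: act_act act_XSpace dH x)
    have dHy: "det (H y) = 1" for y by (simp add: H_def dH)
    show ?thesis
    proof (cases "\<exists>a c. a \<notin> J \<and> c \<in> J \<and> n1 (?A $ a) \<le> \<Omega> * n1 (?A $ c)")
      case True
      then obtain a c where ac: "a \<notin> J" "c \<in> J" "n1 (?A $ a) \<le> \<Omega> * n1 (?A $ c)" by blast
      have close: "(alpha i ?A)\<^sup>2 \<le> \<Omega> * (alpha (i + 1) ?A * alpha (i - 1) ?A)"
        using alpha_close[OF A(1) _ ac] J by simp
      have "(?q * alpha i (rep C (?x x y))) powr ?\<beta> i \<le> k1 * ?f" if y: "y \<in> Y" for y
      proof -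
        let ?a' = "alpha i (rep C (?x x y))"
        let ?a = "\<lambda>j. e ^ (j * (?d - j)) * alpha j ?A"
        obtain Z where Z: "Z \<in> SLZ" "rep C (?x x y) = Z ** ?A ** H y" using rp by blast
        have "?a' \<le> C * b ^ CARD('m + 'n) * alpha i ?A"
          unfolding Z(2) by (rule alpha_translate_le[OF A dHy nH[OF y] b1 Z(1) iC])
        then have a': "?a' \<le> B * alpha i ?A" by (simp add: B_def)
        have "(?q * ?a')\<^sup>2 \<le> (?q * (B * alpha i ?A))\<^sup>2"
          using a' ap'[of y] e0 by (intro power_mono mult_left_mono) auto
        also have "\<dots> = B\<^sup>2 * ?q\<^sup>2 * (alpha i ?A)\<^sup>2" by (simp add: power_mult_distrib mult_ac)
        also have "\<dots> \<le> B\<^sup>2 * ?q\<^sup>2 * (\<Omega> * (alpha (i + 1) ?A * alpha (i - 1) ?A))"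
          by (intro mult_left_mono close) auto
        \<comment> \<open>Twice \<open>i (d - i)\<close> exceeds the sum of the neighbouring values
          by 2, whence the gain \<open>e\<^sup>2\<close>.\<close>
        also have "?q\<^sup>2 = e\<^sup>2 * e ^ ((i + 1) * (?d - (i + 1))) * e ^ ((i - 1) * (?d - (i - 1)))"
        proof -
          obtain i' where i': "i = Suc i'" using i by (cases i) auto
          obtain l where l: "?d = i + Suc l" using i less_imp_Suc_add by fastforce
          have "i * (?d - i) * 2 = 2 + (i + 1) * (?d - (i + 1)) + (i - 1) * (?d - (i - 1))"
            unfolding l i' by (simp add: algebra_simps)
          then show ?thesis by (simp only: power_mult[symmetric] power_add[symmetric])
        qed
        also have "B\<^sup>2 * (e\<^sup>2 * e ^ ((i + 1) * (?d - (i + 1))) * e ^ ((i - 1) * (?d - (i - 1)))) * (\<Omega> * (alpha (i + 1) ?A * alpha (i - 1) ?A))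
          = (B\<^sup>2 * \<Omega> * e\<^sup>2) * (?a (i + 1) * ?a (i - 1))" by (simp add: mult_ac)
        finally have sq: "(?q * ?a')\<^sup>2 \<le> k0\<^sup>2 * (?a (i + 1) * ?a (i - 1))" unfolding e2 .
        have nn: "0 \<le> ?a (i + 1) * ?a (i - 1)"
        proof -
          have "0 \<le> alpha j ?A" if "j \<le> CARD('m + 'n)" for j
            using alpha_pos[OF A(1) that] by simp
          then show ?thesis using e0 i by (intro mult_nonneg_nonneg zero_le_power) auto
        qed
        have qa: "0 < ?q * ?a'" using ap'[of y] e0 by simp
        have "(?q * ?a') powr ?\<beta> i = ((?q * ?a')\<^sup>2) powr (?\<beta> i / 2)"
          using qa by (simp add: powr_powr flip: powr_numeral)
        also have "\<dots> \<le> (k0\<^sup>2 * (?a (i + 1) * ?a (i - 1))) powr (?\<beta> i / 2)"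
          using sq be by (intro powr_mono2) auto
        also have "\<dots> = (k0\<^sup>2) powr (?\<beta> i / 2) * (?a (i + 1) * ?a (i - 1)) powr (?\<beta> i / 2)"
          using nn by (simp add: powr_mult)
        also have "(k0\<^sup>2) powr (?\<beta> i / 2) = k0 powr ?\<beta> i"
          using k0 by (simp add: powr_powr flip: powr_numeral)
        also have "k0 powr ?\<beta> i * (?a (i + 1) * ?a (i - 1)) powr (?\<beta> i / 2) \<le> k0 * ?f"
        proof (rule mult_mono)
          show "k0 powr ?\<beta> i \<le> k0" using powr_mono'[OF be(1), of k0] k0 by simp
          show "(?a (i + 1) * ?a (i - 1)) powr (?\<beta> i / 2) \<le> ?f"
            by (rule height_neighbours_le[OF x e0 i])
        qed (use k0 in auto)
        also have "\<dots> \<le> k1 * ?f" using k01 f1 by (intro mult_right_mono) auto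
        finally show ?thesis .
      qed
      then have "(\<Sum>y\<in>Y. (?q * alpha i (rep C (?x x y))) powr ?\<beta> i) \<le> (\<Sum>y\<in>Y. k1 * ?f)"
        by (rule sum_mono)
      then show ?thesis by simp
    next
      case False
      have gap: "\<Omega> * n1 (?A $ c) < n1 (?A $ a)" if "a \<notin> J" "c \<in> J" for a c using False that by force
      have Om: "C * b ^ CARD('m + 'n) * b ^ CARD('m + 'n) \<le> \<Omega>" by (simp add: \<Omega>_def B_def)
      have cp: "0 < covol J (\<lambda>c. ?A $ c v* H y)" for y
      proof -
        have "det (?A ** H y) = 1" by (simp add: det_mul A dHy)
        then have "0 < covol J (($) (?A ** H y))" by (rule covol_pos_det)
        moreover have "($) (?A ** H y) = (\<lambda>c. ?A $ c v* H y)" by (simp add: fun_eq_iff row_matrix_mult)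
        ultimately show ?thesis by simp
      qed
      have "(?q * alpha i (rep C (?x x y))) powr ?\<beta> i
          \<le> ?q powr ?\<beta> i * covol J (\<lambda>c. ?A $ c v* H y) powr (- ?\<beta> i)" if y: "y \<in> Y" for y
      proof -
        let ?a' = "alpha i (rep C (?x x y))"
        obtain Z where Z: "Z \<in> SLZ" "rep C (?x x y) = Z ** ?A ** H y" using rp by blast
        have "?a' \<le> 1 / covol J (\<lambda>c. ?A $ c v* H y)"
          unfolding Z(2) by (rule alpha_translate_gap[OF A dHy nH[OF y] b1 Z(1) J(1) i(1) gap O1 Om])
        then have "?a' powr ?\<beta> i \<le> (1 / covol J (\<lambda>c. ?A $ c v* H y)) powr ?\<beta> i"
          using ap'[of y] be by (intro powr_mono2) auto
        also have "\<dots> = covol J (\<lambda>c. ?A $ c v* H y) powr (- ?\<beta> i)"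
          using cp[of y] by (simp add: powr_divide powr_minus_divide)
        finally show ?thesis using ap'[of y] e0 by (simp add: powr_mult mult_left_mono)
      qed
      then have "(\<Sum>y\<in>Y. (?q * alpha i (rep C (?x x y))) powr ?\<beta> i)
          \<le> (\<Sum>y\<in>Y. ?q powr ?\<beta> i * covol J (\<lambda>c. ?A $ c v* H y) powr (- ?\<beta> i))"
        by (rule sum_mono)
      also have "\<dots> = ?q powr ?\<beta> i * (\<Sum>y\<in>Y. covol J (\<lambda>c. ?A $ c v* H y) powr (- ?\<beta> i))"
        by (simp add: sum_distrib_left)
      also have "\<dots> \<le> ?q powr ?\<beta> i * (D * t * k0 * real (card Y) * covol J (($) ?A) powr (- ?\<beta> i))"
        using flow(2)[OF A(1), of J] J(1) i unfolding H_def k0_def by (intro mult_left_mono) auto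
      also have "covol J (($) ?A) powr (- ?\<beta> i) \<le> C ^ ?d * alpha i ?A powr ?\<beta> i"
      proof -
        have "covol J (($) ?A) powr (- ?\<beta> i) = (1 / covol J (($) ?A)) powr ?\<beta> i"
          using covol_pos_det[OF A(1), of J] by (simp add: powr_divide powr_minus_divide)
        also have "\<dots> \<le> (C * alpha i ?A) powr ?\<beta> i"
          using inverse_covol_le_alpha[OF A, of J] covol_pos_det[OF A(1), of J] be J by (intro powr_mono2) auto
        also have "\<dots> = C powr ?\<beta> i * alpha i ?A powr ?\<beta> i" using reduction_bound_ge_1 ap by (simp add: powr_mult)
        also have "\<dots> \<le> C ^ ?d * alpha i ?A powr ?\<beta> i"
          using powr_le_power[OF reduction_bound_ge_1 be(2)] by (intro mult_right_mono) auto
        finally show ?thesis .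
      qed
      also have "?q powr ?\<beta> i * (D * t * k0 * real (card Y) * (C ^ ?d * alpha i ?A powr ?\<beta> i))
        = real (card Y) * (k1 * (?q * alpha i ?A) powr ?\<beta> i)"
        using ap e0 by (simp add: k1_def powr_mult mult_ac)
      also have "\<dots> \<le> real (card Y) * (k1 * ?f)"
        using k01 k0 i by (intro mult_left_mono height_term_le) auto
      finally show ?thesis using flow(1) t k0 e0 by (auto simp: mult_left_mono)
    qed
  qed
  show ?thesis
  proof (rule that[OF e0])
    fix x :: "(real^('m + 'n)^('m + 'n)) set" assume x: "x \<in> XSpace"
    let ?f = "height C e x"
    have "(\<Sum>y\<in>Y. height C e (?x x y))
      = real (card Y) + (\<Sum>i\<in>{1..<?d}. \<Sum>y\<in>Y. (e ^ (i * (?d - i)) * alpha i (rep C (?x x y))) powr ?\<beta> i)"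
      unfolding height_def by (simp add: sum.distrib sum.swap[of _ Y])
    also have "\<dots> \<le> real (card Y) + (\<Sum>i\<in>{1..<?d}. real (card Y) * (k1 * ?f))"
      using trm[OF x] by (intro add_left_mono sum_mono) auto
    also have "\<dots> = real (card Y) + real (?d - 1) * (real (card Y) * (k1 * ?f))" by simp
    also have "\<dots> \<le> real (card Y) + real ?d * (real (card Y) * (k1 * ?f))"
      using k01 k0 height_ge_1[of e x] by (intro add_left_mono mult_right_mono) auto
    finally show "(\<Sum>y\<in>Y. height C e (?x x y)) \<le>
         real (card Y) * (real ?d * (D * C ^ ?d) * t * exp (- real ?m * real ?n * t) * ?f + 1)"
      by (simp add: k1_def k0_def algebra_simps)
  qed
qed

text \<open>The rows of the transposed unipotent have norm at most \<open>m + n\<close>, so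
  \<open>alpha_translate_le\<close> applies with this \<open>b\<close>. It transfers heights between
  a grid point and its box at a cost independent of \<open>t\<close>.\<close>

lemma height_umat_le:
  fixes x :: "(real^('m + 'n)^('m + 'n)) set" and z :: "real^'n^'m"
  assumes x: "x \<in> XSpace" and e: "0 < e" and z: "\<And>a b. \<bar>z $ a $ b\<bar> \<le> 1"
  shows "height C e (act (umat z) x) \<le> (C * real (CARD('m) + CARD('n)) ^ (CARD('m) + CARD('n))) ^ (CARD('m) + CARD('n)) * height C e x"
proof -
  let ?d = "CARD('m) + CARD('n)"
  let ?A = "rep C x"
  let ?H = "transpose (umat z) :: real^('m + 'n)^('m + 'n)"
  let ?B = "C * real ?d ^ ?d"
  have d1: "1 \<le> real ?d" using zero_less_card_finite[where 'a='m] by linarith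
  have B1: "1 \<le> ?B" using mult_mono[OF reduction_bound_ge_1 one_le_power[OF d1, of "CARD('m) + CARD('n)"]] reduction_bound_ge_1 by simp
  then have Bd: "1 \<le> ?B ^ ?d" by (rule one_le_power)
  have A: "det ?A = 1" "(\<Prod>c\<in>UNIV. n1 (?A $ c)) \<le> C" using rep[OF C x] by auto
  obtain Z where Z: "Z \<in> SLZ" "rep C (act (umat z) x) = Z ** ?A ** ?H" using rep_act[OF C x det_umat] by blast
  have dH: "det ?H = 1" by (simp add: det_umat)
  have nH: "n1 (?H $ k) \<le> real ?d" for k
  proof -
    have "\<bar>?H $ k $ j\<bar> \<le> 1" for j using z by (auto simp: transpose_def umat_def split: sum.splits)
    then show ?thesis using n1_le_CARD[of "?H $ k" 1] by simp
  qed
  have "(e ^ (i * (?d - i)) * alpha i (rep C (act (umat z) x))) powr height_exp CARD('m) CARD('n) i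
    \<le> ?B ^ ?d * (e ^ (i * (?d - i)) * alpha i ?A) powr height_exp CARD('m) CARD('n) i" if i: "i \<in> {1..<?d}" for i
  proof -
    let ?q = "e ^ (i * (?d - i))" and ?\<beta> = "height_exp CARD('m) CARD('n) i"
    have iC: "i \<le> CARD('m + 'n)" using i by simp
    have be: "1 \<le> ?\<beta>" "?\<beta> \<le> real ?d" using height_exp_bounds[of i] i by auto
    have pos: "0 < alpha i ?A" "0 < alpha i (rep C (act (umat z) x))"
      by (intro alpha_pos A iC rep(1)[OF C] act_XSpace det_umat x)+
    have "alpha i (rep C (act (umat z) x)) \<le> C * real ?d ^ CARD('m + 'n) * alpha i ?A"
      unfolding Z(2) by (rule alpha_translate_le[OF A dH nH d1 Z(1) iC])
    then have "?q * alpha i (rep C (act (umat z) x)) \<le> ?B * (?q * alpha i ?A)"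
      using e mult_left_mono[of "alpha i (rep C (act (umat z) x))" "?B * alpha i ?A" ?q] by (simp add: mult_ac)
    then have "(?q * alpha i (rep C (act (umat z) x))) powr ?\<beta> \<le> (?B * (?q * alpha i ?A)) powr ?\<beta>"
      using pos e be by (intro powr_mono2) auto
    also have "\<dots> = ?B powr ?\<beta> * (?q * alpha i ?A) powr ?\<beta>"
      by (rule powr_mult)
    also have "\<dots> \<le> ?B ^ ?d * (?q * alpha i ?A) powr ?\<beta>"
      by (intro mult_right_mono powr_le_power B1 be) auto
    finally show ?thesis .
  qed
  then have "height C e (act (umat z) x) \<le> ?B ^ ?d * 1 + (\<Sum>i\<in>{1..<?d}. ?B ^ ?d * (e ^ (i * (?d - i)) * alpha i ?A) powr height_exp CARD('m) CARD('n) i)"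
    unfolding height_def using Bd by (intro add_mono sum_mono) auto
  also have "\<dots> = ?B ^ ?d * height C e x" unfolding height_def by (simp add: sum_distrib_left distrib_left)
  finally show ?thesis .
qed

text \<open>Removes \<open>e\<close>, and with it the dependence on \<open>t\<close>, from the bound
  that becomes the function of \<open>x\<close>.\<close>

lemma height_mono:
  fixes x :: "(real^('m + 'n)^('m + 'n)) set"
  assumes x: "x \<in> XSpace" and e: "0 < e" "e \<le> 1"
  shows "height C e x \<le> height C 1 x"
proof -
  let ?d = "CARD('m) + CARD('n)"
  have "(e ^ (i * (?d - i)) * alpha i (rep C x)) powr height_exp CARD('m) CARD('n) i
    \<le> (1 ^ (i * (?d - i)) * alpha i (rep C x)) powr height_exp CARD('m) CARD('n) i" if i: "i \<in> {1..<?d}" for i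
  proof -
    have "0 < alpha i (rep C x)" by (rule alpha_pos[OF rep(1)[OF C x]]) (use i in simp)
    moreover have "e ^ (i * (?d - i)) \<le> 1" using e by (simp add: power_le_one)
    moreover have "1 \<le> height_exp CARD('m) CARD('n) i" using i by (intro height_exp_bounds) auto
    ultimately show ?thesis using e by (intro powr_mono2 mult_right_mono) auto
  qed
  then show ?thesis unfolding height_def by (intro add_left_mono sum_mono)
qed

text \<open>Mahler's criterion by reduction theory: cosets of matrices with bounded entries form a
  compact set. A large entry makes one row long, hence the product of the other norms small and
  \<open>alpha\<close> of rank \<open>d - 1\<close> large.\<close>

lemma height_proper:
  assumes e: "0 < e"
  obtains Q :: "(real^('m + 'n)^('m + 'n)) set set" where "compactin XTop Q"
    "\<And>x. x \<in> XSpace \<Longrightarrow> x \<notin> Q \<Longrightarrow> M < height C e x"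
proof -
  let ?d = "CARD('m) + CARD('n)"
  \<comment> \<open>Solved from \<open>e ^ (?d - 1) * (R / C) = \<bar>M\<bar> + 2\<close>; the right
    side exceeds 1, so raising it to the power \<open>height_exp\<close> does not lower it.\<close>
  define R where "R = C / e ^ (?d - 1) * (\<bar>M\<bar> + 2)"
  have R0: "0 < R" unfolding R_def using reduction_bound_ge_1 e by (intro mult_pos_pos divide_pos_pos) auto
  define G where "G = {g :: real^('m + 'n)^('m + 'n). det g = 1 \<and> (\<forall>i j. \<bar>g $ i $ j\<bar> \<le> R)}"
  have "compact G"
    unfolding compact_eq_bounded_closed
  proof
    have "norm g \<le> (\<Sum>i\<in>(UNIV :: ('m + 'n) set). \<Sum>j\<in>(UNIV :: ('m + 'n) set). R)" if "g \<in> G" for g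
    proof -
      have "norm g \<le> (\<Sum>i\<in>UNIV. norm (g $ i))" unfolding norm_vec_def[of g] by (rule L2_set_le_sum) auto
      also have "\<dots> \<le> (\<Sum>i\<in>UNIV. \<Sum>j\<in>UNIV. \<bar>g $ i $ j\<bar>)" by (intro sum_mono norm_le_l1_cart)
      also have "\<dots> \<le> (\<Sum>i\<in>(UNIV :: ('m + 'n) set). \<Sum>j\<in>(UNIV :: ('m + 'n) set). R)"
        using that by (intro sum_mono) (auto simp: G_def)
      finally show ?thesis .
    qed
    then show "bounded G" unfolding bounded_iff by blast
    have c: "continuous_on UNIV (det :: real^('m + 'n)^('m + 'n) \<Rightarrow> real)"
      unfolding det_def by (intro continuous_intros)
    have "closed {g :: real^('m + 'n)^('m + 'n). det g = 1}"
      using c by (intro closed_Collect_eq continuous_intros)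
    moreover have "closed {g :: real^('m + 'n)^('m + 'n). \<forall>i j. \<bar>g $ i $ j\<bar> \<le> R}"
      by (intro closed_Collect_all closed_Collect_le continuous_intros)
    ultimately show "closed G" unfolding G_def by (intro closed_Collect_conj)
  qed
  define Q where "Q = (\<lambda>g. g <#\<^bsub>SLR\<^esub> SLZ) ` G"
  show ?thesis
  proof (rule that[of Q])
    have "compactin (top_of_set (carrier SLR)) G"
      using \<open>compact G\<close> by (auto simp: compactin_subtopology G_def SLR_def)
    then show "compactin XTop Q"
      unfolding Q_def using quotient_map_XTop quotient_imp_continuous_map by (intro image_compactin) auto
    fix x :: "(real^('m + 'n)^('m + 'n)) set" assume x: "x \<in> XSpace" "x \<notin> Q"
    let ?A = "rep C x"
    have A: "det ?A = 1" "(\<Prod>c\<in>UNIV. n1 (?A $ c)) \<le> C" "transpose ?A \<in> x" using rep[OF C x(1)] by auto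
    obtain g where g: "det g = 1" "x = (\<lambda>z. g ** z) ` SLZ" using x by (auto simp: XSpace_iff)
    have "x = transpose ?A <#\<^bsub>SLR\<^esub> SLZ"
    proof -
      obtain z where z: "z \<in> SLZ" "transpose ?A = g ** z" using A(3) g by auto
      obtain w where w: "w \<in> SLZ" "z ** w = mat 1" using SLZ_inverse[OF z(1)] by blast
      have "(\<lambda>y. g ** y) ` SLZ = (\<lambda>y. g ** z ** y) ` SLZ"
      proof (intro equalityI image_subsetI)
        fix y :: "real^('m + 'n)^('m + 'n)" assume y: "y \<in> SLZ"
        have "g ** y = g ** z ** (w ** y)" using w by (metis matrix_mul_assoc matrix_mul_rid)
        then show "g ** y \<in> (\<lambda>y. g ** z ** y) ` SLZ" using SLZ_mult[OF w(1) y] by blast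
        have "g ** z ** y = g ** (z ** y)" by (simp add: matrix_mul_assoc)
        then show "g ** z ** y \<in> (\<lambda>y. g ** y) ` SLZ" using SLZ_mult[OF z(1) y] by blast
      qed
      from trans[OF g(2) this] show ?thesis unfolding lcoset_SLR z(2) .
    qed
    then have "transpose ?A \<notin> G" using x by (auto simp: Q_def)
    then have "\<not> (\<forall>i j. \<bar>transpose ?A $ i $ j\<bar> \<le> R)" unfolding G_def using A(1) by simp
    then obtain j k where "R < \<bar>transpose ?A $ j $ k\<bar>" by (auto simp: not_le)
    then have "R < \<bar>?A $ k $ j\<bar>" by (simp add: transpose_def)
    then have Rk: "R < n1 (?A $ k)" using component_le_n1[of "?A $ k" j] by linarith
    let ?P = "\<Prod>c\<in>UNIV - {k}. n1 (?A $ c)"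
    have P: "0 < ?P" by (rule prod_n1_pos[OF A(1)])
    have "n1 (?A $ k) * ?P \<le> C" using A(2) by (simp add: prod.remove[of UNIV k])
    then have "R * ?P \<le> C" using Rk P by (meson less_imp_le mult_right_mono order_trans)
    then have "R / C \<le> 1 / ?P" using P reduction_bound_ge_1 by (simp add: field_simps)
    also have "\<dots> \<le> alpha (?d - 1) ?A" by (rule alpha_ge) simp
    finally have al: "R / C \<le> alpha (?d - 1) ?A" .
    have dd2: "0 < ?d - 1" "?d - 1 < ?d" using zero_less_card_finite[where 'a='m] zero_less_card_finite[where 'a='n] by linarith+
    let ?\<beta> = "height_exp CARD('m) CARD('n) (?d - 1)"
    have be: "1 \<le> ?\<beta>" by (rule height_exp_bounds) (use dd2 in auto)
    have dd1: "(?d - 1) * (?d - (?d - 1)) = ?d - 1" using dd2 by simp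
    have "\<bar>M\<bar> + 2 = e ^ (?d - 1) * (R / C)" using e reduction_bound_ge_1 by (simp add: R_def)
    also have "\<dots> \<le> e ^ (?d - 1) * alpha (?d - 1) ?A" using al e by (intro mult_left_mono) auto
    finally have "(\<bar>M\<bar> + 2) powr ?\<beta> \<le> (e ^ ((?d - 1) * (?d - (?d - 1))) * alpha (?d - 1) ?A) powr ?\<beta>"
      unfolding dd1 using be by (intro powr_mono2) auto
    also have "\<dots> \<le> height C e x" by (rule height_term_le[OF dd2])
    finally have "(\<bar>M\<bar> + 2) powr ?\<beta> \<le> height C e x" .
    moreover have "(\<bar>M\<bar> + 2) powr 1 \<le> (\<bar>M\<bar> + 2) powr ?\<beta>" using be by (intro powr_mono) auto
    ultimately show "M < height C e x" by simp
  qed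
qed

end

subsection \<open>Covering\<close>

lemma mgrid_cover:
  fixes s :: "real^'n::finite^'m::finite"
  assumes "\<epsilon> > 0" "\<And>a b. \<bar>s $ a $ b\<bar> \<le> \<epsilon>" "K > 0"
  obtains y where "y \<in> mgrid \<epsilon> K" "\<And>a b. \<bar>s $ a $ b - y $ a $ b\<bar> \<le> \<epsilon> / real K"
proof -
  have "\<exists>y. y \<in> gridpts \<epsilon> K \<and> \<bar>s $ a $ b - y\<bar> \<le> \<epsilon> / real K" for a b
    using gridpts_cover[OF assms(1) assms(2) assms(3)] by metis
  then obtain f where "f a b \<in> gridpts \<epsilon> K" "\<bar>s $ a $ b - f a b\<bar> \<le> \<epsilon> / real K" for a b
    by metis
  then show ?thesis by (intro that[of "\<chi> a b. f a b"]) (auto simp: mgrid_def)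
qed

text \<open>Each step into the part \<open>M < height C e x\<close> costs a factor \<open>2 \<kappa>\<close>. The weight
  \<open>height C e x / M\<close> carries this saving through consecutive steps of a long excursion.\<close>

lemma excursion_cover:
  fixes x :: "(real^('m::finite + 'n::finite)^('m + 'n)) set" and t \<epsilon> :: real
  defines "T \<equiv> (real CARD('m) + real CARD('n)) * t"
  defines "Y \<equiv> mgrid \<epsilon> (npts T) :: (real^'n^'m) set"
  assumes C: "reduction_bound TYPE('m + 'n) C" and e: "0 < e" and eps: "0 < \<epsilon>" "\<epsilon> \<le> 1"
    and avg: "\<And>x :: (real^('m + 'n)^('m + 'n)) set. x \<in> XSpace \<Longrightarrow>
       (\<Sum>y\<in>Y. height C e (act (gmat t) (act (umat y) x))) \<le> real (card Y) * (\<kappa> * height C e x + 1)"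
    and k: "0 < \<kappa>" "2 * \<kappa> \<le> 1" and M: "1 \<le> \<kappa> * M"
    and Q: "\<And>x. x \<in> XSpace \<Longrightarrow> x \<notin> Q \<Longrightarrow>
       (C * real (CARD('m) + CARD('n)) ^ (CARD('m) + CARD('n))) ^ (CARD('m) + CARD('n)) * M < height C e x"
    and x: "x \<in> XSpace"
  shows "\<exists>W. finite W \<and>
     real (card W) \<le> (2 * \<kappa>) powr k * (2 * real (card Y)) ^ N * (if M < height C e x then height C e x / M else 1) \<and>
     (\<forall>s :: real^'n^'m. (\<forall>a b. \<bar>s $ a $ b\<bar> \<le> \<epsilon>) \<and>
        k \<le> real (card {l\<in>{1..N}. act (gmat (t * real l)) (act (umat s) x) \<notin> Q})
        \<longrightarrow> (\<exists>c\<in>W. \<forall>a b. \<bar>s $ a $ b - c $ a $ b\<bar> \<le> \<epsilon> * exp (- T * real N)))"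
  using x
proof (induction N arbitrary: x k)
  case 0
  show ?case
  \<comment> \<open>\<open>k\<close> is a real number that the induction may lower below 0. For
    \<open>k > 0\<close> no \<open>s\<close> satisfies the premise and the empty set covers.\<close>
  proof (cases "k \<le> 0")
    case True
    have "(2 * \<kappa>) powr 0 \<le> (2 * \<kappa>) powr k" using True k by (intro powr_mono') auto
    then have "1 \<le> (2 * \<kappa>) powr k" using k by simp
    moreover have M0: "0 < M" using M k by (metis less_le_trans zero_less_mult_pos zero_less_one)
    then have "1 \<le> (if M < height C e x then height C e x / M else 1)" by simp
    ultimately have "1 * 1 \<le> (2 * \<kappa>) powr k * (if M < height C e x then height C e x / M else 1)"
      by (intro mult_mono) auto
    then show ?thesis by (intro exI[of _ "{0}"]) auto
  next
    case False
    have "0 \<le> M" using M k by (metis less_imp_le less_le_trans zero_less_mult_pos zero_less_one)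
    then have "0 \<le> (if M < height C e x then height C e x / M else 1)" by auto
    then show ?thesis using False by (intro exI[of _ "{}"]) (auto simp: mult_nonneg_nonneg)
  qed
next
  case (Suc N)
  let ?m = "CARD('m)" and ?n = "CARD('n)"
  let ?h = "height C e :: (real^('m + 'n)^('m + 'n)) set \<Rightarrow> real"
  let ?C3 = "(C * real (?m + ?n) ^ (?m + ?n)) ^ (?m + ?n)"
  define fbar where "fbar z = (if M < ?h z then ?h z / M else 1)" for z
  define x' where "x' y = act (gmat t) (act (umat y) x)" for y :: "real^'n^'m"
  have M0: "0 < M" using M k by (metis less_le_trans zero_less_mult_pos zero_less_one)
  have h1: "1 \<le> ?h z" for z by (rule height_ge_1[OF C])
  have x'X: "x' y \<in> XSpace" for y unfolding x'_def by (intro act_XSpace det_gmat det_umat Suc.prems)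
  \<comment> \<open>Only cells whose point \<open>x' y\<close> has height above \<open>M\<close> can
    be charged for a visit, so \<open>k\<close> is lowered for these alone.\<close>
  define hi where "hi y = (M < ?h (x' y))" for y
  have C3: "1 \<le> ?C3"
  proof -
    have "1 \<le> real (?m + ?n)" using zero_less_card_finite[where 'a='m] by linarith
    then have "1 * 1 \<le> C * real (?m + ?n) ^ (?m + ?n)"
      using reduction_bound_ge_1[OF C] by (intro mult_mono one_le_power) auto
    then show ?thesis by (intro one_le_power) simp
  qed
  have finY: "finite Y" unfolding Y_def by (rule card_mgrid[OF eps(1)])
  define good where "good y W \<longleftrightarrow> finite W \<and>
     real (card W) \<le> (2 * \<kappa>) powr (k - (if hi y then 1 else 0)) * (2 * real (card Y)) ^ N * fbar (x' y) \<and>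
     (\<forall>s :: real^'n^'m. (\<forall>a b. \<bar>s $ a $ b\<bar> \<le> \<epsilon>) \<and>
        k - (if hi y then 1 else 0) \<le> real (card {l\<in>{1..N}. act (gmat (t * real l)) (act (umat s) (x' y)) \<notin> Q})
        \<longrightarrow> (\<exists>c\<in>W. \<forall>a b. \<bar>s $ a $ b - c $ a $ b\<bar> \<le> \<epsilon> * exp (- T * real N)))" for y W
  have "\<exists>W. good y W" for y
    unfolding good_def fbar_def by (rule Suc.IH[OF x'X])
  then have "\<forall>y. \<exists>W. good y W" by blast
  from choice[OF this] obtain W where good: "\<forall>y. good y (W y)" by blast
  then have W: "\<And>y. finite (W y)"
    "\<And>y. real (card (W y)) \<le> (2 * \<kappa>) powr (k - (if hi y then 1 else 0)) * (2 * real (card Y)) ^ N * fbar (x' y)"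
    unfolding good_def by blast+
  have W3: "\<exists>c\<in>W y. \<forall>a b. \<bar>s $ a $ b - c $ a $ b\<bar> \<le> \<epsilon> * exp (- T * real N)"
    if "\<forall>a b. \<bar>s $ a $ b\<bar> \<le> \<epsilon>"
      "k - (if hi y then 1 else 0) \<le> real (card {l\<in>{1..N}. act (gmat (t * real l)) (act (umat s) (x' y)) \<notin> Q})" for y s
    using good that unfolding good_def by blast
  define V where "V = (\<Union>y\<in>Y. (\<lambda>c. y + exp (- T) *\<^sub>R c) ` W y)"
  have finV: "finite V" unfolding V_def using finY W(1) by auto
  have cardV: "real (card V) \<le> (2 * \<kappa>) powr k * (2 * real (card Y)) ^ Suc N * fbar x"
  proof -
    have "card V \<le> (\<Sum>y\<in>Y. card ((\<lambda>c. y + exp (- T) *\<^sub>R c) ` W y))"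
      unfolding V_def by (rule card_UN_le[OF finY])
    also have "\<dots> \<le> (\<Sum>y\<in>Y. card (W y))" by (intro sum_mono card_image_le W)
    finally have "real (card V) \<le> (\<Sum>y\<in>Y. real (card (W y)))" by (simp flip: of_nat_sum)
    \<comment> \<open>A common bound for both cases: under \<open>hi y\<close> one factor
      \<open>2 * \<kappa>\<close> is lost and goes into the height term; otherwise the summand 1
      suffices.\<close>
    also have "\<dots> \<le> (\<Sum>y\<in>Y. (2 * \<kappa>) powr k * (2 * real (card Y)) ^ N * (?h (x' y) / (2 * \<kappa> * M) + 1))"
    proof (rule sum_mono)
      fix y
      have "(2 * \<kappa>) powr (k - (if hi y then 1 else 0)) * fbar (x' y) \<le> (2 * \<kappa>) powr k * (?h (x' y) / (2 * \<kappa> * M) + 1)"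
      proof (cases "hi y")
        case True
        have "(2 * \<kappa>) powr (k - 1) * (?h (x' y) / M) = (2 * \<kappa>) powr k * (?h (x' y) / (2 * \<kappa> * M))"
          using k by (simp add: powr_diff)
        also have "\<dots> \<le> (2 * \<kappa>) powr k * (?h (x' y) / (2 * \<kappa> * M) + 1)" by (intro mult_left_mono) auto
        finally show ?thesis using True by (simp add: fbar_def hi_def)
      next
        case False
        have "0 \<le> ?h (x' y) / (2 * \<kappa> * M)" using h1[of "x' y"] k M0 by (intro divide_nonneg_nonneg) auto
        then have "(2 * \<kappa>) powr k * 1 \<le> (2 * \<kappa>) powr k * (?h (x' y) / (2 * \<kappa> * M) + 1)"
          by (intro mult_left_mono) auto
        then show ?thesis using False by (simp add: fbar_def hi_def)
      qed
      then have "(2 * real (card Y)) ^ N * ((2 * \<kappa>) powr (k - (if hi y then 1 else 0)) * fbar (x' y))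
        \<le> (2 * real (card Y)) ^ N * ((2 * \<kappa>) powr k * (?h (x' y) / (2 * \<kappa> * M) + 1))"
        by (intro mult_left_mono) auto
      then show "real (card (W y)) \<le> (2 * \<kappa>) powr k * (2 * real (card Y)) ^ N * (?h (x' y) / (2 * \<kappa> * M) + 1)"
        using W(2)[of y] by (simp only: mult_ac)
    qed
    also have "\<dots> = (2 * \<kappa>) powr k * (2 * real (card Y)) ^ N * ((\<Sum>y\<in>Y. ?h (x' y)) / (2 * \<kappa> * M) + real (card Y))"
      by (simp add: sum_distrib_left[symmetric] sum.distrib sum_divide_distrib[symmetric])
    also have "\<dots> \<le> (2 * \<kappa>) powr k * (2 * real (card Y)) ^ N * (2 * real (card Y) * fbar x)"
    proof (rule mult_left_mono)
      have f: "1 \<le> fbar x" "?h x / M \<le> fbar x" using M0 by (auto simp: fbar_def)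
      \<comment> \<open>The \<open>\<kappa>\<close> of the average cancels the one in the
        denominator, and \<open>1 \<le> \<kappa> * M\<close> controls the constant term; each of the
        two halves is at most \<open>fbar x / 2\<close>.\<close>
      have "(\<Sum>y\<in>Y. ?h (x' y)) / (2 * \<kappa> * M) \<le> real (card Y) * (\<kappa> * ?h x + 1) / (2 * \<kappa> * M)"
        unfolding x'_def using avg[OF Suc.prems] k M0 by (intro divide_right_mono) auto
      also have "\<dots> = real (card Y) * (?h x / M / 2 + 1 / (\<kappa> * M) / 2)"
        using k M0 by (simp add: field_simps)
      also have "\<dots> \<le> real (card Y) * fbar x"
      proof (rule mult_left_mono)
        have "1 / (\<kappa> * M) \<le> 1" using M by simp
        moreover have "p / 2 + q / 2 \<le> r" if "p \<le> r" "q \<le> 1" "1 \<le> r" for p q r :: real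
          using that by linarith
        ultimately show "?h x / M / 2 + 1 / (\<kappa> * M) / 2 \<le> fbar x" using f by blast
      qed simp
      finally have "(\<Sum>y\<in>Y. ?h (x' y)) / (2 * \<kappa> * M) \<le> real (card Y) * fbar x" .
      moreover have "real (card Y) * 1 \<le> real (card Y) * fbar x" using f by (intro mult_left_mono) auto
      ultimately show "(\<Sum>y\<in>Y. ?h (x' y)) / (2 * \<kappa> * M) + real (card Y) \<le> 2 * real (card Y) * fbar x" by linarith
    qed simp
    finally show ?thesis by (simp add: mult_ac)
  qed
  have cover: "\<exists>c\<in>V. \<forall>a b. \<bar>s $ a $ b - c $ a $ b\<bar> \<le> \<epsilon> * exp (- T * real (Suc N))"
    if s: "\<And>a b. \<bar>s $ a $ b\<bar> \<le> \<epsilon>"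
      "k \<le> real (card {l\<in>{1..Suc N}. act (gmat (t * real l)) (act (umat s) x) \<notin> Q})" for s :: "real^'n^'m"
  proof -
    obtain y where y: "y \<in> Y" "\<And>a b. \<bar>s $ a $ b - y $ a $ b\<bar> \<le> \<epsilon> / real (npts T)"
      unfolding Y_def using mgrid_cover[OF eps(1) s(1) npts_bounds(3)] by metis
    \<comment> \<open>The cell around \<open>y\<close> is enlarged to the full box. By
      \<open>gmat_umat\<close> the orbit of \<open>s\<close> after the first step is that of
      \<open>s'\<close> starting at \<open>x' y\<close>.\<close>
    define s' where "s' = exp T *\<^sub>R (s - y)"
    have s': "\<bar>s' $ a $ b\<bar> \<le> \<epsilon>" for a b
    proof -
      have "\<bar>s' $ a $ b\<bar> = exp T * \<bar>s $ a $ b - y $ a $ b\<bar>" by (simp add: s'_def abs_mult)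
      also have "\<dots> \<le> exp T * (\<epsilon> / real (npts T))" by (intro mult_left_mono y) auto
      also have "\<dots> \<le> real (npts T) * (\<epsilon> / real (npts T))"
        using npts_bounds(1)[of T] eps by (intro mult_right_mono) auto
      finally show ?thesis using npts_bounds(3)[of T] by simp
    qed
    have flow: "act (gmat (t * real (Suc l))) (act (umat s) x) = act (gmat (t * real l)) (act (umat s') (x' y))" for l
    proof -
      have "(gmat (t * real l) ** umat s') ** (gmat t ** umat y)
        = gmat (t * real l) ** ((umat s' ** gmat t) ** umat y :: real^('m + 'n)^('m + 'n))"
        by (simp add: matrix_mul_assoc)
      also have "umat s' ** gmat t = (gmat t ** umat (s - y) :: real^('m + 'n)^('m + 'n))"
        unfolding s'_def T_def by (rule gmat_umat[symmetric])
      also have "gmat (t * real l) ** ((gmat t ** umat (s - y)) ** umat y :: real^('m + 'n)^('m + 'n))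
        = (gmat (t * real l) ** gmat t) ** (umat (s - y) ** umat y)" by (simp add: matrix_mul_assoc)
      also have "\<dots> = gmat (t * real (Suc l)) ** umat s"
        by (simp add: gmat_add umat_add algebra_simps)
      finally have e: "(gmat (t * real l) ** umat s') ** (gmat t ** umat y)
        = (gmat (t * real (Suc l)) ** umat s :: real^('m + 'n)^('m + 'n))" .
      show ?thesis unfolding x'_def act_act e[symmetric] by (simp only: matrix_mul_assoc)
    qed
    let ?bad = "\<lambda>l. act (gmat (t * real l)) (act (umat s) x) \<notin> Q"
    let ?bad' = "\<lambda>l. act (gmat (t * real l)) (act (umat s') (x' y)) \<notin> Q"
    \<comment> \<open>A point outside \<open>Q\<close> has height above \<open>?C3 * M\<close>, and
      passing to \<open>x' y\<close> costs at most the factor \<open>?C3\<close>.\<close>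
    have hi: "hi y" if "?bad 1"
    proof -
      have "act (umat s') (x' y) \<notin> Q"
        using that flow[of 0] by (simp add: gmat_0 act_eq)
      moreover have "act (umat s') (x' y) \<in> XSpace" by (rule act_XSpace[OF det_umat x'X])
      ultimately have "?C3 * M < ?h (act (umat s') (x' y))" by (intro Q)
      also have "\<dots> \<le> ?C3 * ?h (x' y)"
        using s' eps(2) by (intro height_umat_le[OF C x'X e]) (meson order_trans)
      finally show ?thesis using C3 by (simp add: hi_def)
    qed
    have "{l\<in>{1..Suc N}. ?bad l} \<subseteq> (if ?bad 1 then {1} else {}) \<union> Suc ` {l\<in>{1..N}. ?bad' l}"
    proof
      fix l assume l: "l \<in> {l\<in>{1..Suc N}. ?bad l}"
      show "l \<in> (if ?bad 1 then {1} else {}) \<union> Suc ` {l\<in>{1..N}. ?bad' l}"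
      proof (cases "l = 1")
        case True
        then show ?thesis using l by simp
      next
        case False
        then obtain l' where l': "l = Suc l'" "l' \<in> {1..N}" using l by (cases l) auto
        then have "?bad' l'" using l flow[of l'] by simp
        then show ?thesis using l' by blast
      qed
    qed
    then have "card {l\<in>{1..Suc N}. ?bad l} \<le> card ((if ?bad 1 then {1} else {}) \<union> Suc ` {l\<in>{1..N}. ?bad' l})"
      by (intro card_mono) auto
    also have "\<dots> \<le> card (if ?bad 1 then {1::nat} else {}) + card (Suc ` {l\<in>{1..N}. ?bad' l})"
      by (rule card_Un_le)
    also have "\<dots> \<le> (if hi y then 1 else 0) + card {l\<in>{1..N}. ?bad' l}"
      using hi by (auto simp: card_image)
    finally have "card {l\<in>{1..Suc N}. ?bad l} \<le> (if hi y then 1 else 0) + card {l\<in>{1..N}. ?bad' l}" .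
    then have "real (card {l\<in>{1..Suc N}. ?bad l}) \<le> (if hi y then 1 else 0) + real (card {l\<in>{1..N}. ?bad' l})"
      by (auto split: if_splits)
    then have "k - (if hi y then 1 else 0) \<le> real (card {l\<in>{1..N}. ?bad' l})" using s(2) by linarith
    then obtain c where c: "c \<in> W y" "\<And>a b. \<bar>s' $ a $ b - c $ a $ b\<bar> \<le> \<epsilon> * exp (- T * real N)"
      using W3[of s' y] s' by blast
    have "\<bar>s $ a $ b - (y + exp (- T) *\<^sub>R c) $ a $ b\<bar> \<le> \<epsilon> * exp (- T * real (Suc N))" for a b
    proof -
      have "s $ a $ b - (y + exp (- T) *\<^sub>R c) $ a $ b = exp (- T) * (s' $ a $ b - c $ a $ b)"
      proof -
        have "exp (- T) * (s' $ a $ b - c $ a $ b)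
          = (exp (- T) * exp T) * (s $ a $ b - y $ a $ b) - exp (- T) * c $ a $ b"
          by (simp add: s'_def algebra_simps)
        also have "exp (- T) * exp T = 1" using exp_add[of "- T" T] by simp
        finally show ?thesis by simp
      qed
      then have "\<bar>s $ a $ b - (y + exp (- T) *\<^sub>R c) $ a $ b\<bar> = exp (- T) * \<bar>s' $ a $ b - c $ a $ b\<bar>"
        by (simp add: abs_mult)
      also have "\<dots> \<le> exp (- T) * (\<epsilon> * exp (- T * real N))" by (intro mult_left_mono c) auto
      also have "\<dots> = \<epsilon> * exp (- T + - T * real N)" by (simp only: exp_add mult_ac)
      also have "- T + - T * real N = - T * real (Suc N)" by (simp add: algebra_simps)
      finally show ?thesis .
    qed
    then show ?thesis using y(1) c(1) unfolding V_def by blast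
  qed
  show ?case
    using finV cardV cover unfolding fbar_def by (intro exI[of _ V]) blast
qed

lemma norm_matrix_le:
  fixes z :: "real^'n::finite^'m::finite"
  assumes "\<And>a b. \<bar>z $ a $ b\<bar> \<le> r"
  shows "norm z \<le> real CARD('m) * real CARD('n) * r"
proof -
  have "norm z \<le> (\<Sum>a\<in>UNIV. norm (z $ a))" unfolding norm_vec_def[of z] by (rule L2_set_le_sum) auto
  also have "\<dots> \<le> (\<Sum>a\<in>UNIV. \<Sum>b\<in>UNIV. \<bar>z $ a $ b\<bar>)" by (intro sum_mono norm_le_l1_cart)
  also have "\<dots> \<le> (\<Sum>a\<in>(UNIV::'m set). \<Sum>b\<in>(UNIV::'n set). r)" using assms by (intro sum_mono) simp
  finally show ?thesis by simp
qed

theorem theorem1p5: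
  shows "\<exists>(t0::real) (C :: (real^('m::finite + 'n::finite)^('m + 'n)) set \<Rightarrow> real).
    t0 > 0 \<and> (\<forall>x\<in>XSpace. C x > 0) \<and>
    (\<forall>t>t0. \<exists>Q. compactin XTop Q \<and>
      (\<forall>(N::nat) (\<delta>::real). \<forall>x\<in>XSpace. N \<ge> 1 \<and> 0 < \<delta> \<and> \<delta> < 1 \<longrightarrow>
        (\<exists>S. S \<subseteq> USub \<and> finite S \<and>
          real (card S) \<le> C x * t ^ (3 * N) *
            exp ((real CARD('m) + real CARD('n) - \<delta>) * real CARD('m) * real CARD('n) * t * real N) \<and>
          Zset x Q N t \<delta> \<subseteq>
            (\<Union>c\<in>S. ballU c (exp (- (real CARD('m) + real CARD('n)) * t * real N))))))"
proof -
  let ?m = "CARD('m)" and ?n = "CARD('n)"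
  obtain C where C: "reduction_bound TYPE('m + 'n) C"
    unfolding reduction_bound_def using reduced_basis_exists[where 'k="'m + 'n"] by metis
  obtain \<epsilon> D where eps: "0 < \<epsilon>" "\<epsilon> \<le> 1" "real ?m * real ?n * \<epsilon> < 1" and D: "1 \<le> D"
    "\<And>t (A :: real^('m + 'n)^('m + 'n)) J.
      1 \<le> t \<Longrightarrow> det A = 1 \<Longrightarrow> 0 < card J \<Longrightarrow> card J < ?m + ?n \<Longrightarrow>
      (\<Sum>y\<in>mgrid \<epsilon> (npts ((real ?m + real ?n) * t)).
        covol J (\<lambda>c. A $ c v* transpose (gmat t ** umat y)) powr (- height_exp ?m ?n (card J)))
      \<le> D * t * exp (- real ?m * real ?n * t)
        * real (card (mgrid \<epsilon> (npts ((real ?m + real ?n) * t)) :: (real^'n^'m) set))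
        * covol J (($) A) powr (- height_exp ?m ?n (card J))"
    using sum_covol_flow_le[where 'm='m and 'n='n] by blast
  define L where "L = real (?m + ?n) * (D * C ^ (?m + ?n))"
  \<comment> \<open>The constant paid per step: \<open>2 * L\<close> from
    \<open>2 * \<kappa>\<close>, 2 from \<open>2 * card Y\<close>, and \<open>2 ^ (m n)\<close> from
    rounding \<open>exp T\<close> up in \<open>npts\<close>. Also \<open>t > w\<close> ensures
    \<open>2 * \<kappa> \<le> 1\<close>.\<close>
  define w where "w = 4 * L * 2 ^ (?m * ?n)"
  have m1: "1 \<le> real ?m" "1 \<le> real ?n" using zero_less_card_finite[where 'a='m] zero_less_card_finite[where 'a='n] by linarith+
  have L1: "1 \<le> L"
  proof -
    have "1 * (1 * 1) \<le> real (?m + ?n) * (D * C ^ (?m + ?n))"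
    proof (intro mult_mono one_le_power D(1) reduction_bound_ge_1[OF C])
      show "1 \<le> real (?m + ?n)" using m1 by linarith
    qed (use D(1) in auto)
    then show ?thesis by (simp add: L_def)
  qed
  have wL: "4 * L \<le> w"
    using L1 mult_left_mono[of 1 "2 ^ (?m * ?n)" "4 * L"] by (simp add: w_def)
  \<comment> \<open>The unit ball is cut into boxes of half-width at most \<open>\<epsilon>\<close>,
    their number independent of \<open>t\<close>; each is recentred at 0 by moving the base
    point.\<close>
  define K0 where "K0 = nat \<lceil>1 / \<epsilon>\<rceil>"
  have K0: "0 < K0" "1 / real K0 \<le> \<epsilon>"
  proof -
    have "0 < 1 / \<epsilon>" using eps by simp
    then have "0 < K0" "1 / \<epsilon> \<le> real K0" unfolding K0_def by linarith+
    then show "0 < K0" "1 / real K0 \<le> \<epsilon>" using eps by (auto simp: field_simps)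
  qed
  define E where "E = (mgrid 1 K0 :: (real^'n^'m) set)"
  have finE: "finite E" unfolding E_def by (rule card_mgrid) simp
  define Cx where "Cx x = 1 + (\<Sum>c\<in>E. height C 1 (act (umat c) x))" for x :: "(real^('m + 'n)^('m + 'n)) set"
  have h1: "1 \<le> height C e z" for e and z :: "(real^('m + 'n)^('m + 'n)) set" by (rule height_ge_1[OF C])
  have Cx1: "0 < Cx x" for x
  proof -
    have "0 \<le> (\<Sum>c\<in>E. height C 1 (act (umat c) x))" using h1 by (intro sum_nonneg) (meson order_trans zero_le_one)
    then show ?thesis by (simp add: Cx_def)
  qed
  have main: "\<exists>Q. compactin XTop Q \<and>
      (\<forall>(N::nat) (\<delta>::real). \<forall>x\<in>XSpace. N \<ge> 1 \<and> 0 < \<delta> \<and> \<delta> < 1 \<longrightarrow>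
        (\<exists>S. S \<subseteq> USub \<and> finite S \<and>
          real (card S) \<le> Cx x * t ^ (3 * N) *
            exp ((real ?m + real ?n - \<delta>) * real ?m * real ?n * t * real N) \<and>
          Zset x Q N t \<delta> \<subseteq>
            (\<Union>c\<in>S. ballU c (exp (- (real ?m + real ?n) * t * real N)))))"
    if tw: "w < t" for t
  proof -
    have t1: "1 \<le> t" using tw wL L1 by linarith
    let ?T = "(real ?m + real ?n) * t"
    define Y where "Y = (mgrid \<epsilon> (npts ?T) :: (real^'n^'m) set)"
    have finY: "finite Y" and cardY: "card Y = npts ?T ^ (?m * ?n)"
      unfolding Y_def by (rule card_mgrid[OF eps(1)])+
    have bY: "\<bar>y $ a $ b\<bar> \<le> 1" if "y \<in> Y" for y a b
    proof -
      have "y $ a $ b \<in> gridpts \<epsilon> (npts ?T)" using that by (simp add: Y_def mgrid_def)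
      then show ?thesis using gridpts_bound[OF eps(1)] eps(2) by (meson order_trans)
    qed
    define \<kappa> where "\<kappa> = L * t * exp (- real ?m * real ?n * t)"
    have k0: "0 < \<kappa>" using L1 t1 by (simp add: \<kappa>_def)
    obtain e where e: "0 < e" "e \<le> 1" and avg: "\<And>x :: (real^('m + 'n)^('m + 'n)) set. x \<in> XSpace \<Longrightarrow>
       (\<Sum>y\<in>Y. height C e (act (gmat t) (act (umat y) x))) \<le> real (card Y) * (\<kappa> * height C e x + 1)"
      using height_average[OF C D(1) D(2)[OF t1, folded Y_def] finY bY t1] unfolding \<kappa>_def L_def by blast
    have k2: "2 * \<kappa> \<le> 1"
    proof -
      have "t\<^sup>2 / 2 \<le> exp t" using exp_lower_Taylor_quadratic[of t] t1 by simp
      also have "exp t \<le> exp (real ?m * real ?n * t)"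
      proof -
        have "1 * 1 * t \<le> real ?m * real ?n * t" using m1 t1 by (intro mult_mono) auto
        then show ?thesis by simp
      qed
      finally have 1: "t\<^sup>2 / 2 \<le> exp (real ?m * real ?n * t)" .
      have "2 * L * t \<le> t\<^sup>2 / 2"
        using mult_right_mono[of "4 * L" t t] wL tw t1 by (simp add: power2_eq_square)
      then have "2 * L * t \<le> exp (real ?m * real ?n * t)" using 1 by linarith
      then show ?thesis by (simp add: \<kappa>_def exp_minus field_simps)
    qed
    \<comment> \<open>The least \<open>M\<close> with \<open>1 \<le> \<kappa> * M\<close>.\<close>
    define M where "M = 1 / \<kappa>"
    have M: "1 \<le> \<kappa> * M" "1 \<le> M" using k0 k2 by (auto simp: M_def)
    obtain Q where Q: "compactin XTop Q" "\<And>x :: (real^('m + 'n)^('m + 'n)) set. x \<in> XSpace \<Longrightarrow> x \<notin> Q \<Longrightarrow>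
       (C * real (?m + ?n) ^ (?m + ?n)) ^ (?m + ?n) * M < height C e x"
      using height_proper[OF C e(1)] by blast
    show ?thesis
    proof (intro exI[of _ Q] conjI allI ballI impI)
      show "compactin XTop Q" by (rule Q)
      fix N :: nat and \<delta> :: real and x :: "(real^('m + 'n)^('m + 'n)) set"
      assume x: "x \<in> XSpace" and "N \<ge> 1 \<and> 0 < \<delta> \<and> \<delta> < 1"
      then have N: "N \<ge> 1" and del: "0 < \<delta>" "\<delta> < 1" by auto
      define xc where "xc c = act (umat c) x" for c :: "real^'n^'m"
      have xcX: "xc c \<in> XSpace" for c unfolding xc_def by (rule act_XSpace[OF det_umat x])
      define good where "good c W \<longleftrightarrow> finite W \<and>
         real (card W) \<le> (2 * \<kappa>) powr (\<delta> * real N) * (2 * real (card Y)) ^ N * (if M < height C e (xc c) then height C e (xc c) / M else 1) \<and>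
         (\<forall>s :: real^'n^'m. (\<forall>a b. \<bar>s $ a $ b\<bar> \<le> \<epsilon>) \<and>
            \<delta> * real N \<le> real (card {l\<in>{1..N}. act (gmat (t * real l)) (act (umat s) (xc c)) \<notin> Q})
            \<longrightarrow> (\<exists>z\<in>W. \<forall>a b. \<bar>s $ a $ b - z $ a $ b\<bar> \<le> \<epsilon> * exp (- ?T * real N)))" for c W
      have "\<exists>W. good c W" for c
        unfolding good_def Y_def by (rule excursion_cover[OF C e(1) eps(1,2) avg[unfolded Y_def] k0 k2 M(1) Q(2) xcX])
      then have "\<forall>c. \<exists>W. good c W" by blast
      from choice[OF this] obtain W where good: "\<forall>c. good c (W c)" by blast
      then have W: "\<And>c. finite (W c)"
        "\<And>c. real (card (W c)) \<le> (2 * \<kappa>) powr (\<delta> * real N) * (2 * real (card Y)) ^ N * (if M < height C e (xc c) then height C e (xc c) / M else 1)"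
        unfolding good_def by blast+
      have W3: "\<exists>z\<in>W c. \<forall>a b. \<bar>s $ a $ b - z $ a $ b\<bar> \<le> \<epsilon> * exp (- ?T * real N)"
        if "\<forall>a b. \<bar>s $ a $ b\<bar> \<le> \<epsilon>"
          "\<delta> * real N \<le> real (card {l\<in>{1..N}. act (gmat (t * real l)) (act (umat s) (xc c)) \<notin> Q})" for c s
        using good that unfolding good_def by blast
      define S where "S = umat ` (\<Union>c\<in>E. (\<lambda>z. c + z) ` W c)"
      show "\<exists>S. S \<subseteq> USub \<and> finite S \<and>
          real (card S) \<le> Cx x * t ^ (3 * N) *
            exp ((real ?m + real ?n - \<delta>) * real ?m * real ?n * t * real N) \<and>
          Zset x Q N t \<delta> \<subseteq>
            (\<Union>c\<in>S. ballU c (exp (- (real ?m + real ?n) * t * real N)))"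
      proof (intro exI[of _ S] conjI)
        show "S \<subseteq> USub" by (auto simp: S_def USub_def)
        have finU: "finite (\<Union>c\<in>E. (\<lambda>z. c + z) ` W c)" using finE W(1) by auto
        then show "finite S" by (simp add: S_def)
        let ?F = "t ^ (3 * N) * exp ((real ?m + real ?n - \<delta>) * real ?m * real ?n * t * real N)"
        have fac: "(2 * \<kappa>) powr (\<delta> * real N) * (2 * real (card Y)) ^ N \<le> ?F"
        proof -
          have Lt: "1 \<le> 2 * L * t" using mult_mono[OF L1 t1] L1 by simp
          have "2 * \<kappa> = (2 * L * t) * exp (- real ?m * real ?n * t)" by (simp add: \<kappa>_def)
          then have "(2 * \<kappa>) powr (\<delta> * real N)
              = (2 * L * t) powr (\<delta> * real N) * exp (- real ?m * real ?n * t) powr (\<delta> * real N)"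
            by (simp only: powr_mult)
          also have "exp (- real ?m * real ?n * t) powr (\<delta> * real N) = exp (- real ?m * real ?n * t * \<delta> * real N)"
            by (simp add: exp_powr_real mult_ac)
          \<comment> \<open>The base is at least 1 and \<open>\<delta> < 1\<close>, so this factor
            may be paid at every step, while the exponential keeps its
            \<open>\<delta>\<close>.\<close>
          also have "(2 * L * t) powr (\<delta> * real N) \<le> (2 * L * t) powr (real N)"
            using Lt del by (intro powr_mono) (auto simp: mult_left_le_one_le)
          also have "\<dots> = (2 * L * t) ^ N" using Lt by (intro powr_realpow) linarith
          finally have 1: "(2 * \<kappa>) powr (\<delta> * real N) \<le> (2 * L * t) ^ N * exp (- real ?m * real ?n * t * \<delta> * real N)"
            by simp
          have "1 \<le> exp ?T" using m1 t1 by simp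
          then have "real (npts ?T) \<le> 2 * exp ?T" using npts_bounds(2)[of ?T] by linarith
          then have "real (card Y) \<le> (2 * exp ?T) ^ (?m * ?n)"
            unfolding cardY of_nat_power by (intro power_mono) auto
          then have "(2 * real (card Y)) ^ N \<le> (2 * (2 * exp ?T) ^ (?m * ?n)) ^ N"
            by (intro power_mono mult_left_mono) auto
          also have "\<dots> = (2 * 2 ^ (?m * ?n)) ^ N * exp ((real ?m + real ?n) * real ?m * real ?n * t * real N)"
            by (simp add: power_mult_distrib exp_of_nat_mult[symmetric] mult_ac flip: power_mult)
          finally have 2: "(2 * real (card Y)) ^ N \<le> (2 * 2 ^ (?m * ?n)) ^ N * exp ((real ?m + real ?n) * real ?m * real ?n * t * real N)" .
          have "(2 * \<kappa>) powr (\<delta> * real N) * (2 * real (card Y)) ^ N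
            \<le> ((2 * L * t) ^ N * exp (- real ?m * real ?n * t * \<delta> * real N)) *
              ((2 * 2 ^ (?m * ?n)) ^ N * exp ((real ?m + real ?n) * real ?m * real ?n * t * real N))"
            using Lt by (intro mult_mono 1 2) auto
          also have "\<dots> = (w * t) ^ N * exp ((real ?m + real ?n - \<delta>) * real ?m * real ?n * t * real N)"
          proof -
            have e1: "(2 * L * t) ^ N * (2 * 2 ^ (?m * ?n)) ^ N = (w * t) ^ N"
              unfolding power_mult_distrib[symmetric] by (simp add: w_def mult_ac)
            have e2: "exp (- real ?m * real ?n * t * \<delta> * real N) * exp ((real ?m + real ?n) * real ?m * real ?n * t * real N)
              = exp ((real ?m + real ?n - \<delta>) * real ?m * real ?n * t * real N)"
              unfolding exp_add[symmetric] by (simp add: algebra_simps)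
            have "(a * b) * (c * d) = (a * c) * (b * d)" for a b c d :: real by (simp only: mult_ac)
            then show ?thesis by (simp only: e1 e2)
          qed
          also have "(w * t) ^ N \<le> t ^ (3 * N)"
          proof -
            \<comment> \<open>One factor \<open>t\<close> pays for all constants.\<close>
            have "w * t \<le> t * t" using tw t1 by (intro mult_right_mono) auto
            also have "\<dots> \<le> t ^ 3" using power_increasing[of 2 3 t] t1 by (simp add: power2_eq_square)
            finally have "(w * t) ^ N \<le> (t ^ 3) ^ N" using wL L1 t1 by (intro power_mono) auto
            then show ?thesis by (simp add: power_mult)
          qed
          finally show ?thesis by (simp add: mult_right_mono)
        qed
        have "card S \<le> card (\<Union>c\<in>E. (\<lambda>z. c + z) ` W c)" unfolding S_def by (rule card_image_le[OF finU])
        also have "\<dots> \<le> (\<Sum>c\<in>E. card ((\<lambda>z. c + z) ` W c))" by (rule card_UN_le[OF finE])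
        also have "\<dots> \<le> (\<Sum>c\<in>E. card (W c))" by (intro sum_mono card_image_le W)
        finally have "real (card S) \<le> (\<Sum>c\<in>E. real (card (W c)))" by (simp flip: of_nat_sum)
        also have "\<dots> \<le> (\<Sum>c\<in>E. ?F * height C 1 (xc c))"
        proof (rule sum_mono)
          fix c
          have "(if M < height C e (xc c) then height C e (xc c) / M else 1) \<le> height C e (xc c)"
            using h1[of e "xc c"] M(2) by (auto simp: divide_le_eq mult_le_cancel_left1)
          also have "\<dots> \<le> height C 1 (xc c)" by (rule height_mono[OF C xcX e])
          finally have g: "(if M < height C e (xc c) then height C e (xc c) / M else 1) \<le> height C 1 (xc c)" .
          have "0 \<le> (if M < height C e (xc c) then height C e (xc c) / M else 1)"
            using M(2) h1[of e "xc c"] by auto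
          then have "(2 * \<kappa>) powr (\<delta> * real N) * (2 * real (card Y)) ^ N * (if M < height C e (xc c) then height C e (xc c) / M else 1)
            \<le> ?F * height C 1 (xc c)"
            using t1 by (intro mult_mono fac g) auto
          then show "real (card (W c)) \<le> ?F * height C 1 (xc c)" using W(2)[of c] by linarith
        qed
        also have "\<dots> = ?F * (Cx x - 1)" by (simp add: Cx_def xc_def sum_distrib_left)
        also have "\<dots> \<le> ?F * Cx x" using t1 by (intro mult_left_mono) auto
        finally show "real (card S) \<le> Cx x * t ^ (3 * N) *
            exp ((real ?m + real ?n - \<delta>) * real ?m * real ?n * t * real N)" by (simp add: mult_ac)
        show "Zset x Q N t \<delta> \<subseteq> (\<Union>c\<in>S. ballU c (exp (- (real ?m + real ?n) * t * real N)))"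
        proof
          fix u assume "u \<in> Zset x Q N t \<delta>"
          then obtain s :: "real^'n^'m" where s: "u = umat s" "norm s < 1"
            "\<delta> \<le> 1 / real N * real (card {l \<in> {1..N}. act (gmat (t * real l)) (act (umat s) x) \<notin> Q})"
            by (auto simp: Zset_def BU_def)
          have sb: "\<bar>s $ a $ b\<bar> \<le> 1" for a b
            using component_le_norm_cart[of "s $ a" b] Finite_Cartesian_Product.norm_nth_le[of s a] s(2) by linarith
          obtain c where c: "c \<in> E" "\<And>a b. \<bar>s $ a $ b - c $ a $ b\<bar> \<le> 1 / real K0"
            unfolding E_def using mgrid_cover[OF zero_less_one sb K0(1)] by metis
          have "\<bar>(s - c) $ a $ b\<bar> \<le> \<epsilon>" for a b using c(2)[of a b] K0(2) by simp
          moreover have "act (umat (s - c)) (xc c) = act (umat s) x"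
            by (simp add: xc_def act_act umat_add)
          then have "\<delta> * real N \<le> real (card {l\<in>{1..N}. act (gmat (t * real l)) (act (umat (s - c)) (xc c)) \<notin> Q})"
            using s(3) N by (simp add: field_simps)
          ultimately obtain z where z: "z \<in> W c" "\<And>a b. \<bar>(s - c) $ a $ b - z $ a $ b\<bar> \<le> \<epsilon> * exp (- ?T * real N)"
            using W3[of "s - c" c] by blast
          \<comment> \<open>The choice of \<open>\<epsilon>\<close> turns closeness of the entries
            into a strict bound on the Euclidean norm.\<close>
          have "norm (s - (c + z)) \<le> real ?m * real ?n * (\<epsilon> * exp (- ?T * real N))"
            using z(2) by (intro norm_matrix_le) (simp add: algebra_simps)
          also have "\<dots> = (real ?m * real ?n * \<epsilon>) * exp (- ?T * real N)" by simp
          also have "\<dots> < 1 * exp (- ?T * real N)" using eps(3) by (intro mult_strict_right_mono) auto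
          finally have "norm ((c + z) - s) < exp (- (real ?m + real ?n) * t * real N)"
            by (simp only: norm_minus_commute minus_mult_left mult_1)
          then have "u \<in> ballU (umat (c + z)) (exp (- (real ?m + real ?n) * t * real N))"
            by (simp add: ballU_def dU_def USub_def s(1))
          moreover have "umat (c + z) \<in> S" using c z by (auto simp: S_def)
          ultimately show "u \<in> (\<Union>c\<in>S. ballU c (exp (- (real ?m + real ?n) * t * real N)))" by blast
        qed
      qed
    qed
  qed
  have "0 < w" using wL L1 by linarith
  then show ?thesis using Cx1 main by (intro exI[of _ w] exI[of _ Cx]) blast
qed

end
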